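(* Let $\omega_1=1$ and $\omega_2=\tau=\frac12+ib$ with $b>0$, and regard $e_1$, $\eta_1$ and the theta values $\vartheta_j(0)=\vartheta_j(0;\tau)$ as functions of $b$. Then: (1) $\displaystyle\frac{d}{db}(e_1+\eta_1)=-4\pi\frac{d^2}{db^2}\log|\vartheta_2(0)|>0$. (2) $\displaystyle\frac12e_1-\eta_1=4\pi\frac{d}{db}\log|\vartheta_3(0)|<0$ and $\displaystyle\frac{d^2}{db^2}\log|\vartheta_3(0)|>0$. The same holds for $\vartheta_4(0)=\overline{\vartheta_3(0)}$. In particular, $e_1$ increases in $b$.
   Context: $\wp$ and $\zeta$ ($\zeta'=-\wp$, $\zeta$ odd) are the Weierstrass functions of the lattice $\mathbb{Z}+\mathbb{Z}\tau$; $e_1=\wp(\frac12)$ and $\eta_1=2\zeta(\frac12)=\zeta(z+1)-\zeta(z)$. With $q=e^{\pi i\tau}$, the theta functions are $\vartheta_1(z;\tau)=2\sum_{n\ge0}(-1)^nq^{(n+\frac12)^2}\sin(2n+1)\pi z$ (where $q^{(n+1/2)^2}=e^{\pi i\tau(n+1/2)^2}$), $\vartheta_2(z;\tau)=\vartheta_1(z+\frac12;\tau)$, $\vartheta_4(z;\tau)=\sum_{n\in\mathbb{Z}}(-1)^nq^{n^2}e^{2\pi inz}$, $\vartheta_3(z;\tau)=\vartheta_4(z+\frac12;\tau)=\sum_{n\in\mathbb{Z}}q^{n^2}e^{2\pi inz}$. *)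

theory Defs
  imports "HOL-Complex_Analysis.Complex_Analysis"
begin

section \<open>Weierstrass functions of the lattice generated by 1 and \<open>\<tau>\<close>\<close>

definition period_lattice :: "complex \<Rightarrow> complex set" where
  "period_lattice \<tau> = {of_int m + of_int n * \<tau> | m n. True}"

text \<open>For non-real \<open>\<tau>\<close> both series below converge absolutely off the lattice. Values at lattice points
  are artefacts of division by zero. The odd primitive of \<open>-\<wp>\<close> is unique, and
  \<open>weierstrass_zeta_minus\<close> and \<open>has_field_derivative_weierstrass_zeta\<close> show that it is
  \<open>weierstrass_zeta\<close>.\<close>

definition weierstrass_p :: "complex \<Rightarrow> complex \<Rightarrow> complex" where
  "weierstrass_p \<tau> z =
     1 / z\<^sup>2 + (\<Sum>\<^sub>\<infinity>\<omega>\<in>period_lattice \<tau> - {0}. 1 / (z - \<omega>)\<^sup>2 - 1 / \<omega>\<^sup>2)"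

definition weierstrass_zeta :: "complex \<Rightarrow> complex \<Rightarrow> complex" where
  "weierstrass_zeta \<tau> z =
     1 / z + (\<Sum>\<^sub>\<infinity>\<omega>\<in>period_lattice \<tau> - {0}. 1 / (z - \<omega>) + 1 / \<omega> + z / \<omega>\<^sup>2)"

definition weierstrass_e1 :: "complex \<Rightarrow> complex" where
  "weierstrass_e1 \<tau> = weierstrass_p \<tau> (1 / 2)"

definition weierstrass_eta1 :: "complex \<Rightarrow> complex" where
  "weierstrass_eta1 \<tau> = 2 * weierstrass_zeta \<tau> (1 / 2)"

section \<open>Theta functions\<close>

text \<open>The argument order is \<open>\<vartheta>\<^sub>j z \<tau>\<close>. A power \<open>q\<^bsup>a\<^esup>\<close> of \<open>q = exp (\<pi> \<i> \<tau>)\<close> always means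
  \<open>exp (\<pi> \<i> \<tau> a)\<close>, also for fractional exponents.\<close>

definition theta1 :: "complex \<Rightarrow> complex \<Rightarrow> complex" where
  "theta1 z \<tau> = 2 * (\<Sum>n::nat. (-1) ^ n * exp (of_real pi * \<i> * \<tau> * (of_nat n + 1 / 2)\<^sup>2)
                              * sin (of_nat (2 * n + 1) * of_real pi * z))"

definition theta2 :: "complex \<Rightarrow> complex \<Rightarrow> complex" where
  "theta2 z \<tau> = theta1 (z + 1 / 2) \<tau>"

definition theta4 :: "complex \<Rightarrow> complex \<Rightarrow> complex" where
  "theta4 z \<tau> = (\<Sum>\<^sub>\<infinity>n::int. (-1) powi n * exp (of_real pi * \<i> * \<tau> * of_int (n\<^sup>2))
                              * exp (2 * of_real pi * \<i> * of_int n * z))"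

definition theta3 :: "complex \<Rightarrow> complex \<Rightarrow> complex" where
  "theta3 z \<tau> = theta4 (z + 1 / 2) \<tau>"

lemma theta3_series:
  "theta3 z \<tau> = (\<Sum>\<^sub>\<infinity>n::int. exp (of_real pi * \<i> * \<tau> * of_int (n\<^sup>2))
                              * exp (2 * of_real pi * \<i> * of_int n * z))"
proof -
  have half_period: "(-1) powi n * exp (2 * of_real pi * \<i> * of_int n * (z + 1 / 2))
                      = exp (2 * of_real pi * \<i> * of_int n * z)" for n :: int
  proof -
    have "exp (2 * of_real pi * \<i> * of_int n * (z + 1 / 2))
            = exp (2 * of_real pi * \<i> * of_int n * z) * exp (of_int n * (\<i> * of_real pi))"
      by (simp add: exp_add [symmetric] algebra_simps)
    also have "exp (of_int n * (\<i> * of_real pi)) = ((-1) powi n :: complex)"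
      using exp_power_int [of "\<i> * of_real pi" n] by simp
    finally have "(-1) powi n * exp (2 * of_real pi * \<i> * of_int n * (z + 1 / 2))
        = exp (2 * of_real pi * \<i> * of_int n * z) * ((-1) powi n * (-1) powi n)"
      by (simp only: mult_ac)
    also have "(-1) powi n * (-1) powi n = (1 :: complex)"
      by (simp add: power_int_mult_distrib [symmetric])
    finally show ?thesis by simp
  qed
  show ?thesis
    unfolding theta3_def theta4_def
  proof (rule infsum_cong)
    fix n :: int
    show "(-1) powi n * exp (of_real pi * \<i> * \<tau> * of_int (n\<^sup>2))
            * exp (2 * of_real pi * \<i> * of_int n * (z + 1 / 2))
          = exp (of_real pi * \<i> * \<tau> * of_int (n\<^sup>2)) * exp (2 * of_real pi * \<i> * of_int n * z)"
      by (subst half_period [symmetric]) (simp only: mult_ac)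
  qed
qed

section \<open>The Weierstrass zeta function is the odd primitive of \<open>-\<wp>\<close>\<close>

lemma period_lattice_uminus: "\<omega> \<in> period_lattice \<tau> \<Longrightarrow> -\<omega> \<in> period_lattice \<tau>"
proof -
  assume "\<omega> \<in> period_lattice \<tau>"
  then obtain m n where "\<omega> = of_int m + of_int n * \<tau>"
    by (auto simp: period_lattice_def)
  then have "-\<omega> = of_int (-m) + of_int (-n) * \<tau>"
    by simp
  then show ?thesis
    unfolding period_lattice_def by blast
qed

lemma weierstrass_zeta_minus: "weierstrass_zeta \<tau> (-z) = - weierstrass_zeta \<tau> z"
proof -
  let ?L = "period_lattice \<tau> - {0}"
  have odd_term: "1 / (-z - -\<omega>) + 1 / -\<omega> + -z / (-\<omega>)\<^sup>2 = - (1 / (z - \<omega>) + 1 / \<omega> + z / \<omega>\<^sup>2)" for \<omega>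
  proof -
    have "-z - -\<omega> = -(z - \<omega>)" by simp
    then show ?thesis by (simp only: divide_minus_right) simp
  qed
  have "(\<Sum>\<^sub>\<infinity>\<omega>\<in>?L. 1 / (-z - \<omega>) + 1 / \<omega> + -z / \<omega>\<^sup>2)
          = (\<Sum>\<^sub>\<infinity>\<omega>\<in>?L. - (1 / (z - \<omega>) + 1 / \<omega> + z / \<omega>\<^sup>2))"
  proof (rule infsum_reindex_bij_witness [where i = uminus and j = uminus])
    fix \<omega>
    show "- (1 / (z - -\<omega>) + 1 / -\<omega> + z / (-\<omega>)\<^sup>2) = 1 / (-z - \<omega>) + 1 / \<omega> + -z / \<omega>\<^sup>2"
      using odd_term [of "-\<omega>"] by (simp only: minus_minus)
  qed (simp_all add: period_lattice_uminus)
  also have "\<dots> = - (\<Sum>\<^sub>\<infinity>\<omega>\<in>?L. 1 / (z - \<omega>) + 1 / \<omega> + z / \<omega>\<^sup>2)"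
    by (rule infsum_uminus)
  finally show ?thesis
    by (simp add: weierstrass_zeta_def)
qed

lemma period_lattice_coords_bound:
  assumes "Im \<tau> \<noteq> 0"
  obtains K where "K > 0"
    "\<And>m n. real_of_int \<bar>m\<bar> \<le> K * norm (of_int m + of_int n * \<tau>)"
    "\<And>m n. real_of_int \<bar>n\<bar> \<le> K * norm (of_int m + of_int n * \<tau>)"
proof
  define A where "A = 1 / \<bar>Im \<tau>\<bar>"
  have A: "A > 0" using assms by (simp add: A_def)
  let ?K = "1 + A + A * norm \<tau>"
  show "?K > 0" using A by (simp add: add_pos_nonneg)
  fix m n :: int
  let ?w = "of_int m + of_int n * \<tau>"
  have "\<bar>real_of_int n * Im \<tau>\<bar> \<le> norm ?w"
    using abs_Im_le_cmod [of ?w] by simp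
  then have n: "\<bar>real_of_int n\<bar> \<le> A * norm ?w"
    using assms by (simp add: A_def abs_mult field_simps)
  have "norm (of_int m :: complex) = norm (?w - of_int n * \<tau>)" by simp
  also have "\<dots> \<le> norm ?w + \<bar>real_of_int n\<bar> * norm \<tau>"
    using norm_triangle_ineq4 [of ?w "of_int n * \<tau>"] by (simp add: norm_mult)
  also have "\<dots> \<le> norm ?w + A * norm ?w * norm \<tau>"
    using n by (simp add: mult_right_mono)
  finally have m: "\<bar>real_of_int m\<bar> \<le> norm ?w + A * norm ?w * norm \<tau>" by simp
  have "0 \<le> A * norm ?w" "0 \<le> A * norm ?w * norm \<tau>" using A by simp_all
  with m n show "real_of_int \<bar>m\<bar> \<le> ?K * norm ?w" "real_of_int \<bar>n\<bar> \<le> ?K * norm ?w"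
    by (simp_all add: algebra_simps)
qed

lemma finite_period_lattice_cball:
  assumes "Im \<tau> \<noteq> 0"
  shows "finite {\<omega> \<in> period_lattice \<tau>. norm \<omega> \<le> R}"
proof -
  obtain K where K: "K > 0"
    "\<And>m n. real_of_int \<bar>m\<bar> \<le> K * norm (of_int m + of_int n * \<tau>)"
    "\<And>m n. real_of_int \<bar>n\<bar> \<le> K * norm (of_int m + of_int n * \<tau>)"
    using period_lattice_coords_bound [OF assms] by metis
  define N where "N = \<lfloor>K * R\<rfloor>"
  have "{\<omega> \<in> period_lattice \<tau>. norm \<omega> \<le> R}
          \<subseteq> (\<lambda>(m, n). of_int m + of_int n * \<tau>) ` ({-N..N} \<times> {-N..N})"
  proof
    fix \<omega> assume \<omega>: "\<omega> \<in> {\<omega> \<in> period_lattice \<tau>. norm \<omega> \<le> R}"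
    then obtain m n where mn: "\<omega> = of_int m + of_int n * \<tau>"
      by (auto simp: period_lattice_def)
    have "K * norm \<omega> \<le> K * R" using \<omega> K(1) by simp
    then have "real_of_int \<bar>m\<bar> \<le> K * R" "real_of_int \<bar>n\<bar> \<le> K * R"
      using K(2) [of m n] K(3) [of n m] unfolding mn by linarith+
    then have "\<bar>m\<bar> \<le> N" "\<bar>n\<bar> \<le> N"
      unfolding N_def by (simp_all add: le_floor_iff)
    then show "\<omega> \<in> (\<lambda>(m, n). of_int m + of_int n * \<tau>) ` ({-N..N} \<times> {-N..N})"
      unfolding mn by (intro image_eqI [where x = "(m, n)"]) auto
  qed
  then show ?thesis by (rule finite_subset) simp
qed

lemma summable_on_int_powr: "(\<lambda>i::int. (1 + \<bar>real_of_int i\<bar>) powr (-3/2)) summable_on UNIV"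
proof -
  let ?g = "\<lambda>i::int. (1 + \<bar>real_of_int i\<bar>) powr (-3/2)"
  have "summable (\<lambda>n. real (Suc n) powr (-3/2))"
    by (subst summable_Suc_iff) (simp add: summable_real_powr_iff)
  then have nat: "(\<lambda>n. (1 + real n) powr (-3/2)) summable_on UNIV"
    by (subst summable_on_UNIV_nonneg_real_iff) (simp_all add: add.commute)
  have "?g summable_on range int"
    by (subst summable_on_reindex) (use nat in \<open>simp_all add: o_def inj_on_def\<close>)
  moreover have "?g summable_on range (\<lambda>n. - int n)"
    by (subst summable_on_reindex) (use nat in \<open>simp_all add: o_def inj_on_def\<close>)
  moreover have "range int \<union> range (\<lambda>n. - int n) = UNIV"
    by (auto simp: image_iff) (metis int_cases2)
  ultimately show ?thesis
    by (metis summable_on_union)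
qed

lemma summable_on_period_lattice_cube:
  assumes "Im \<tau> \<noteq> 0"
  shows "(\<lambda>\<omega>. 1 / norm \<omega> ^ 3) summable_on (period_lattice \<tau> - {0})"
proof -
  obtain K where K: "K > 0"
    "\<And>m n. real_of_int \<bar>m\<bar> \<le> K * norm (of_int m + of_int n * \<tau>)"
    "\<And>m n. real_of_int \<bar>n\<bar> \<le> K * norm (of_int m + of_int n * \<tau>)"
    using period_lattice_coords_bound [OF assms] by metis
  define g where "g = (\<lambda>i::int. (1 + \<bar>real_of_int i\<bar>) powr (-3/2))"
  define h where "h = (\<lambda>(m::int, n::int). of_int m + of_int n * \<tau>)"
  let ?I = "UNIV - {(0::int, 0::int)}"
  obtain S where S: "(g has_sum S) UNIV"
    using summable_on_int_powr unfolding g_def summable_on_def by blast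
  have "(\<lambda>(m, n). g m * g n) summable_on (UNIV \<times> UNIV)"
  proof (rule summable_on_SigmaI [where g = "\<lambda>m. g m * S"])
    show "((\<lambda>n. case (m, n) of (m, n) \<Rightarrow> g m * g n) has_sum g m * S) UNIV" for m
      using has_sum_cmult_right [OF S] by simp
    show "(\<lambda>m. g m * S) summable_on UNIV"
      using has_sum_cmult_left [OF S] unfolding summable_on_def by blast
  qed (simp add: g_def)
  then have "(\<lambda>(m, n). g m * g n) summable_on ?I"
    by (rule summable_on_subset) simp
  then have "(\<lambda>x. (2 * K) ^ 3 * (case x of (m, n) \<Rightarrow> g m * g n)) summable_on ?I"
    by (rule summable_on_cmult_right)
  then have "(\<lambda>x. 1 / norm (h x) ^ 3) summable_on ?I"
  proof (rule summable_on_comparison_test)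
    fix x assume x: "x \<in> ?I"
    obtain m n where mn: "x = (m, n)" by (cases x)
    define X where "X = 2 * K * norm (h x)"
    have b: "\<bar>real_of_int m\<bar> \<le> K * norm (h x)" "\<bar>real_of_int n\<bar> \<le> K * norm (h x)"
      using K(2) [of m n] K(3) [of n m] by (simp_all add: h_def mn)
    have "1 \<le> \<bar>m\<bar> \<or> 1 \<le> \<bar>n\<bar>" using x mn by auto
    then have "1 \<le> K * norm (h x)" using b by linarith
    then have X: "1 + \<bar>real_of_int m\<bar> \<le> X" "1 + \<bar>real_of_int n\<bar> \<le> X" "X > 0"
      using b by (simp_all add: X_def)
    have "X powr (-3/2) \<le> g m" "X powr (-3/2) \<le> g n"
      unfolding g_def using X by (auto intro!: powr_mono2')
    then have "X powr (-3/2) * X powr (-3/2) \<le> g m * g n"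
      by (intro mult_mono) (auto simp: g_def)
    also have "X powr (-3/2) * X powr (-3/2) = X powr (-3)"
      by (simp add: powr_add [symmetric])
    also have "\<dots> = 1 / X ^ 3"
      using X by (simp add: powr_minus powr_numeral divide_inverse)
    finally have "1 / X ^ 3 \<le> g m * g n" .
    moreover have "1 / norm (h x) ^ 3 = (2 * K) ^ 3 * (1 / X ^ 3)"
      using K(1) by (simp add: X_def power_mult_distrib)
    ultimately show "1 / norm (h x) ^ 3 \<le> (2 * K) ^ 3 * (case x of (m, n) \<Rightarrow> g m * g n)"
      using K(1) mult_left_mono [of "1 / X ^ 3" "g m * g n" "(2 * K) ^ 3"] by (simp add: mn)
  qed simp
  moreover have "inj_on h ?I"
  proof (rule inj_onI)
    fix x y assume eq: "h x = h y"
    obtain m n m' n' where xy: "x = (m, n)" "y = (m', n')" by (cases x, cases y)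
    have "Im (h x) = Im (h y)" "Re (h x) = Re (h y)" using eq by simp_all
    then show "x = y" using assms by (auto simp: h_def xy)
  qed
  moreover have "h ` ?I = period_lattice \<tau> - {0}"
  proof -
    have zero: "m = 0 \<and> n = 0" if "of_int m + of_int n * \<tau> = 0" for m n :: int
      using K(2) [of m n] K(3) [of n m] unfolding that by simp
    show ?thesis
    proof (intro equalityI subsetI)
      fix \<omega> assume "\<omega> \<in> h ` ?I"
      then show "\<omega> \<in> period_lattice \<tau> - {0}"
        using zero by (auto simp: h_def period_lattice_def)
    next
      fix \<omega> assume \<omega>: "\<omega> \<in> period_lattice \<tau> - {0}"
      then obtain m n where "\<omega> = of_int m + of_int n * \<tau>"
        by (auto simp: period_lattice_def)
      then show "\<omega> \<in> h ` ?I"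
        using \<omega> by (intro image_eqI [where x = "(m, n)"]) (auto simp: h_def)
    qed
  qed
  ultimately show ?thesis
    using summable_on_reindex [of h ?I "\<lambda>\<omega>. 1 / norm \<omega> ^ 3"] by (simp add: o_def)
qed

theorem has_field_derivative_weierstrass_zeta:
  assumes \<tau>: "Im \<tau> \<noteq> 0" and z: "z \<notin> period_lattice \<tau>"
  shows "(weierstrass_zeta \<tau> has_field_derivative - weierstrass_p \<tau> z) (at z)"
proof -
  let ?L = "period_lattice \<tau> - {0}"
  let ?u = "\<lambda>\<omega> w::complex. 1 / (w - \<omega>) + 1 / \<omega> + w / \<omega>\<^sup>2"
  let ?v = "\<lambda>\<omega> w::complex. - (1 / (w - \<omega>)\<^sup>2) + 1 / \<omega>\<^sup>2"
  have "0 \<in> period_lattice \<tau>"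
    unfolding period_lattice_def by (auto intro!: exI [of _ 0])
  with z have z0: "z \<noteq> 0" by auto
  define R where "R = norm z + 1"
  have R: "R > 0" by (simp add: R_def add_nonneg_pos)
  define B where "B = {\<omega> \<in> period_lattice \<tau>. norm \<omega> \<le> 2 * R}"
  have "finite B" unfolding B_def by (rule finite_period_lattice_cball [OF \<tau>])
  moreover have "z \<notin> B" using z by (simp add: B_def)
  ultimately obtain d where d: "d > 0" "\<And>\<omega>. \<omega> \<in> B \<Longrightarrow> d \<le> dist z \<omega>"
    using finite_set_avoid [of B z] by metis
  define r where "r = min 1 (d / 2)"
  have r: "r > 0" "r \<le> 1" "r \<le> d / 2" using d(1) by (auto simp: r_def)
  define c where "c = min (1 / 2) (d / 2 / (2 * R))"
  have c: "c > 0" "c \<le> 1 / 2" "c \<le> d / 2 / (2 * R)" using d(1) R by (auto simp: c_def)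
  have wR: "norm w \<le> R" if "w \<in> cball z r" for w
  proof -
    have "norm w \<le> norm z + dist z w"
      by (metis dist_norm norm_minus_commute norm_triangle_sub)
    then show ?thesis using that r by (simp add: R_def)
  qed
  have sep: "c * norm \<omega> \<le> norm (w - \<omega>)" if w: "w \<in> cball z r" and \<omega>: "\<omega> \<in> ?L" for w \<omega>
  proof (cases "\<omega> \<in> B")
    case True
    have "d \<le> dist z w + norm (w - \<omega>)"
      using d(2) [OF True] dist_triangle [of z \<omega> w] by (simp add: dist_norm)
    then have "d / 2 \<le> norm (w - \<omega>)" using w r by simp
    moreover have "c * norm \<omega> \<le> d / 2 / (2 * R) * (2 * R)"
      using True c R by (intro mult_mono) (auto simp: B_def)
    ultimately show ?thesis using R by simp
  next
    case False
    then have "norm \<omega> > 2 * R" using \<omega> by (auto simp: B_def)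
    then have "norm w \<le> norm \<omega> / 2" using wR [OF w] by simp
    moreover have "norm \<omega> \<le> norm (w - \<omega>) + norm w"
      by (metis norm_minus_commute norm_triangle_sub add.commute)
    moreover have "c * norm \<omega> \<le> 1 / 2 * norm \<omega>"
      using c by (intro mult_right_mono) auto
    ultimately show ?thesis by simp
  qed
  have nz: "w - \<omega> \<noteq> 0" if "w \<in> cball z r" "\<omega> \<in> ?L" for w \<omega>
    using sep [OF that] that(2) c(1) by (auto simp: mult_le_0_iff)
  have bound: "norm (?u \<omega> w) \<le> R\<^sup>2 / c * (1 / norm \<omega> ^ 3)"
    if \<omega>: "\<omega> \<in> ?L" and w: "w \<in> cball z r" for \<omega> w
  proof -
    have \<omega>0: "\<omega> \<noteq> 0" using \<omega> by simp
    have "?u \<omega> w = w\<^sup>2 / (\<omega>\<^sup>2 * (w - \<omega>))"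
      using \<omega>0 nz [OF w \<omega>] by (simp add: divide_simps) (simp add: algebra_simps power2_eq_square power3_eq_cube)
    then have "norm (?u \<omega> w) = (norm w)\<^sup>2 / ((norm \<omega>)\<^sup>2 * norm (w - \<omega>))"
      by (simp add: norm_divide norm_mult norm_power)
    also have "\<dots> \<le> R\<^sup>2 / ((norm \<omega>)\<^sup>2 * (c * norm \<omega>))"
      using wR [OF w] sep [OF w \<omega>] \<omega>0 c(1)
      by (intro frac_le mult_left_mono power_mono) auto
    also have "\<dots> = R\<^sup>2 / c * (1 / norm \<omega> ^ 3)"
      by (simp add: power2_eq_square power3_eq_cube field_simps)
    finally show ?thesis .
  qed
  define s where "s = (\<lambda>w. \<Sum>\<^sub>\<infinity>\<omega>\<in>?L. ?u \<omega> w)"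
  have lim: "uniform_limit (cball z r) (\<lambda>X w. \<Sum>\<omega>\<in>X. ?u \<omega> w) s (finite_subsets_at_top ?L)"
    unfolding s_def
    using bound summable_on_cmult_right [OF summable_on_period_lattice_cube [OF \<tau>]]
    by (rule Weierstrass_m_test_general)
  have deriv_term: "(?u \<omega> has_field_derivative ?v \<omega> w) (at w)"
    if "w \<in> cball z r" "\<omega> \<in> ?L" for w \<omega>
    using nz [OF that] that(2) by (auto intro!: derivative_eq_intros simp: power2_eq_square)
  have partial: "eventually (\<lambda>X. continuous_on (cball z r) (\<lambda>w. \<Sum>\<omega>\<in>X. ?u \<omega> w) \<and>
      (\<forall>w\<in>ball z r. ((\<lambda>w. \<Sum>\<omega>\<in>X. ?u \<omega> w) has_field_derivative (\<Sum>\<omega>\<in>X. ?v \<omega> w)) (at w)))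
      (finite_subsets_at_top ?L)"
  proof (rule eventually_finite_subsets_at_top_weakI, intro conjI ballI)
    fix X assume X: "finite X" "X \<subseteq> ?L"
    show "continuous_on (cball z r) (\<lambda>w. \<Sum>\<omega>\<in>X. ?u \<omega> w)"
    proof (rule continuous_on_sum)
      fix \<omega> assume "\<omega> \<in> X"
      then have \<omega>: "\<omega> \<in> ?L" using X by auto
      show "continuous_on (cball z r) (?u \<omega>)"
        by (rule DERIV_continuous_on) (use deriv_term [OF _ \<omega>] in \<open>blast intro: has_field_derivative_at_within\<close>)
    qed
    fix w assume w: "w \<in> ball z r"
    show "((\<lambda>w. \<Sum>\<omega>\<in>X. ?u \<omega> w) has_field_derivative (\<Sum>\<omega>\<in>X. ?v \<omega> w)) (at w)"
    proof (rule DERIV_sum)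
      fix \<omega> assume "\<omega> \<in> X"
      then have \<omega>: "\<omega> \<in> ?L" using X by auto
      show "(?u \<omega> has_field_derivative ?v \<omega> w) (at w)"
        using w by (intro deriv_term [OF _ \<omega>]) auto
    qed
  qed
  have ntriv: "finite_subsets_at_top ?L \<noteq> bot" by simp
  obtain s' where s': "\<And>w. w \<in> ball z r \<Longrightarrow>
      (s has_field_derivative s' w) (at w) \<and>
      ((\<lambda>X. \<Sum>\<omega>\<in>X. ?v \<omega> w) \<longlongrightarrow> s' w) (finite_subsets_at_top ?L)"
    using has_complex_derivative_uniform_limit [OF partial lim ntriv r(1)] by blast
  have zr: "z \<in> ball z r" using r(1) by simp
  have "((\<lambda>\<omega>. ?v \<omega> z) has_sum s' z) ?L"
    using s' [OF zr] by (simp add: has_sum_def)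
  then have "((\<lambda>\<omega>. - ?v \<omega> z) has_sum - s' z) ?L"
    by (rule has_sum_uminusI)
  then have "((\<lambda>\<omega>. 1 / (z - \<omega>)\<^sup>2 - 1 / \<omega>\<^sup>2) has_sum - s' z) ?L"
    by simp
  then have "weierstrass_p \<tau> z = 1 / z\<^sup>2 - s' z"
    by (simp add: weierstrass_p_def infsumI)
  moreover have "weierstrass_zeta \<tau> = (\<lambda>w. 1 / w + s w)"
    by (simp add: weierstrass_zeta_def s_def fun_eq_iff)
  moreover have "((\<lambda>w. 1 / w + s w) has_field_derivative - (1 / z\<^sup>2) + s' z) (at z)"
    using s' [OF zr] z0 by (auto intro!: derivative_eq_intros simp: power2_eq_square)
  ultimately show ?thesis by simp
qed

end

theory Submission
  imports Defs
begin

text \<open>Write \<open>x = exp (-2\<pi>b)\<close>. On the line \<open>\<tau> = 1/2 + ib\<close> the number \<open>Q = exp (2\<pi>i\<tau>)\<close> equals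
  \<open>-x\<close>, so all quantities are real, and each of them is expressed by one function, the Lambert series
  \<open>\<Lambda>(y) = \<Sum>n\<ge>1. y^n / (1 - y^n)\<^sup>2\<close> at \<open>x\<close>, \<open>x\<^sup>2\<close> and \<open>x\<^sup>4\<close>.

  On the lattice side, summation along the rows \<open>n\<tau> + \<int>\<close> with the cosecant series gives
  \<open>\<eta>\<^sub>1 = \<pi>\<^sup>2/3 - 8\<pi>\<^sup>2 \<Lambda>(Q)\<close> and \<open>e\<^sub>1 + \<eta>\<^sub>1 = \<pi>\<^sup>2 + 8\<pi>\<^sup>2 (\<Lambda>(Q) - 4 \<Lambda>(Q\<^sup>2))\<close>
  (\<open>weierstrass_eta1_eq_lambert_sigma\<close>, \<open>weierstrass_e1_plus_eta1_eq_lambert_sigma\<close>), and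
  \<open>\<Lambda>(-x) = -\<Lambda>(x) + 6 \<Lambda>(x\<^sup>2) - 4 \<Lambda>(x\<^sup>4)\<close> (\<open>lambert_sigma_minus\<close>).

  On the theta side, let \<open>E(x) = \<Prod>n\<ge>1. 1 - x^n\<close>. The Jacobi triple product yields
  \<open>|\<vartheta>\<^sub>3(0)| = E(x\<^sup>2)^5 / (E(x)\<^sup>2 E(x\<^sup>4)\<^sup>2)\<close> and
  \<open>|\<vartheta>\<^sub>2(0)| = 2 exp (-\<pi>b/4) E(x) E(x\<^sup>4) / E(x\<^sup>2)\<close>. Because the derivative of \<open>log E(exp (-2\<pi>b))\<close> is
  \<open>2\<pi> \<Lambda>(x)\<close> (\<open>has_real_derivative_euler_log\<close>), the logarithmic derivatives of the theta constants are
  combinations of the same three values, and the two identities follow by comparing coefficients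
  (\<open>e1_plus_eta1_half_tau\<close>, \<open>half_e1_minus_eta1_half_tau\<close>).

  The signs come from series of exponentials in \<open>b\<close> with positive coefficients. The derivative of \<open>log |\<vartheta>\<^sub>2(0)|\<close> is
  \<open>-\<pi>/4\<close> plus \<open>2\<pi>\<close> times the sum of \<open>m exp (-2\<pi>bmn)\<close> over \<open>n \<ge> 1\<close> and over those
  \<open>m \<ge> 1\<close> that are odd or divisible by 4, so it decreases strictly. Moreover \<open>|\<vartheta>\<^sub>3(0)|\<close> is the sum of
  \<open>exp (-2\<pi>b j\<^sup>2)\<close> over \<open>j \<in> \<int>\<close> (\<open>norm_theta3_half_tau\<close>), which is decreasing and strictly log-convex by the
  Cauchy-Schwarz inequality. Finally, \<open>3/2 e\<^sub>1\<close> is the sum of \<open>e\<^sub>1 + \<eta>\<^sub>1\<close> and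
  \<open>e\<^sub>1/2 - \<eta>\<^sub>1\<close>, which both increase.\<close>

section \<open>Sums over the integers and the cosecant series\<close>

text \<open>Sums over \<open>\<int>\<close> are computed below from one-sided ones, and
  \<open>-n - 1\<close> is the enumeration of the negative half that misses 0.\<close>
lemma has_sum_int_split:
  fixes f :: "int \<Rightarrow> 'a::{topological_comm_monoid_add,t3_space}"
  assumes "((\<lambda>n. f (int n)) has_sum a) UNIV" "((\<lambda>n. f (- int n - 1)) has_sum b) UNIV"
  shows "(f has_sum (a + b)) UNIV"
proof -
  have "(f has_sum a) (range int)"
    using assms(1) by (subst has_sum_reindex) (auto simp: o_def)
  moreover have "(f has_sum b) (range (\<lambda>n. - int n - 1))"
    using assms(2) by (subst has_sum_reindex) (auto simp: o_def inj_on_def)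
  moreover have "range int \<inter> range (\<lambda>n. - int n - 1) = {}"
    by auto
  ultimately have "(f has_sum (a + b)) (range int \<union> range (\<lambda>n. - int n - 1))"
    by (rule has_sum_Un_disjoint)
  moreover have "range int \<union> range (\<lambda>n. - int n - 1) = UNIV"
  proof -
    have "k \<in> range int \<union> range (\<lambda>n. - int n - 1)" for k
    proof (cases "k \<ge> 0")
      case True
      then have "k = int (nat k)" by simp
      then show ?thesis by blast
    next
      case False
      then have "k = - int (nat (- k - 1)) - 1" by simp
      then show ?thesis by blast
    qed
    then show ?thesis by blast
  qed
  ultimately show ?thesis by simp
qed

lemma has_sum_int_abs:
  fixes h :: "nat \<Rightarrow> 'a::real_normed_field"
  assumes "(h has_sum S) {1..}"
  shows "((\<lambda>n::int. h (nat \<bar>n\<bar>)) has_sum (h 0 + 2 * S)) UNIV"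
proof -
  have 1: "((\<lambda>n. h (Suc n)) has_sum S) UNIV"
    using assms by (subst has_sum_reindex_bij_witness[of _ "\<lambda>n. n - 1" Suc "{1..}" h]) auto
  have "(h has_sum (h 0 + S)) (insert 0 {1..})"
    using assms by (intro has_sum_insert) auto
  moreover have "insert 0 {1..} = (UNIV :: nat set)" by auto
  ultimately have 2: "(h has_sum (h 0 + S)) UNIV" by simp
  have "((\<lambda>n::int. h (nat \<bar>n\<bar>)) has_sum ((h 0 + S) + S)) UNIV"
  proof (rule has_sum_int_split)
    have "nat \<bar>- int n - 1\<bar> = Suc n" for n by linarith
    then show "((\<lambda>n. h (nat \<bar>- int n - 1\<bar>)) has_sum S) UNIV" using 1 by simp
  qed (use 2 in simp)
  then show ?thesis by (simp add: algebra_simps)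
qed

text \<open>The logarithmic derivative of Euler's reflection formula \<open>\<Gamma>(z) \<Gamma>(1 - z) = \<pi> / sin \<pi>z\<close>
  expresses \<open>\<psi>(z) - \<psi>(1 - z)\<close> by the cotangent; one more derivative gives the trigamma function.\<close>
lemma Polygamma_1_reflection:
  fixes z :: complex
  assumes "z \<notin> \<int>"
  shows "Polygamma 1 z + Polygamma 1 (1 - z) = of_real pi ^ 2 / sin (of_real pi * z) ^ 2"
proof -
  have nonpos: "w \<notin> \<int>\<^sub>\<le>\<^sub>0" "1 - w \<notin> \<int>\<^sub>\<le>\<^sub>0" "w \<notin> \<int>" "1 - w \<notin> \<int>"
     "sin (of_real pi * w) \<noteq> 0" if "w \<in> - \<int>" for w :: complex
  proof -
    show w: "w \<notin> \<int>" using that by simp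
    show w': "1 - w \<notin> \<int>"
    proof
      assume "1 - w \<in> \<int>"
      then have "1 - (1 - w) \<in> \<int>" by (rule Ints_diff[OF Ints_1])
      then show False using w by simp
    qed
    show "w \<notin> \<int>\<^sub>\<le>\<^sub>0" "1 - w \<notin> \<int>\<^sub>\<le>\<^sub>0" using w w' nonpos_Ints_Int by blast+
    show "sin (of_real pi * w) \<noteq> 0" 
    proof
      assume "sin (of_real pi * w) = 0"
      then obtain n :: int where "of_real pi * w = of_real (real_of_int n * pi)"
        by (auto simp: sin_eq_0)
      then have "w = of_int n" by simp
      then show False using w by simp
    qed
  qed
  have Digamma: "Digamma w - Digamma (1 - w) = - (of_real pi * cos (of_real pi * w) / sin (of_real pi * w))"
    if w: "w \<in> - \<int>" for w :: complex
  proof -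
    note [simp] = nonpos[OF w]
    have G: "Gamma w \<noteq> 0" "Gamma (1 - w) \<noteq> 0" by (simp_all add: Gamma_eq_zero_iff)
    have "((\<lambda>w. Gamma w * Gamma (1 - w)) has_field_derivative
            Gamma w * Digamma w * Gamma (1 - w) - Gamma w * (Gamma (1 - w) * Digamma (1 - w))) (at w)"
      by (auto intro!: derivative_eq_intros simp: algebra_simps)
    moreover have "(\<lambda>w. Gamma w * Gamma (1 - w)) = (\<lambda>w::complex. of_real pi / sin (of_real pi * w))"
      by (auto simp: Gamma_reflection_complex)
    moreover have "((\<lambda>w. of_real pi / sin (of_real pi * w)) has_field_derivative
            - (of_real pi * (of_real pi * cos (of_real pi * w))) / sin (of_real pi * w) ^ 2) (at w)"
      using nonpos(5)[OF w] by (auto intro!: derivative_eq_intros simp: algebra_simps power2_eq_square)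
    ultimately have "Gamma w * Digamma w * Gamma (1 - w) - Gamma w * (Gamma (1 - w) * Digamma (1 - w))
          = - (of_real pi * (of_real pi * cos (of_real pi * w))) / sin (of_real pi * w) ^ 2"
      using DERIV_unique by metis
    then have "(Gamma w * Gamma (1 - w)) * (Digamma w - Digamma (1 - w))
          = - (of_real pi * (of_real pi * cos (of_real pi * w))) / sin (of_real pi * w) ^ 2"
      by (simp add: algebra_simps)
    also have "Gamma w * Gamma (1 - w) = of_real pi / sin (of_real pi * w)"
      by (rule Gamma_reflection_complex)
    finally have eq: "of_real pi / sin (of_real pi * w) * (Digamma w - Digamma (1 - w))
          = - (of_real pi * (of_real pi * cos (of_real pi * w))) / sin (of_real pi * w) ^ 2" .
    have "A = - (p * c / s)" if "p / s * A = - (p * (p * c)) / s ^ 2" "p \<noteq> 0" "s \<noteq> 0" for p s A c :: complex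
    proof -
      have "A = (s / p) * (p / s * A)" using that(2,3) by simp
      also have "\<dots> = (s / p) * (- (p * (p * c)) / s ^ 2)" by (simp only: that(1))
      also have "\<dots> = - (p * c / s)" using that(2,3) by (simp add: power2_eq_square)
      finally show ?thesis .
    qed
    from this[OF eq] nonpos(5)[OF w] show ?thesis by simp
  qed
  note [simp] = nonpos[of z]
  have z: "z \<in> - \<int>" using assms by simp
  have "((\<lambda>w. Digamma w - Digamma (1 - w)) has_field_derivative
           Polygamma 1 z + Polygamma 1 (1 - z)) (at z)"
    using nonpos[OF z] by (auto intro!: derivative_eq_intros)
  moreover have "open (- \<int> :: complex set)" by (simp add: open_Compl)
  ultimately have "((\<lambda>w. - (of_real pi * cos (of_real pi * w) / sin (of_real pi * w))) has_field_derivative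
           Polygamma 1 z + Polygamma 1 (1 - z)) (at z)"
    using z Digamma by (rule has_field_derivative_transform_within_open)
  moreover have "((\<lambda>w. - (of_real pi * cos (of_real pi * w) / sin (of_real pi * w))) has_field_derivative
           of_real pi ^ 2 / sin (of_real pi * z) ^ 2) (at z)"
  proof -
    have "((\<lambda>w. of_real pi * w) has_field_derivative of_real pi) (at z)"
      by (auto intro!: derivative_eq_intros)
    from DERIV_minus[OF DERIV_cmult[OF DERIV_chain2[OF DERIV_cot[OF nonpos(5)[OF z]] this], of "of_real pi"]]
    have "((\<lambda>w. - (of_real pi * cot (of_real pi * w))) has_field_derivative
           - (of_real pi * (- inverse ((sin (of_real pi * z))\<^sup>2) * of_real pi))) (at z)" .
    moreover have "- (of_real pi * (- inverse ((sin (of_real pi * z))\<^sup>2) * of_real pi)) = of_real pi ^ 2 / sin (of_real pi * z) ^ 2"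
      by (simp add: power2_eq_square divide_inverse)
    ultimately show ?thesis by (simp only: cot_def times_divide_eq_right)
  qed
  ultimately show ?thesis by (rule DERIV_unique)
qed

lemma has_sum_inverse_square_shift:
  fixes w :: complex
  assumes "w \<noteq> 0"
  shows "((\<lambda>n. 1 / (w + of_nat n) ^ 2) has_sum Polygamma 1 w) UNIV"
proof -
  have s: "(\<lambda>n. inverse ((w + of_nat n) ^ 2)) sums Polygamma 1 w"
    using Polygamma_LIMSEQ[OF assms, of 1] by (simp add: numeral_2_eq_2)
  have "summable (\<lambda>n. norm (inverse ((w + of_nat n) ^ 2)))"
  proof (rule summable_comparison_test_ev)
    obtain N :: nat where N: "norm w + 1 < of_nat N" using reals_Archimedean2 by blast
    show "eventually (\<lambda>n. norm (norm (inverse ((w + of_nat n) ^ 2))) \<le> 4 * inverse (real n ^ 2)) sequentially"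
      using eventually_ge_at_top[of "2 * N"]
    proof eventually_elim
      case (elim n)
      then have n: "2 * real N \<le> real n" by linarith
      have "real n \<le> norm (w + of_nat n) + norm w"
        using norm_triangle_ineq4[of "w + of_nat n" w] by simp
      then have "real n / 2 \<le> norm (w + of_nat n)" using n N by linarith
      then have "(real n / 2)^2 \<le> norm (w + of_nat n) ^ 2" by (intro power_mono) auto
      moreover have "real n > 0" using n N norm_ge_zero[of w] by linarith
      ultimately have "inverse (norm (w + of_nat n) ^ 2) \<le> inverse ((real n / 2)^2)"
        by (intro le_imp_inverse_le) auto
      then show ?case by (simp add: norm_divide norm_power power_divide inverse_eq_divide)
    qed
    show "summable (\<lambda>n. 4 * inverse (real n ^ 2))"
      by (intro summable_mult inverse_power_summable) auto
  qed
  with s show ?thesis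
    by (intro norm_summable_imp_has_sum) (auto simp: inverse_eq_divide)
qed

text \<open>The trigamma values at \<open>w\<close> and \<open>1 - w\<close> are the two halves of this bilateral series.\<close>
lemma has_sum_inverse_square_int:
  fixes w :: complex
  assumes "w \<notin> \<int>"
  shows "((\<lambda>m::int. 1 / (w + of_int m) ^ 2) has_sum of_real pi ^ 2 / sin (of_real pi * w) ^ 2) UNIV"
  unfolding Polygamma_1_reflection[OF assms, symmetric]
proof (rule has_sum_int_split)
  have "w \<noteq> 0" "1 - w \<noteq> 0" using assms by auto
  from this(1) show "((\<lambda>n. 1 / (w + of_int (int n))\<^sup>2) has_sum Polygamma 1 w) UNIV"
    using has_sum_inverse_square_shift by simp
  have "(w + of_int (- int n - 1))\<^sup>2 = (1 - w + of_nat n)\<^sup>2" for n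
    by (simp add: power2_eq_square algebra_simps)
  then show "((\<lambda>n. 1 / (w + of_int (- int n - 1))\<^sup>2) has_sum Polygamma 1 (1 - w)) UNIV"
    using has_sum_inverse_square_shift[OF \<open>1 - w \<noteq> 0\<close>] by simp
qed

text \<open>The term at \<open>m = 0\<close> vanishes because \<open>1 / 0 = 0\<close>, so this is \<open>2 \<zeta>(2)\<close>; the same convention lets the
  lattice sums below run over the whole lattice.\<close>
lemma has_sum_inverse_squares_int:
  "((\<lambda>m::int. 1 / (of_int m) ^ 2 :: complex) has_sum of_real pi ^ 2 / 3) UNIV"
proof -
  have "((\<lambda>n. 1 / (real n + 1) ^ 2) has_sum pi ^ 2 / 6) UNIV"
    by (rule sums_nonneg_imp_has_sum) (use inverse_squares_sums in \<open>auto simp: add.commute\<close>)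
  then have "((\<lambda>n. complex_of_real (1 / (real n + 1) ^ 2)) has_sum of_real (pi ^ 2 / 6)) UNIV"
    by (rule has_sum_of_real)
  then have "((\<lambda>n. 1 / of_nat (Suc n) ^ 2 :: complex) has_sum of_real pi ^ 2 / 6) UNIV"
    by (simp add: add.commute)
  then have "((\<lambda>n. 1 / of_nat n ^ 2 :: complex) has_sum of_real pi ^ 2 / 6) {1..}"
    by (subst has_sum_reindex_bij_witness[of _ Suc "\<lambda>n. n - 1" UNIV "\<lambda>n. 1 / of_nat (Suc n) ^ 2 :: complex"]) auto
  from has_sum_int_abs[OF this] show ?thesis by (simp flip: of_int_power)
qed

text \<open>Neither half of the difference is summable over \<open>\<int>\<close>, so the telescoping is done on each half-line;
  the boundary terms \<open>-1 / c\<close> and \<open>1 / c\<close> cancel.\<close>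
lemma has_sum_telescope_int:
  fixes c :: complex
  assumes "\<And>m::int. c + of_int m \<noteq> 0"
  shows "((\<lambda>m::int. 1 / (c + of_int m + 1) - 1 / (c + of_int m)) has_sum 0) UNIV"
proof -
  \<comment> \<open>Domination of the products of consecutive terms by the summable squares.\<close>
  have ab: "a * b \<le> a\<^sup>2 + b\<^sup>2" if "a \<ge> 0" "b \<ge> 0" for a b :: real
    using sum_squares_bound[of a b] mult_nonneg_nonneg[OF that] by linarith
  have half: "((\<lambda>n. 1 / (d + of_nat n + 1) - 1 / (d + of_nat n)) has_sum - (1 / d)) UNIV"
    if d: "\<And>n::nat. d + of_nat n \<noteq> 0" for d :: complex
  proof (rule norm_summable_imp_has_sum)
    have "(\<lambda>n. 1 / (d + of_nat n)) \<longlonglongrightarrow> 0"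
      by (intro tendsto_divide_0[OF tendsto_const] tendsto_add_filterlim_at_infinity[OF tendsto_const]
            tendsto_of_nat)
    from telescope_sums[OF this] show "(\<lambda>n. 1 / (d + of_nat n + 1) - 1 / (d + of_nat n)) sums - (1 / d)"
      by (simp add: add_ac)
    have d0: "d \<noteq> 0" "d + 1 \<noteq> 0" using d[of 0] d[of 1] by auto
    have sum: "summable (\<lambda>n. norm (1 / (d + of_nat n) ^ 2) + norm (1 / (d + 1 + of_nat n) ^ 2))"
    proof (rule summable_add)
      have "(\<lambda>n. norm (1 / (e + of_nat n) ^ 2)) summable_on UNIV" if "e \<noteq> 0" for e :: complex
        using has_sum_imp_summable[OF has_sum_inverse_square_shift[OF that]]
        by (simp only: summable_on_iff_abs_summable_on_complex)
      then show "summable (\<lambda>n. norm (1 / (d + of_nat n) ^ 2))" "summable (\<lambda>n. norm (1 / (d + 1 + of_nat n) ^ 2))"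
        using d0 by (auto intro!: summable_on_imp_summable)
    qed
    show "summable (\<lambda>n. norm (1 / (d + of_nat n + 1) - 1 / (d + of_nat n)))"
    proof (rule summable_comparison_test'[OF sum])
      fix n :: nat
      have e: "d + of_nat n \<noteq> 0" "d + of_nat n + 1 \<noteq> 0"
        using d[of n] d[of "Suc n"] by (auto simp: add_ac)
      let ?a = "1 / norm (d + of_nat n)" and ?b = "1 / norm (d + of_nat n + 1)"
      have "1 / (d + of_nat n + 1) - 1 / (d + of_nat n) = - (1 / (d + of_nat n) * (1 / (d + of_nat n + 1)))"
        using e by (simp add: field_simps)
      then have "norm (1 / (d + of_nat n + 1) - 1 / (d + of_nat n)) = ?a * ?b"
        by (simp add: norm_mult norm_divide)
      also have "\<dots> \<le> ?a ^ 2 + ?b ^ 2"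
        by (rule ab) auto
      also have "\<dots> = norm (1 / (d + of_nat n) ^ 2) + norm (1 / (d + 1 + of_nat n) ^ 2)"
        by (simp add: norm_divide norm_power add_ac power_divide)
      finally show "norm (norm (1 / (d + of_nat n + 1) - 1 / (d + of_nat n))) \<le>
           norm (1 / (d + of_nat n) ^ 2) + norm (1 / (d + 1 + of_nat n) ^ 2)" by simp
    qed
  qed
  have "((\<lambda>m::int. 1 / (c + of_int m + 1) - 1 / (c + of_int m)) has_sum (- (1 / c) + - (1 / (- c)))) UNIV"
  proof (rule has_sum_int_split)
    show "((\<lambda>n. 1 / (c + of_int (int n) + 1) - 1 / (c + of_int (int n))) has_sum - (1 / c)) UNIV"
      using half[of c] assms by (metis (no_types, lifting) of_int_of_nat_eq has_sum_cong)
    have nz: "- c + of_nat n \<noteq> 0" for n :: nat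
    proof -
      have "- c + of_nat n = - (c + of_int (- int n))" by simp
      then show ?thesis using assms[of "- int n"] by (metis neg_equal_0_iff_equal)
    qed
    have "1 / (c + of_int (- int n - 1) + 1) - 1 / (c + of_int (- int n - 1)) =
           1 / (- c + of_nat n + 1) - 1 / (- c + of_nat n)" for n
    proof -
      have "c + of_int (- int n - 1) + 1 = - (- c + of_nat n)" "c + of_int (- int n - 1) = - (- c + of_nat n + 1)"
        by simp_all
      then show ?thesis by (simp only: divide_minus_right) simp
    qed
    then show "((\<lambda>n. 1 / (c + of_int (- int n - 1) + 1) - 1 / (c + of_int (- int n - 1))) has_sum - (1 / - c)) UNIV"
      using half[OF nz] by simp
  qed
  then show ?thesis by simp
qed

section \<open>The Lambert series of the divisor sum\<close>

text \<open>The Koebe function \<open>\<Sum>n\<ge>1. n u^n\<close>. With \<open>u = exp (2\<pi>iw)\<close> it is \<open>-1 / (4 sin\<^sup>2 \<pi>w)\<close>, and it is invariant under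
  \<open>u \<mapsto> 1 / u\<close>; this is how a row of the lattice sum turns into a term of a Lambert series.\<close>
definition koebe :: "'a::field \<Rightarrow> 'a" where
  "koebe u = u / (1 - u)\<^sup>2"

text \<open>Adding \<open>koebe u\<close> to both sides, the poles at 1 and at -1 combine to
  \<open>u / (1 - u)\<^sup>2 - u / (1 + u)\<^sup>2 = 4 u\<^sup>2 / (1 - u\<^sup>2)\<^sup>2\<close>.\<close>
lemma koebe_minus:
  fixes u :: "'a::field"
  assumes "u \<noteq> 1" "u \<noteq> -1"
  shows "koebe (- u) = 4 * koebe (u\<^sup>2) - koebe u"
proof -
  have "1 - u \<noteq> 0" "1 + u \<noteq> 0" using assms by (auto simp: add_eq_0_iff)
  then have "u / (1 - u)\<^sup>2 = u * (1 + u)\<^sup>2 / ((1 - u)\<^sup>2 * (1 + u)\<^sup>2)"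
    and l: "koebe (- u) = - u * (1 - u)\<^sup>2 / ((1 - u)\<^sup>2 * (1 + u)\<^sup>2)"
    by (simp_all add: koebe_def)
  moreover have "4 * koebe (u\<^sup>2) = 4 * u\<^sup>2 / ((1 - u)\<^sup>2 * (1 + u)\<^sup>2)"
  proof -
    have "1 - u\<^sup>2 = (1 - u) * (1 + u)" by (simp add: power2_eq_square algebra_simps)
    then show ?thesis by (simp add: koebe_def power_mult_distrib)
  qed
  ultimately have "4 * koebe (u\<^sup>2) - koebe u = (4 * u\<^sup>2 - u * (1 + u)\<^sup>2) / ((1 - u)\<^sup>2 * (1 + u)\<^sup>2)"
    by (simp add: koebe_def diff_divide_distrib)
  also have "4 * u\<^sup>2 - u * (1 + u)\<^sup>2 = - u * (1 - u)\<^sup>2"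
    by (simp add: power2_eq_square algebra_simps)
  finally show ?thesis using l by simp
qed

lemma koebe_inverse: "koebe (inverse u) = koebe u"
proof (cases "u = 0 \<or> u = 1")
  case False
  then have "1 - u \<noteq> 0" "u - 1 \<noteq> 0" by auto
  moreover have "1 - inverse u = (u - 1) / u" using False by (simp add: field_simps)
  ultimately show ?thesis
    unfolding koebe_def using False by (simp add: field_simps power2_eq_square)
qed (auto simp: koebe_def)

lemma koebe_of_real: "koebe (of_real x :: 'a::real_field) = of_real (koebe x)"
  by (simp add: koebe_def)

lemma pi_over_sin_squared_eq_koebe:
  fixes w :: complex
  shows "of_real pi ^ 2 / sin (of_real pi * w) ^ 2 = - 4 * of_real pi ^ 2 * koebe (exp (2 * of_real pi * \<i> * w))"
proof -
  define u where "u = exp (of_real pi * \<i> * w)"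
  have u: "u \<noteq> 0" by (simp add: u_def)
  have e: "exp (2 * of_real pi * \<i> * w) = u ^ 2"
    by (simp add: u_def power2_eq_square mult_ac flip: exp_add)
  have "sin (of_real pi * w) = (u - inverse u) / (2 * \<i>)"
    by (simp add: u_def sin_exp_eq exp_minus mult_ac)
  also have "\<dots> = (u\<^sup>2 - 1) / (2 * \<i> * u)" using u by (simp add: field_simps power2_eq_square)
  finally have "sin (of_real pi * w) ^ 2 = (1 - u\<^sup>2)\<^sup>2 / (- 4 * u\<^sup>2)"
    by (simp add: power_divide power_mult_distrib power2_commute)
  then show ?thesis unfolding e koebe_def using u by simp
qed

text \<open>The generating function of the divisor sum: expanding the Koebe function gives
  \<open>\<Sum>n\<ge>1. \<sigma>(n) y^n\<close>, so \<open>1 - 24 lambert_sigma\<close> is the Eisenstein series \<open>E\<^sub>2\<close>.\<close>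
definition lambert_sigma :: "'a::{real_normed_field,banach} \<Rightarrow> 'a" where
  "lambert_sigma y = (\<Sum>\<^sub>\<infinity>n\<in>{1..}. koebe (y ^ n))"

lemma norm_koebe_le:
  fixes u :: "'a::real_normed_field"
  assumes "norm u \<le> r" "r < 1"
  shows "norm (koebe u) \<le> norm u / (1 - r)\<^sup>2"
proof -
  have "1 - r \<le> norm (1 - u)"
    using norm_triangle_ineq2[of 1 u] assms by simp
  then have "(1 - r)\<^sup>2 \<le> norm (1 - u) ^ 2" using assms by (intro power_mono) auto
  then show ?thesis
    unfolding koebe_def using assms by (auto simp: norm_divide norm_power intro!: frac_le)
qed

lemma summable_on_power_atLeast_1:
  fixes r :: real
  assumes "0 \<le> r" "r < 1"
  shows "(\<lambda>n. r ^ n) summable_on {1..}"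
proof -
  have "(\<lambda>n. r ^ n) summable_on UNIV"
    by (rule summable_nonneg_imp_summable_on) (use assms in \<open>auto intro: summable_geometric\<close>)
  then show ?thesis by (rule summable_on_subset) auto
qed

lemma has_sum_lambert_sigma:
  fixes y :: "'a::{real_normed_field,banach}"
  assumes "norm y < 1"
  shows "((\<lambda>n. koebe (y ^ n)) has_sum lambert_sigma y) {1..}"
proof -
  have "(\<lambda>n. norm (koebe (y ^ n))) summable_on {1..}"
  proof (rule summable_on_comparison_test)
    have "(\<lambda>n. norm y ^ n) summable_on {1..}"
      using assms by (intro summable_on_power_atLeast_1) auto
    then show "(\<lambda>n. norm y ^ n / (1 - norm y)\<^sup>2) summable_on {1..}"
      by (simp add: divide_inverse summable_on_cmult_left)
    fix n :: nat assume n: "n \<in> {1..}"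
    have "norm (y ^ n) \<le> norm y ^ 1"
      unfolding norm_power using n assms by (intro power_decreasing) auto
    then show "norm (koebe (y ^ n)) \<le> norm y ^ n / (1 - norm y)\<^sup>2"
      using norm_koebe_le[of "y ^ n" "norm y"] assms by (simp add: norm_power)
  qed auto
  from has_sum_infsum[OF abs_summable_summable[OF this]] show ?thesis
    unfolding lambert_sigma_def .
qed

lemma lambert_sigma_of_real:
  assumes "\<bar>x\<bar> < 1"
  shows "lambert_sigma (of_real x :: 'a::{real_normed_field,banach}) = of_real (lambert_sigma x)"
proof -
  have "((\<lambda>n. of_real (koebe (x ^ n)) :: 'a) has_sum of_real (lambert_sigma x)) {1..}"
    by (intro has_sum_of_real has_sum_lambert_sigma) (use assms in auto)
  moreover have "of_real (koebe (x ^ n)) = (koebe (of_real x ^ n) :: 'a)" for n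
    using koebe_of_real[of "x ^ n", where ?'a = 'a] by simp
  ultimately have "((\<lambda>n. koebe (of_real x ^ n) :: 'a) has_sum of_real (lambert_sigma x)) {1..}"
    by (simp only:)
  then show ?thesis unfolding lambert_sigma_def by (rule infsumI)
qed

lemma has_sum_evens:
  assumes "(f has_sum S) {1..}"
  shows "((\<lambda>n. f (n div 2)) has_sum S) {n \<in> {1::nat..}. even n}"
  using assms by (subst has_sum_reindex_bij_witness[of "{n \<in> {1..}. even n}" "\<lambda>n. 2 * n" "\<lambda>n. n div 2" "{1..}" f _ S S])
     (auto elim!: evenE)

lemma has_sum_lambert_sigma_even:
  fixes y :: "'a::{real_normed_field,banach}"
  assumes "norm y < 1"
  shows "((\<lambda>n. koebe (y ^ n)) has_sum lambert_sigma (y\<^sup>2)) {n \<in> {1..}. even n}"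
proof -
  have "norm (y\<^sup>2) < 1" using assms by (simp add: norm_power power_less_one_iff)
  note even = has_sum_evens[OF has_sum_lambert_sigma[OF this]]
  have "koebe ((y\<^sup>2) ^ (n div 2)) = koebe (y ^ n)" if "n \<in> {n \<in> {1..}. even n}" for n
    using that by (auto simp flip: power_mult)
  from iffD1[OF has_sum_cong[OF this] even] show ?thesis .
qed

lemma has_sum_lambert_sigma_odd:
  fixes y :: "'a::{real_normed_field,banach}"
  assumes "norm y < 1"
  shows "((\<lambda>n. koebe (y ^ n)) has_sum lambert_sigma y - lambert_sigma (y\<^sup>2)) {n \<in> {1..}. odd n}"
proof -
  have "((\<lambda>n. koebe (y ^ n)) has_sum lambert_sigma y - lambert_sigma (y\<^sup>2)) ({1..} - {n \<in> {1..}. even n})"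
    by (rule has_sum_Diff[OF has_sum_lambert_sigma[OF assms] has_sum_lambert_sigma_even[OF assms]]) auto
  moreover have "{1..} - {n \<in> {1..}. even n} = {n \<in> {1::nat..}. odd n}" by auto
  ultimately show ?thesis by simp
qed

text \<open>On even \<open>n\<close> nothing changes, since \<open>(-y)^n = y^n\<close>; on odd \<open>n\<close> the identity \<open>koebe_minus\<close> applies. The sums over odd
  \<open>n\<close> are differences of full and even ones. For positive \<open>y\<close> this expresses the value at
  the negative nome \<open>-y\<close> by the positive nomes that occur in the eta quotients below.\<close>
lemma lambert_sigma_minus:
  fixes y :: "'a::{real_normed_field,banach}"
  assumes "norm y < 1"
  shows "lambert_sigma (- y) = - lambert_sigma y + 6 * lambert_sigma (y\<^sup>2) - 4 * lambert_sigma (y ^ 4)"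
proof -
  have y2: "norm (y\<^sup>2) < 1" using assms by (simp add: norm_power power_less_one_iff)
  have diff: "((\<lambda>n. 4 * koebe ((y\<^sup>2) ^ n) - koebe (y ^ n)) has_sum
      4 * (lambert_sigma (y\<^sup>2) - lambert_sigma ((y\<^sup>2)\<^sup>2)) - (lambert_sigma y - lambert_sigma (y\<^sup>2))) {n \<in> {1..}. odd n}"
    using has_sum_add[OF has_sum_cmult_right[OF has_sum_lambert_sigma_odd[OF y2], of 4]
          has_sum_uminusI[OF has_sum_lambert_sigma_odd[OF assms]]] by simp
  have "4 * koebe ((y\<^sup>2) ^ n) - koebe (y ^ n) = koebe ((- y) ^ n)" if n: "n \<in> {n \<in> {1..}. odd n}" for n
  proof -
    have "norm (y ^ n) < 1" using n assms by (auto simp: norm_power power_less_one_iff)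
    then have "y ^ n \<noteq> 1" "y ^ n \<noteq> -1" by auto
    from koebe_minus[OF this] n show ?thesis
      by (simp add: power_mult[symmetric] mult.commute)
  qed
  note odd = iffD1[OF has_sum_cong[OF this] diff]
  have even: "((\<lambda>n. koebe ((- y) ^ n)) has_sum lambert_sigma (y\<^sup>2)) {n \<in> {1..}. even n}"
    using has_sum_lambert_sigma_even[of "- y"] assms by simp
  have "((\<lambda>n. koebe ((- y) ^ n)) has_sum
      (4 * (lambert_sigma (y\<^sup>2) - lambert_sigma ((y\<^sup>2)\<^sup>2)) - (lambert_sigma y - lambert_sigma (y\<^sup>2)) + lambert_sigma (y\<^sup>2)))
        ({n \<in> {1..}. odd n} \<union> {n \<in> {1..}. even n})"
    by (rule has_sum_Un_disjoint[OF odd even]) auto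
  moreover have "{n \<in> {1..}. odd n} \<union> {n \<in> {1..}. even n} = {1::nat..}" by auto
  ultimately have "((\<lambda>n. koebe ((- y) ^ n)) has_sum
      (4 * (lambert_sigma (y\<^sup>2) - lambert_sigma ((y\<^sup>2)\<^sup>2)) - (lambert_sigma y - lambert_sigma (y\<^sup>2)) + lambert_sigma (y\<^sup>2))) {1..}"
    by simp
  from has_sum_unique[OF has_sum_lambert_sigma[of "- y"] this]
  have "lambert_sigma (- y) = 4 * (lambert_sigma (y\<^sup>2) - lambert_sigma ((y\<^sup>2)\<^sup>2)) - (lambert_sigma y - lambert_sigma (y\<^sup>2)) + lambert_sigma (y\<^sup>2)"
    using assms by simp
  moreover have "(y\<^sup>2)\<^sup>2 = y ^ 4" by simp
  ultimately show ?thesis by (simp add: algebra_simps)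
qed

section \<open>Lattice sums as Lambert series\<close>

text \<open>The lattice sums converge absolutely, so they may be summed along the rows \<open>n\<tau> + \<int>\<close>, each of which has a
  closed form.\<close>
lemma has_sum_period_lattice_rows:
  fixes f :: "complex \<Rightarrow> complex"
  assumes \<tau>: "Im \<tau> \<noteq> 0"
    and f: "f summable_on period_lattice \<tau>"
    and rows: "\<And>n::int. ((\<lambda>m::int. f (of_int m + of_int n * \<tau>)) has_sum g n) UNIV"
  shows "(g has_sum infsum f (period_lattice \<tau>)) UNIV"
proof -
  define h where "h = (\<lambda>(n::int, m::int). of_int m + of_int n * \<tau>)"
  have "inj h"
  proof (rule injI)
    fix x y assume eq: "h x = h y"
    obtain n m n' m' where xy: "x = (n, m)" "y = (n', m')" by (cases x, cases y)
    have "Im (h x) = Im (h y)" "Re (h x) = Re (h y)" using eq by simp_all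
    then show "x = y" using \<tau> by (auto simp: h_def xy)
  qed
  moreover have "range h = period_lattice \<tau>"
    by (auto simp: h_def period_lattice_def image_iff)
  ultimately have "((f \<circ> h) has_sum infsum f (period_lattice \<tau>)) UNIV"
    using has_sum_reindex[of h UNIV f] has_sum_infsum[OF f] by simp
  then have "((f \<circ> h) has_sum infsum f (period_lattice \<tau>)) (UNIV \<times> UNIV)" by simp
  then show ?thesis
    by (rule has_sum_SigmaD) (use rows in \<open>simp add: h_def\<close>)
qed

text \<open>Only finitely many lattice points have norm at most 1, so it is enough to compare with the cubes
  outside the unit disc.\<close>
lemma summable_on_period_lattice:
  fixes f :: "complex \<Rightarrow> complex"
  assumes \<tau>: "Im \<tau> \<noteq> 0"
    and bound: "\<And>\<omega>. 1 \<le> norm \<omega> \<Longrightarrow> norm (f \<omega>) \<le> C * (1 / norm \<omega> ^ 3)"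
  shows "f summable_on period_lattice \<tau>"
proof -
  let ?A = "{\<omega> \<in> period_lattice \<tau>. norm \<omega> \<le> 1}" and ?B = "{\<omega> \<in> period_lattice \<tau>. norm \<omega> > 1}"
  have "f summable_on ?A"
    by (intro summable_on_finite finite_period_lattice_cball \<tau>)
  moreover have "f summable_on ?B"
  proof (rule abs_summable_summable, rule summable_on_comparison_test)
    have "(\<lambda>\<omega>. 1 / norm \<omega> ^ 3) summable_on ?B"
      by (rule summable_on_subset[OF summable_on_period_lattice_cube[OF \<tau>]]) auto
    then show "(\<lambda>\<omega>. C * (1 / norm \<omega> ^ 3)) summable_on ?B"
      by (rule summable_on_cmult_right)
    show "norm (f \<omega>) \<le> C * (1 / norm \<omega> ^ 3)" if "\<omega> \<in> ?B" for \<omega>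
      using bound[of \<omega>] that by auto
  qed auto
  moreover have "?A \<union> ?B = period_lattice \<tau>" by auto
  ultimately show ?thesis
    using summable_on_Un_disjoint[of f ?A ?B] by force
qed

lemma zero_in_period_lattice: "0 \<in> period_lattice \<tau>"
  unfolding period_lattice_def by (auto intro!: exI[of _ 0])

text \<open>By \<open>1 / 0 = 0\<close> the summands of \<open>\<wp>\<close> and \<open>\<zeta>\<close> at \<open>\<omega> = 0\<close> are exactly the leading terms
  \<open>1 / z\<^sup>2\<close> and \<open>1 / z\<close> in the definitions; hence both functions are sums over the full lattice.\<close>
lemma infsum_period_lattice_split_0:
  fixes f :: "complex \<Rightarrow> complex"
  assumes "f summable_on period_lattice \<tau>"
  shows "infsum f (period_lattice \<tau>) = f 0 + infsum f (period_lattice \<tau> - {0})"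
proof -
  have "period_lattice \<tau> = insert 0 (period_lattice \<tau> - {0})"
    using zero_in_period_lattice by auto
  moreover have "f summable_on (period_lattice \<tau> - {0})"
    by (rule summable_on_subset_banach[OF assms]) auto
  ultimately show ?thesis
    using infsum_insert[of f "period_lattice \<tau> - {0}" 0] by simp
qed

lemma half_lattice_point_bounds:
  fixes \<omega> :: complex
  assumes "1 \<le> norm \<omega>"
  shows "norm \<omega> / 2 \<le> norm (1 / 2 - \<omega>)" "\<omega> \<noteq> 0" "1 / 2 - \<omega> \<noteq> 0"
proof -
  have "norm \<omega> - 1 / 2 \<le> norm (1 / 2 - \<omega>)"
    using norm_triangle_ineq2[of \<omega> "1 / 2"] by (simp add: norm_minus_commute)
  with assms show *: "norm \<omega> / 2 \<le> norm (1 / 2 - \<omega>)" by simp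
  show "\<omega> \<noteq> 0" using assms by auto
  have "norm (1 / 2 - \<omega>) > 0" using * assms by linarith
  then show "1 / 2 - \<omega> \<noteq> 0" using zero_less_norm_iff by blast
qed

lemma summable_on_weierstrass_p_half:
  assumes \<tau>: "Im \<tau> \<noteq> 0"
  shows "(\<lambda>\<omega>. 1 / (1 / 2 - \<omega>)\<^sup>2 - 1 / \<omega>\<^sup>2) summable_on period_lattice \<tau>"
proof (rule summable_on_period_lattice[OF \<tau>])
  fix \<omega> :: complex assume \<omega>: "1 \<le> norm \<omega>"
  note b = half_lattice_point_bounds[OF \<omega>]
  define v where "v = 1 / 2 - \<omega>"
  have v: "v \<noteq> 0" "norm \<omega> / 2 \<le> norm v" using b by (auto simp: v_def)
  have "1 / v\<^sup>2 - 1 / \<omega>\<^sup>2 = (\<omega>\<^sup>2 - v\<^sup>2) / (\<omega>\<^sup>2 * v\<^sup>2)"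
    using v b by (simp add: field_simps)
  also have "\<omega>\<^sup>2 - v\<^sup>2 = \<omega> - 1 / 4"
    by (simp add: v_def power2_eq_square algebra_simps)
  finally have "norm (1 / v\<^sup>2 - 1 / \<omega>\<^sup>2) = norm (\<omega> - 1 / 4) / ((norm \<omega>)\<^sup>2 * (norm v)\<^sup>2)"
    by (simp add: norm_divide norm_mult norm_power)
  also have "\<dots> \<le> (2 * norm \<omega>) / ((norm \<omega>)\<^sup>2 * (norm \<omega> / 2)\<^sup>2)"
  proof (rule frac_le)
    show "norm (\<omega> - 1 / 4) \<le> 2 * norm \<omega>"
      using norm_triangle_ineq4[of \<omega> "1 / 4"] \<omega> by simp
    show "(norm \<omega>)\<^sup>2 * (norm \<omega> / 2)\<^sup>2 \<le> (norm \<omega>)\<^sup>2 * (norm v)\<^sup>2"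
      using v by (intro mult_left_mono power_mono) auto
  qed (use b in auto)
  also have "\<dots> = 8 * (1 / norm \<omega> ^ 3)"
    using b by (simp add: field_simps power2_eq_square power3_eq_cube)
  finally show "norm (1 / (1 / 2 - \<omega>)\<^sup>2 - 1 / \<omega>\<^sup>2) \<le> 8 * (1 / norm \<omega> ^ 3)"
    unfolding v_def .
qed

lemma summable_on_weierstrass_zeta_half:
  assumes \<tau>: "Im \<tau> \<noteq> 0"
  shows "(\<lambda>\<omega>. 1 / (1 / 2 - \<omega>) + 1 / \<omega> + 1 / 2 / \<omega>\<^sup>2) summable_on period_lattice \<tau>"
proof (rule summable_on_period_lattice[OF \<tau>])
  fix \<omega> :: complex assume \<omega>: "1 \<le> norm \<omega>"
  note b = half_lattice_point_bounds[OF \<omega>]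
  define v where "v = 1 / 2 - \<omega>"
  have v: "v \<noteq> 0" "norm \<omega> / 2 \<le> norm v" using b by (auto simp: v_def)
  have "1 / v + 1 / \<omega> + 1 / 2 / \<omega>\<^sup>2 = (\<omega>\<^sup>2 + \<omega> * v + v / 2) / (\<omega>\<^sup>2 * v)"
    using v b by (simp add: field_simps power2_eq_square)
  also have "\<omega>\<^sup>2 + \<omega> * v + v / 2 = 1 / 4"
    by (simp add: v_def power2_eq_square field_simps)
  finally have "norm (1 / v + 1 / \<omega> + 1 / 2 / \<omega>\<^sup>2) = (1 / 4) / ((norm \<omega>)\<^sup>2 * norm v)"
    by (simp add: norm_divide norm_mult norm_power)
  also have "\<dots> \<le> (1 / 4) / ((norm \<omega>)\<^sup>2 * (norm \<omega> / 2))"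
    using v b by (intro frac_le mult_left_mono) auto
  also have "\<dots> = (1 / 2) * (1 / norm \<omega> ^ 3)"
    using b by (simp add: field_simps power2_eq_square power3_eq_cube)
  finally show "norm (1 / (1 / 2 - \<omega>) + 1 / \<omega> + 1 / 2 / \<omega>\<^sup>2) \<le> (1 / 2) * (1 / norm \<omega> ^ 3)"
    unfolding v_def .
qed

lemma norm_nome_less_1:
  assumes "Im \<tau> > 0"
  shows "norm (exp (2 * of_real pi * \<i> * \<tau>)) < 1"
  using assms by (simp add: norm_exp_eq_Re)

lemma not_Ints_if_Im: "Im w \<noteq> 0 \<Longrightarrow> w \<notin> \<int>"
  by (auto elim!: Ints_cases)

text \<open>The rows \<open>n\<close> and \<open>-n\<close> contribute equally, by the invariance of the Koebe function under inversion. The factor \<open>c = -1\<close>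
  belongs to the rows shifted by a half period.\<close>
lemma koebe_nome_power:
  "koebe (c * exp (2 * of_real pi * \<i> * \<tau>) ^ nat \<bar>n\<bar>) =
     koebe (c * exp (2 * of_real pi * \<i> * (of_int n * \<tau>)))"
  if "c = 1 \<or> c = -1" for n :: int
proof -
  define Q where "Q = exp (2 * of_real pi * \<i> * \<tau>)"
  have exp_nat: "exp (2 * of_real pi * \<i> * (of_nat k * \<tau>)) = Q ^ k" for k
    by (simp add: Q_def mult_ac flip: exp_of_nat_mult)
  have c: "inverse c = c" using that by auto
  show ?thesis
  proof (cases "n \<ge> 0")
    case True
    then show ?thesis using exp_nat[of "nat n"] by (simp add: Q_def)
  next
    case False
    then have "Q ^ nat \<bar>n\<bar> = exp (- (2 * of_real pi * \<i> * (of_int n * \<tau>)))"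
      using exp_nat[of "nat \<bar>n\<bar>"] by simp
    then have "exp (2 * of_real pi * \<i> * (of_int n * \<tau>)) = inverse (Q ^ nat \<bar>n\<bar>)"
      by (simp only: exp_minus inverse_inverse_eq)
    then have "koebe (c * exp (2 * of_real pi * \<i> * (of_int n * \<tau>))) = koebe (inverse (c * Q ^ nat \<bar>n\<bar>))"
      by (simp add: c)
    then show ?thesis by (simp only: koebe_inverse Q_def)
  qed
qed

lemma of_int_neq_half: "of_int m \<noteq> (1 / 2 :: complex)"
proof
  assume "of_int m = (1 / 2 :: complex)"
  then have "of_int (2 * m) = (of_int 1 :: complex)" by (simp add: mult.commute)
  then have "2 * m = 1" by (simp only: of_int_eq_iff)
  then show False by presburger
qed

text \<open>Averaging the series for \<open>2 \<zeta>(1/2)\<close> over \<open>\<omega>\<close> and \<open>-\<omega>\<close> turns the summand into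
  \<open>1 / (1/2 - \<omega>) + 1 / (1/2 + \<omega>) + 1 / \<omega>\<^sup>2\<close>. The first two terms telescope along every row, so no
  cotangent appears and only the squares remain.\<close>
theorem weierstrass_eta1_eq_lambert_sigma:
  assumes \<tau>: "Im \<tau> > 0"
  shows "weierstrass_eta1 \<tau> = of_real pi ^ 2 / 3 - 8 * of_real pi ^ 2 * lambert_sigma (exp (2 * of_real pi * \<i> * \<tau>))"
proof -
  define Q where "Q = exp (2 * of_real pi * \<i> * \<tau>)"
  define t where "t = (\<lambda>\<omega>::complex. 1 / (1 / 2 - \<omega>) + 1 / \<omega> + 1 / 2 / \<omega>\<^sup>2)"
  have \<tau>0: "Im \<tau> \<noteq> 0" using \<tau> by simp
  have t: "t summable_on period_lattice \<tau>"
    using summable_on_weierstrass_zeta_half[OF \<tau>0] by (simp add: t_def)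
  have reflect: "((\<lambda>\<omega>. t (- \<omega>)) has_sum S) (period_lattice \<tau>)" if "(t has_sum S) (period_lattice \<tau>)" for S
    using that by (subst has_sum_reindex_bij_witness[of "period_lattice \<tau>" uminus uminus "period_lattice \<tau>" t _ S S])
      (auto simp: period_lattice_uminus)
  have "weierstrass_zeta \<tau> (1 / 2) = infsum t (period_lattice \<tau>)"
    unfolding infsum_period_lattice_split_0[OF t] by (simp add: weierstrass_zeta_def t_def)
  moreover have "((\<lambda>\<omega>. t \<omega> + t (- \<omega>)) has_sum (infsum t (period_lattice \<tau>) + infsum t (period_lattice \<tau>))) (period_lattice \<tau>)"
    by (rule has_sum_add[OF has_sum_infsum[OF t] reflect[OF has_sum_infsum[OF t]]])
  ultimately have "((\<lambda>\<omega>. t \<omega> + t (- \<omega>)) has_sum weierstrass_eta1 \<tau>) (period_lattice \<tau>)"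
    by (simp add: weierstrass_eta1_def)
  then have s: "(\<lambda>\<omega>. t \<omega> + t (- \<omega>)) summable_on period_lattice \<tau>"
       "infsum (\<lambda>\<omega>. t \<omega> + t (- \<omega>)) (period_lattice \<tau>) = weierstrass_eta1 \<tau>"
    by (auto simp: has_sum_iff)
  \<comment> \<open>The sum of row \<open>n\<close>; it depends only on \<open>|n|\<close>.\<close>
  define h where "h = (\<lambda>n::nat. if n = 0 then of_real pi ^ 2 / 3 else - 4 * of_real pi ^ 2 * koebe (Q ^ n))"
  have "((\<lambda>n::int. h (nat \<bar>n\<bar>)) has_sum infsum (\<lambda>\<omega>. t \<omega> + t (- \<omega>)) (period_lattice \<tau>)) UNIV"
  proof (rule has_sum_period_lattice_rows[OF \<tau>0 s(1)])
    fix n :: int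
    define c where "c = of_int n * \<tau> - 1 / 2"
    have nz: "c + of_int m \<noteq> 0" for m
    proof
      assume eq: "c + of_int m = 0"
      have "n = 0" using arg_cong[OF eq, of Im] \<tau>0 by (simp add: c_def)
      with eq have "of_int m = (1 / 2 :: complex)" by (simp add: c_def)
      then show False using of_int_neq_half by blast
    qed
    have squares: "((\<lambda>m. 1 / (of_int n * \<tau> + of_int m)\<^sup>2) has_sum h (nat \<bar>n\<bar>)) UNIV"
    proof (cases "n = 0")
      case True
      then show ?thesis using has_sum_inverse_squares_int by (simp add: h_def)
    next
      case False
      then have "of_int n * \<tau> \<notin> \<int>" using \<tau>0 by (intro not_Ints_if_Im) auto
      from has_sum_inverse_square_int[OF this] show ?thesis
        using False koebe_nome_power[of 1 \<tau> n]
        by (simp add: h_def pi_over_sin_squared_eq_koebe Q_def)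
    qed
    have "t \<omega> + t (- \<omega>) = (1 / (c + of_int m + 1) - 1 / (c + of_int m)) + 1 / (of_int n * \<tau> + of_int m)\<^sup>2"
      if "\<omega> = of_int m + of_int n * \<tau>" for \<omega> m
    proof -
      have e: "c + of_int m + 1 = 1 / 2 - (- \<omega>)" "c + of_int m = - (1 / 2 - \<omega>)" "of_int n * \<tau> + of_int m = \<omega>"
        by (simp_all add: c_def that)
      show ?thesis unfolding e t_def by (simp only: divide_minus_right) simp
    qed
    with has_sum_add[OF has_sum_telescope_int[OF nz] squares]
    show "((\<lambda>m. t (of_int m + of_int n * \<tau>) + t (- (of_int m + of_int n * \<tau>))) has_sum h (nat \<bar>n\<bar>)) UNIV"
      by simp
  qed
  moreover have "((\<lambda>n::int. h (nat \<bar>n\<bar>)) has_sum h 0 + 2 * (- 4 * of_real pi ^ 2 * lambert_sigma Q)) UNIV"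
  proof (rule has_sum_int_abs)
    have "((\<lambda>n. - 4 * of_real pi ^ 2 * koebe (Q ^ n)) has_sum - 4 * of_real pi ^ 2 * lambert_sigma Q) {1..}"
      using norm_nome_less_1[OF \<tau>] by (intro has_sum_cmult_right has_sum_lambert_sigma) (simp add: Q_def)
    then show "(h has_sum - 4 * of_real pi ^ 2 * lambert_sigma Q) {1..}"
      by (subst has_sum_cong[of "{1..}" h "\<lambda>n. - 4 * of_real pi ^ 2 * koebe (Q ^ n)"]) (auto simp: h_def)
  qed
  ultimately have "weierstrass_eta1 \<tau> = h 0 + 2 * (- 4 * of_real pi ^ 2 * lambert_sigma Q)"
    unfolding s(2) by (rule has_sum_unique)
  then show ?thesis by (simp add: h_def Q_def)
qed

text \<open>For \<open>n \<noteq> 0\<close> the row \<open>n\<close> of \<open>\<wp>(1/2)\<close> contributes \<open>koebe\<close> at \<open>-Q^n\<close> and at \<open>Q^n\<close>. The second contribution is cancelled by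
  \<open>\<eta>\<^sub>1\<close>, and \<open>koebe_minus\<close> removes the sign in the first.\<close>
theorem weierstrass_e1_plus_eta1_eq_lambert_sigma:
  assumes \<tau>: "Im \<tau> > 0"
  defines "Q \<equiv> exp (2 * of_real pi * \<i> * \<tau>)"
  shows "weierstrass_e1 \<tau> + weierstrass_eta1 \<tau> =
           of_real pi ^ 2 + 8 * of_real pi ^ 2 * (lambert_sigma Q - 4 * lambert_sigma (Q\<^sup>2))"
proof -
  define f where "f = (\<lambda>\<omega>::complex. 1 / (1 / 2 - \<omega>)\<^sup>2 - 1 / \<omega>\<^sup>2)"
  have \<tau>0: "Im \<tau> \<noteq> 0" using \<tau> by simp
  have Q: "norm Q < 1" "norm (Q\<^sup>2) < 1"
    using norm_nome_less_1[OF \<tau>] by (simp_all add: Q_def norm_power power_less_one_iff)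
  have f: "f summable_on period_lattice \<tau>"
    using summable_on_weierstrass_p_half[OF \<tau>0] by (simp add: f_def)
  have e1: "weierstrass_e1 \<tau> = infsum f (period_lattice \<tau>)"
    unfolding infsum_period_lattice_split_0[OF f] by (simp add: weierstrass_e1_def weierstrass_p_def f_def)
  \<comment> \<open>The sum of row \<open>n\<close>. At \<open>n = 0\<close> the first part is \<open>\<pi>\<^sup>2\<close>, as \<open>koebe (-1) = -1/4\<close>.\<close>
  define h where "h = (\<lambda>n::nat. - 4 * of_real pi ^ 2 * koebe (- (Q ^ n)) -
                        (if n = 0 then of_real pi ^ 2 / 3 else - 4 * of_real pi ^ 2 * koebe (Q ^ n)))"
  have "((\<lambda>n::int. h (nat \<bar>n\<bar>)) has_sum infsum f (period_lattice \<tau>)) UNIV"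
  proof (rule has_sum_period_lattice_rows[OF \<tau>0 f])
    fix n :: int
    have half: "of_int n * \<tau> - 1 / 2 \<notin> \<int>"
    proof
      assume "of_int n * \<tau> - 1 / 2 \<in> \<int>"
      then obtain m where eq: "of_int n * \<tau> - 1 / 2 = of_int m" by (auto elim!: Ints_cases)
      have "n = 0" using arg_cong[OF eq, of Im] \<tau>0 by simp
      with eq have "of_int (- m) = (1 / 2 :: complex)" by (simp add: minus_equation_iff)
      then show False using of_int_neq_half by blast
    qed
    have "exp (2 * of_real pi * \<i> * (of_int n * \<tau> - 1 / 2)) = exp (2 * of_real pi * \<i> * (of_int n * \<tau>) - of_real pi * \<i>)"
      by (simp add: algebra_simps)
    also have "\<dots> = - exp (2 * of_real pi * \<i> * (of_int n * \<tau>))"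
      by (simp add: exp_diff)
    finally have "((\<lambda>m. 1 / (of_int n * \<tau> - 1 / 2 + of_int m)\<^sup>2) has_sum
                     - 4 * of_real pi ^ 2 * koebe (- (Q ^ nat \<bar>n\<bar>))) UNIV"
      using has_sum_inverse_square_int[OF half] koebe_nome_power[of "-1" \<tau> n]
      by (simp add: pi_over_sin_squared_eq_koebe Q_def)
    moreover have "((\<lambda>m. 1 / (of_int n * \<tau> + of_int m)\<^sup>2) has_sum
        (if nat \<bar>n\<bar> = 0 then of_real pi ^ 2 / 3 else - 4 * of_real pi ^ 2 * koebe (Q ^ nat \<bar>n\<bar>))) UNIV"
    proof (cases "n = 0")
      case True
      then show ?thesis using has_sum_inverse_squares_int by simp
    next
      case False
      then have "of_int n * \<tau> \<notin> \<int>" using \<tau>0 by (intro not_Ints_if_Im) auto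
      from has_sum_inverse_square_int[OF this] show ?thesis
        using False koebe_nome_power[of 1 \<tau> n]
        by (simp add: pi_over_sin_squared_eq_koebe Q_def)
    qed
    ultimately have rows: "((\<lambda>m. 1 / (of_int n * \<tau> - 1 / 2 + of_int m)\<^sup>2 + - (1 / (of_int n * \<tau> + of_int m)\<^sup>2)) has_sum h (nat \<bar>n\<bar>)) UNIV"
      unfolding h_def diff_conv_add_uminus by (intro has_sum_add has_sum_uminusI)
    have "f (of_int m + of_int n * \<tau>) = 1 / (of_int n * \<tau> - 1 / 2 + of_int m)\<^sup>2 + - (1 / (of_int n * \<tau> + of_int m)\<^sup>2)" for m
    proof -
      have "(1 / 2 - (of_int m + of_int n * \<tau>))\<^sup>2 = (of_int n * \<tau> - 1 / 2 + of_int m)\<^sup>2"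
        by (simp add: power2_eq_square algebra_simps)
      then show ?thesis by (simp add: f_def add.commute)
    qed
    with rows show "((\<lambda>m. f (of_int m + of_int n * \<tau>)) has_sum h (nat \<bar>n\<bar>)) UNIV" by simp
  qed
  moreover have "((\<lambda>n::int. h (nat \<bar>n\<bar>)) has_sum
      h 0 + 2 * (- 16 * of_real pi ^ 2 * lambert_sigma (Q\<^sup>2) + 8 * of_real pi ^ 2 * lambert_sigma Q)) UNIV"
  proof (rule has_sum_int_abs)
    have hs: "((\<lambda>n. - 16 * of_real pi ^ 2 * koebe ((Q\<^sup>2) ^ n) + 8 * of_real pi ^ 2 * koebe (Q ^ n))
             has_sum - 16 * of_real pi ^ 2 * lambert_sigma (Q\<^sup>2) + 8 * of_real pi ^ 2 * lambert_sigma Q) {1..}"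
      by (intro has_sum_add has_sum_cmult_right has_sum_lambert_sigma Q)
    have teq: "- 16 * of_real pi ^ 2 * koebe ((Q\<^sup>2) ^ n) + 8 * of_real pi ^ 2 * koebe (Q ^ n) = h n"
      if n: "n \<in> {1..}" for n
    proof -
      have "norm (Q ^ n) < 1" using n Q by (auto simp: norm_power power_less_one_iff)
      then have "Q ^ n \<noteq> 1" "Q ^ n \<noteq> -1" by auto
      from koebe_minus[OF this] have k: "koebe (- (Q ^ n)) = 4 * koebe ((Q\<^sup>2) ^ n) - koebe (Q ^ n)"
        by (simp add: mult.commute flip: power_mult)
      show ?thesis using n by (simp add: h_def k algebra_simps)
    qed
    from iffD1[OF has_sum_cong[OF teq] hs]
    show "(h has_sum - 16 * of_real pi ^ 2 * lambert_sigma (Q\<^sup>2) + 8 * of_real pi ^ 2 * lambert_sigma Q) {1..}" .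
  qed
  ultimately have "weierstrass_e1 \<tau> = h 0 + 2 * (- 16 * of_real pi ^ 2 * lambert_sigma (Q\<^sup>2) + 8 * of_real pi ^ 2 * lambert_sigma Q)"
    unfolding e1 by (rule has_sum_unique)
  moreover have "h 0 = 2 * of_real pi ^ 2 / 3" by (simp add: h_def koebe_def)
  ultimately show ?thesis
    unfolding weierstrass_eta1_eq_lambert_sigma[OF \<tau>] Q_def[symmetric] by (simp add: field_simps)
qed

section \<open>The Jacobi triple product\<close>

text \<open>Tannery's theorem over an arbitrary index set: domination makes the finite partial sums converge uniformly
  in \<open>N\<close>, so the two limits may be interchanged.\<close>
lemma has_sum_dominated_limit:
  fixes f :: "nat \<Rightarrow> 'a \<Rightarrow> 'b::banach"
  assumes S: "\<And>N. (f N has_sum S N) A"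
    and lim: "\<And>j. j \<in> A \<Longrightarrow> (\<lambda>N. f N j) \<longlonglongrightarrow> g j"
    and bound: "\<And>N j. j \<in> A \<Longrightarrow> norm (f N j) \<le> M j"
    and M: "M summable_on A"
  shows "S \<longlonglongrightarrow> infsum g A" "g summable_on A"
proof -
  have "norm (g j) \<le> M j" if "j \<in> A" for j
    by (rule LIMSEQ_le_const2[OF tendsto_norm[OF lim[OF that]]]) (use bound that in auto)
  then have "(\<lambda>j. norm (g j)) summable_on A"
    using M by (intro summable_on_comparison_test[of M A "\<lambda>j. norm (g j)"]) auto
  then show g: "g summable_on A" by (rule abs_summable_summable)
  have unif: "uniform_limit UNIV (\<lambda>X N. \<Sum>j\<in>X. f N j) (\<lambda>N. \<Sum>\<^sub>\<infinity>j\<in>A. f N j) (finite_subsets_at_top A)"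
    using bound M by (rule Weierstrass_m_test_general)
  have partial: "\<forall>\<^sub>F X in finite_subsets_at_top A. ((\<lambda>N. \<Sum>j\<in>X. f N j) \<longlongrightarrow> sum g X) sequentially"
    by (rule eventually_finite_subsets_at_top_weakI) (auto intro!: tendsto_sum lim)
  have "(sum g \<longlongrightarrow> infsum g A) (finite_subsets_at_top A)"
    using has_sum_infsum[OF g] by (simp add: has_sum_def)
  from swap_uniform_limit'[OF partial this unif]
  have "(\<lambda>N. \<Sum>\<^sub>\<infinity>j\<in>A. f N j) \<longlonglongrightarrow> infsum g A" by simp
  moreover have "(\<Sum>\<^sub>\<infinity>j\<in>A. f N j) = S N" for N using S by (rule infsumI)
  ultimately show "S \<longlonglongrightarrow> infsum g A" by simp
qed

text \<open>This is \<open>-log (\<Prod>n\<ge>1. 1 - x^n)\<close>, expanded into a double series with nonnegative terms. It is taken as the definition,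
  rather than the product, because a series of exponentials in \<open>b\<close> (for \<open>x = exp (-2\<pi>b)\<close>) can be differentiated term by
  term.\<close>
definition euler_log :: "real \<Rightarrow> real" where
  "euler_log x = (\<Sum>\<^sub>\<infinity>(m, n)\<in>{1..} \<times> {1..}. x ^ (m * n) / n)"

definition euler_prod :: "real \<Rightarrow> real" where
  "euler_prod x = exp (- euler_log x)"

text \<open>The \<open>q\<close>-Pochhammer symbol \<open>(x; x)\<^sub>N\<close>.\<close>
definition qpoch :: "real \<Rightarrow> nat \<Rightarrow> real" where
  "qpoch x N = (\<Prod>k<N. 1 - x ^ Suc k)"

lemma euler_prod_pos: "euler_prod x > 0"
  by (simp add: euler_prod_def)

lemma has_sum_ln_one_minus:
  fixes u :: real
  assumes "0 \<le> u" "u < 1"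
  shows "((\<lambda>n. u ^ n / n) has_sum - ln (1 - u)) {1..}"
proof -
  have "(\<lambda>n. u ^ n / n) sums - ln (1 - u)"
    using sums_minus[OF ln_series'[of "- u"]] assms by simp
  then have "((\<lambda>n. u ^ n / n) has_sum - ln (1 - u)) UNIV"
    by (rule sums_nonneg_imp_has_sum) (use assms in auto)
  then show ?thesis
    by (subst has_sum_cong_neutral[of UNIV "{1..}" _ "\<lambda>n. u ^ n / n"]) auto
qed

lemma has_sum_euler_log:
  assumes x: "0 < x" "x < 1"
  shows "((\<lambda>(m, n). x ^ (m * n) / n) has_sum euler_log x) ({1..} \<times> {1..})"
    and "((\<lambda>m. - ln (1 - x ^ m)) has_sum euler_log x) {1..}"
proof -
  have xm: "0 \<le> x ^ m" "x ^ m < 1" "x ^ m \<le> x" if "m \<in> {1..}" for m :: nat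
    using x that power_decreasing[of 1 m x] by (auto simp: power_less_one_iff)
  have rows: "((\<lambda>n. case (m, n) of (m, n) \<Rightarrow> x ^ (m * n) / n) has_sum - ln (1 - x ^ m)) {1..}"
    if "m \<in> {1..}" for m
    using has_sum_ln_one_minus[OF xm(1,2)[OF that]] by (simp add: power_mult)
  have "(\<lambda>m. - ln (1 - x ^ m)) summable_on {1..}"
  proof (rule summable_on_comparison_test)
    have "(\<lambda>m. inverse (1 - x) * x ^ m) summable_on {1..}"
      using x by (intro summable_on_cmult_right summable_on_power_atLeast_1) auto
    then show "(\<lambda>m. inverse (1 - x) * x ^ m) summable_on {1..}" .
    fix m :: nat assume m: "m \<in> {1..}"
    have "- ln (1 - x ^ m) = ln (inverse (1 - x ^ m))"
      using xm[OF m] by (simp add: ln_inverse)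
    also have "\<dots> \<le> inverse (1 - x ^ m) - 1"
      using xm[OF m] by (intro ln_le_minus_one) auto
    also have "\<dots> = inverse (1 - x ^ m) * x ^ m"
      using xm[OF m] by (simp add: field_simps)
    also have "\<dots> \<le> inverse (1 - x) * x ^ m"
      using xm[OF m] x by (intro mult_right_mono le_imp_inverse_le) auto
    finally show "- ln (1 - x ^ m) \<le> inverse (1 - x) * x ^ m" .
    show "0 \<le> - ln (1 - x ^ m)" using xm[OF m] by simp
  qed
  from summable_on_SigmaI[OF rows this]
  have s: "(\<lambda>(m, n). x ^ (m * n) / n) summable_on ({1..} \<times> {1..})"
    using x by auto
  show *: "((\<lambda>(m, n). x ^ (m * n) / n) has_sum euler_log x) ({1..} \<times> {1..})"
    unfolding euler_log_def by (rule has_sum_infsum[OF s])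
  show "((\<lambda>m. - ln (1 - x ^ m)) has_sum euler_log x) {1..}"
    by (rule has_sum_SigmaD[OF * rows])
qed

lemma tendsto_qpoch:
  assumes x: "0 < x" "x < 1"
  shows "qpoch x \<longlonglongrightarrow> euler_prod x"
proof -
  have "((\<lambda>m. - ln (1 - x ^ Suc m)) has_sum euler_log x) UNIV"
    using has_sum_euler_log(2)[OF x]
    by (subst has_sum_reindex_bij_witness[of UNIV "\<lambda>n. n - 1" Suc "{1..}" "\<lambda>m. - ln (1 - x ^ m)" _ "euler_log x" "euler_log x"]) auto
  then have "(\<lambda>m. - ln (1 - x ^ Suc m)) sums euler_log x"
    by (rule has_sum_imp_sums)
  from sums_minus[OF this] have "(\<lambda>N. \<Sum>m<N. ln (1 - x ^ Suc m)) \<longlonglongrightarrow> - euler_log x"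
    by (simp add: sums_def)
  then have "(\<lambda>N. exp (\<Sum>m<N. ln (1 - x ^ Suc m))) \<longlonglongrightarrow> exp (- euler_log x)"
    by (rule tendsto_exp)
  moreover have "exp (\<Sum>m<N. ln (1 - x ^ Suc m)) = qpoch x N" for N
  proof -
    have "x ^ Suc m < 1" for m using x power_less_one_iff[of x "Suc m"] by simp
    then show ?thesis by (simp add: exp_sum qpoch_def)
  qed
  ultimately show ?thesis by (simp add: euler_prod_def)
qed

lemma qpoch_bounds:
  assumes x: "0 < x" "x < 1"
  shows "qpoch x N > 0" "qpoch x N \<le> 1" "euler_prod x \<le> qpoch x N"
proof -
  have pos: "0 < 1 - x ^ Suc m" and le: "1 - x ^ Suc m \<le> 1" for m
    using x power_less_one_iff[of x "Suc m"] by (simp_all del: power_Suc)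
  show p: "qpoch x N > 0" for N
    unfolding qpoch_def using pos by (intro prod_pos) auto
  show "qpoch x N \<le> 1"
    unfolding qpoch_def using pos le by (intro prod_le_1) (auto intro: less_imp_le)
  have "decseq (qpoch x)"
  proof (rule decseq_SucI)
    show "qpoch x (Suc n) \<le> qpoch x n" for n
      using mult_left_mono[OF le[of n], of "qpoch x n"] p[of n]
      by (simp add: qpoch_def del: power_Suc)
  qed
  then show "euler_prod x \<le> qpoch x N"
    using tendsto_qpoch[OF x] by (rule decseq_ge)
qed

text \<open>Extending \<open>1 / (p; p)\<^sub>k\<close> by 0 to negative \<open>k\<close> is forced by the recurrence below, whose factor
  \<open>1 - p^(k+1)\<close> vanishes at \<open>k = -1\<close>. With this convention the finite triple product is a sum over all integers and its
  induction has no boundary cases.\<close>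
definition inv_qpoch :: "real \<Rightarrow> int \<Rightarrow> real" where
  "inv_qpoch p k = (if k < 0 then 0 else 1 / qpoch p (nat k))"

lemma inv_qpoch_rec:
  assumes p: "0 < p" "p < 1"
  shows "inv_qpoch p k = (1 - p * p powi k) * inv_qpoch p (k + 1)"
proof -
  consider "k < -1" | "k = -1" | "k \<ge> 0" by linarith
  then show ?thesis
  proof cases
    case 3
    define n where "n = nat k"
    have k: "k = int n" "nat (int n + 1) = Suc n" using 3 by (auto simp: n_def)
    have "1 - p ^ Suc n \<noteq> 0" using p power_less_one_iff[of p "Suc n"] by (simp del: power_Suc)
    then show ?thesis
      by (simp add: inv_qpoch_def k qpoch_def)
  qed (use p in \<open>auto simp: inv_qpoch_def power_int_minus\<close>)
qed

text \<open>The Gaussian binomial coefficient \<open>2N choose (N + j)\<close> in base \<open>q\<^sup>2\<close>.\<close>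
definition triple_coeff :: "real \<Rightarrow> nat \<Rightarrow> int \<Rightarrow> real" where
  "triple_coeff q N j = qpoch (q\<^sup>2) (2 * N) * inv_qpoch (q\<^sup>2) (int N - j) * inv_qpoch (q\<^sup>2) (int N + j)"

text \<open>Two steps of the \<open>q\<close>-Pascal rule at once. Writing both sides in terms of \<open>A = p^(N-j)\<close> and \<open>B = p^(N+j)\<close>
  reduces the claim to a polynomial identity in \<open>p\<close>, \<open>A\<close> and \<open>B\<close>.\<close>
lemma triple_coeff_rec:
  assumes q: "0 < q" "q < 1" and z: "z \<noteq> 0"
  defines "f \<equiv> \<lambda>N j. triple_coeff q N j * (q powi (j * j) * z powi j)"
  shows "f (Suc N) j = (1 + q ^ (4 * N + 2)) * f N j + q ^ (2 * N + 1) * z * f N (j - 1) + q ^ (2 * N + 1) / z * f N (j + 1)"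
proof -
  define p where "p = q\<^sup>2"
  have p: "0 < p" "p < 1" using q by (auto simp: p_def power_less_one_iff)
  have pq: "p powi k = q powi (2 * k)" for k
    by (simp add: p_def power_int_mult)
  define A where "A = p powi (int N - j)"
  define B where "B = p powi (int N + j)"
  define R where "R = inv_qpoch p (int N - j + 1)"
  define T where "T = inv_qpoch p (int N + j + 1)"
  define w where "w = q powi (j * j) * z powi j"
  define C where "C = qpoch p (2 * N)"
  have "A * B = q powi (2 * (int N - j) + 2 * (int N + j))"
    using q by (subst power_int_add) (simp_all add: A_def B_def pq)
  also have "2 * (int N - j) + 2 * (int N + j) = int (4 * N)" by simp
  finally have AB0: "A * B = q ^ (4 * N)" by (simp only: power_int_of_nat)
  have AB: "p * A * B = q ^ (4 * N + 2)"
    by (simp only: mult.assoc AB0) (simp add: p_def power2_eq_square)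
  have 1: "inv_qpoch p (int N - j) = (1 - p * A) * R" "inv_qpoch p (int N + j) = (1 - p * B) * T"
    unfolding A_def B_def R_def T_def by (rule inv_qpoch_rec[OF p])+
  have pm: "p * p powi (k - 1) = p powi k" for k
    using p by (simp add: power_int_diff)
  have 2: "inv_qpoch p (int N - j - 1) = (1 - A) * ((1 - p * A) * R)"
          "inv_qpoch p (int N + j - 1) = (1 - B) * ((1 - p * B) * T)"
    using inv_qpoch_rec[OF p, of "int N - j - 1"] inv_qpoch_rec[OF p, of "int N + j - 1"]
    by (simp_all only: pm diff_add_cancel 1 A_def[symmetric] B_def[symmetric])
  have 3: "qpoch p (2 * Suc N) = C * (1 - p * (A * B)) * (1 - p * (p * (A * B)))"
  proof -
    have "2 * Suc N = Suc (Suc (2 * N))" by simp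
    moreover have "p ^ (2 * N) = A * B" by (simp add: AB0 p_def flip: power_mult)
    ultimately show ?thesis by (simp add: qpoch_def C_def del: mult_Suc_right)
  qed
  have qn: "q ^ n * q powi i = q powi (int n + i)" for n i
    using q by (simp add: power_int_add)
  have qp: "q powi (2 + 2 * k + i) = p * q powi (2 * k) * q powi i" for k i
    using q by (simp add: power_int_add p_def)
  have 4: "q ^ (2 * N + 1) * z * (q powi ((j - 1) * (j - 1)) * z powi (j - 1)) = p * A * w"
  proof -
    have "q ^ (2 * N + 1) * q powi ((j - 1) * (j - 1)) = q powi (int (2 * N + 1) + (j - 1) * (j - 1))"
      by (rule qn)
    also have "int (2 * N + 1) + (j - 1) * (j - 1) = 2 + 2 * (int N - j) + j * j"
      by (simp add: algebra_simps)
    also have "q powi \<dots> = p * A * q powi (j * j)"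
      unfolding A_def pq by (rule qp)
    finally show ?thesis
      using z by (simp add: w_def power_int_diff field_simps)
  qed
  have 5: "q ^ (2 * N + 1) / z * (q powi ((j + 1) * (j + 1)) * z powi (j + 1)) = p * B * w"
  proof -
    have "q ^ (2 * N + 1) * q powi ((j + 1) * (j + 1)) = q powi (int (2 * N + 1) + (j + 1) * (j + 1))"
      by (rule qn)
    also have "int (2 * N + 1) + (j + 1) * (j + 1) = 2 + 2 * (int N + j) + j * j"
      by (simp add: algebra_simps)
    also have "q powi \<dots> = p * B * q powi (j * j)"
      unfolding B_def pq by (rule qp)
    finally show ?thesis
      using z by (simp add: w_def power_int_add field_simps)
  qed
  have f0: "f N j = C * ((1 - p * A) * R) * ((1 - p * B) * T) * w"
    by (simp add: f_def triple_coeff_def p_def[symmetric] 1 C_def w_def)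
  have f1: "f (Suc N) j = C * (1 - p * (A * B)) * (1 - p * (p * (A * B))) * R * T * w"
  proof -
    have "int (Suc N) - j = int N - j + 1" "int (Suc N) + j = int N + j + 1" by simp_all
    then show ?thesis
      unfolding f_def triple_coeff_def p_def[symmetric] by (simp only: 3 R_def T_def w_def mult.assoc)
  qed
  have f2: "q ^ (2 * N + 1) * z * f N (j - 1) = C * R * ((1 - B) * ((1 - p * B) * T)) * (p * A * w)"
  proof -
    have "int N - (j - 1) = int N - j + 1" "int N + (j - 1) = int N + j - 1" by simp_all
    then have "f N (j - 1) = C * R * ((1 - B) * ((1 - p * B) * T)) * (q powi ((j - 1) * (j - 1)) * z powi (j - 1))"
      unfolding f_def triple_coeff_def p_def[symmetric] by (simp only: 2 R_def C_def)
    then show ?thesis unfolding 4[symmetric] by (simp only: mult_ac)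
  qed
  have f3: "q ^ (2 * N + 1) / z * f N (j + 1) = C * ((1 - A) * ((1 - p * A) * R)) * T * (p * B * w)"
  proof -
    have "int N - (j + 1) = int N - j - 1" "int N + (j + 1) = int N + j + 1" by simp_all
    then have "f N (j + 1) = C * ((1 - A) * ((1 - p * A) * R)) * T * (q powi ((j + 1) * (j + 1)) * z powi (j + 1))"
      unfolding f_def triple_coeff_def p_def[symmetric] by (simp only: 2 T_def C_def)
    then show ?thesis unfolding 5[symmetric] by (simp only: mult_ac)
  qed
  have "q ^ (4 * N + 2) = p * A * B" using AB by simp
  then show ?thesis unfolding f0 f1 f2 f3 by (simp only:) (simp add: algebra_simps)
qed

text \<open>Passing from \<open>N\<close> to \<open>N + 1\<close> multiplies the product by
  \<open>(1 + q^(4N+2)) + q^(2N+1) z + q^(2N+1) / z\<close>, which acts on the coefficient sequence as in \<open>triple_coeff_rec\<close>.\<close>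
theorem finite_triple_product:
  assumes q: "0 < q" "q < 1" and z: "z \<noteq> 0"
  shows "((\<lambda>j. triple_coeff q N j * (q powi (j * j) * z powi j)) has_sum
           (\<Prod>k<N. (1 + z * q ^ (2 * k + 1)) * (1 + q ^ (2 * k + 1) / z))) UNIV"
proof (induction N)
  case 0
  have "((\<lambda>j. triple_coeff q 0 j * (q powi (j * j) * z powi j)) has_sum 1) {0}"
    by (rule has_sum_finiteI) (auto simp: triple_coeff_def inv_qpoch_def qpoch_def)
  then have "((\<lambda>j. triple_coeff q 0 j * (q powi (j * j) * z powi j)) has_sum 1) UNIV"
    by (subst has_sum_cong_neutral[of "{0}" UNIV _ "\<lambda>j. triple_coeff q 0 j * (q powi (j * j) * z powi j)"])
       (auto simp: triple_coeff_def inv_qpoch_def)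
  then show ?case by simp
next
  case (Suc N)
  define f where "f = (\<lambda>N j. triple_coeff q N j * (q powi (j * j) * z powi j))"
  define P where "P = (\<Prod>k<N. (1 + z * q ^ (2 * k + 1)) * (1 + q ^ (2 * k + 1) / z))"
  have P: "(f N has_sum P) UNIV" using Suc.IH by (simp add: f_def P_def)
  have minus: "((\<lambda>j. f N (j - 1)) has_sum P) UNIV"
    using P by (subst has_sum_reindex_bij_witness[of UNIV "\<lambda>j. j + 1" "\<lambda>j. j - 1" UNIV "f N" _ P P]) auto
  have plus: "((\<lambda>j. f N (j + 1)) has_sum P) UNIV"
    using P by (subst has_sum_reindex_bij_witness[of UNIV "\<lambda>j. j - 1" "\<lambda>j. j + 1" UNIV "f N" _ P P]) auto
  have "((\<lambda>j. (1 + q ^ (4 * N + 2)) * f N j + q ^ (2 * N + 1) * z * f N (j - 1) + q ^ (2 * N + 1) / z * f N (j + 1)) has_sum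
          ((1 + q ^ (4 * N + 2)) * P + q ^ (2 * N + 1) * z * P + q ^ (2 * N + 1) / z * P)) UNIV"
    by (intro has_sum_add has_sum_cmult_right P minus plus)
  moreover have "f (Suc N) j = (1 + q ^ (4 * N + 2)) * f N j + q ^ (2 * N + 1) * z * f N (j - 1) + q ^ (2 * N + 1) / z * f N (j + 1)" for j
    unfolding f_def by (rule triple_coeff_rec[OF q z])
  ultimately have "(f (Suc N) has_sum ((1 + q ^ (4 * N + 2)) * P + q ^ (2 * N + 1) * z * P + q ^ (2 * N + 1) / z * P)) UNIV"
    by presburger
  moreover have "(1 + q ^ (4 * N + 2)) * P + q ^ (2 * N + 1) * z * P + q ^ (2 * N + 1) / z * P =
                  P * ((1 + z * q ^ (2 * N + 1)) * (1 + q ^ (2 * N + 1) / z))"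
  proof -
    have "q ^ (4 * N + 2) = q ^ (2 * N + 1) * q ^ (2 * N + 1)" by (simp flip: power_add)
    then show ?thesis using z by (simp add: field_simps)
  qed
  ultimately show ?case by (simp add: f_def P_def)
qed

text \<open>The Gaussian binomials tend to \<open>1 / (p; p)\<^sub>\<infinity>\<close> with \<open>p = q\<^sup>2\<close> and are bounded by
  \<open>1 / (p; p)\<^sub>\<infinity>\<^sup>2\<close>, so the finite identity passes to the limit by domination.\<close>
theorem jacobi_triple_product:
  assumes q: "0 < q" "q < 1" and z: "z \<noteq> 0"
    and summable: "(\<lambda>j::int. \<bar>q powi (j * j) * z powi j\<bar>) summable_on UNIV"
  shows "(\<lambda>N. \<Prod>k<N. (1 + z * q ^ (2 * k + 1)) * (1 + q ^ (2 * k + 1) / z))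
           \<longlonglongrightarrow> (\<Sum>\<^sub>\<infinity>j. q powi (j * j) * z powi j) / euler_prod (q\<^sup>2)"
proof -
  define E where "E = euler_prod (q\<^sup>2)"
  have E: "E > 0" by (simp add: E_def euler_prod_pos)
  have p: "0 < q\<^sup>2" "q\<^sup>2 < 1" using q by (auto simp: power_less_one_iff)
  have inv_lim: "(\<lambda>N. inv_qpoch (q\<^sup>2) (int N + i)) \<longlonglongrightarrow> 1 / E" for i
  proof -
    define m where "m = nat \<bar>i\<bar>"
    have "filterlim (\<lambda>N. nat (int N + i)) at_top sequentially"
      unfolding filterlim_at_top
    proof
      fix Z :: nat
      show "\<forall>\<^sub>F N in sequentially. Z \<le> nat (int N + i)"
        using eventually_ge_at_top[of "Z + m"] by eventually_elim (auto simp: m_def)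
    qed
    from filterlim_compose[OF tendsto_qpoch[OF p] this]
    have "(\<lambda>N. 1 / qpoch (q\<^sup>2) (nat (int N + i))) \<longlonglongrightarrow> 1 / E"
      using E by (intro tendsto_divide tendsto_const) (auto simp: E_def)
    moreover have "\<forall>\<^sub>F N in sequentially. 1 / qpoch (q\<^sup>2) (nat (int N + i)) = inv_qpoch (q\<^sup>2) (int N + i)"
      using eventually_ge_at_top[of m] by eventually_elim (auto simp: m_def inv_qpoch_def)
    ultimately show ?thesis by (rule Lim_transform_eventually)
  qed
  have inv_bound: "0 \<le> inv_qpoch (q\<^sup>2) i \<and> inv_qpoch (q\<^sup>2) i \<le> 1 / E" for i
    using frac_le[of 1 1 E "qpoch (q\<^sup>2) (nat i)"] qpoch_bounds[OF p, of "nat i"] E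
    by (auto simp: inv_qpoch_def E_def)
  have coeff_lim: "(\<lambda>N. triple_coeff q N j) \<longlonglongrightarrow> E * (1 / E) * (1 / E)" for j
    unfolding triple_coeff_def
  proof (intro tendsto_mult)
    have "filterlim (\<lambda>N::nat. 2 * N) at_top sequentially"
      by (rule filterlim_subseq) (auto simp: strict_mono_def)
    from filterlim_compose[OF tendsto_qpoch[OF p] this]
    show "(\<lambda>N. qpoch (q\<^sup>2) (2 * N)) \<longlonglongrightarrow> E" by (simp add: E_def)
    show "(\<lambda>N. inv_qpoch (q\<^sup>2) (int N - j)) \<longlonglongrightarrow> 1 / E" using inv_lim[of "- j"] by simp
  qed (rule inv_lim)
  have coeff_bound: "\<bar>triple_coeff q N j\<bar> \<le> 1 / E * (1 / E)" for N j
  proof -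
    have "\<bar>triple_coeff q N j\<bar> = qpoch (q\<^sup>2) (2 * N) * (inv_qpoch (q\<^sup>2) (int N - j) * inv_qpoch (q\<^sup>2) (int N + j))"
      using qpoch_bounds[OF p, of "2 * N"] inv_bound by (simp add: triple_coeff_def abs_mult)
    also have "\<dots> \<le> 1 * (1 / E * (1 / E))"
      using qpoch_bounds[OF p, of "2 * N"] inv_bound E by (intro mult_mono mult_nonneg_nonneg) auto
    finally show ?thesis by simp
  qed
  have "(\<lambda>N. \<Prod>k<N. (1 + z * q ^ (2 * k + 1)) * (1 + q ^ (2 * k + 1) / z))
           \<longlonglongrightarrow> (\<Sum>\<^sub>\<infinity>j. E * (1 / E) * (1 / E) * (q powi (j * j) * z powi j))"
  proof (rule has_sum_dominated_limit(1))
    show "((\<lambda>j. triple_coeff q N j * (q powi (j * j) * z powi j)) has_sum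
           (\<Prod>k<N. (1 + z * q ^ (2 * k + 1)) * (1 + q ^ (2 * k + 1) / z))) UNIV" for N
      by (rule finite_triple_product[OF q z])
    show "(\<lambda>N. triple_coeff q N j * (q powi (j * j) * z powi j))
             \<longlonglongrightarrow> E * (1 / E) * (1 / E) * (q powi (j * j) * z powi j)" for j
      by (intro tendsto_mult coeff_lim[unfolded mult.assoc] tendsto_const coeff_lim)
    show "norm (triple_coeff q N j * (q powi (j * j) * z powi j)) \<le> 1 / E * (1 / E) * \<bar>q powi (j * j) * z powi j\<bar>" for N j
      unfolding real_norm_def abs_mult[of "triple_coeff q N j"] by (intro mult_right_mono coeff_bound) auto
    show "(\<lambda>j. 1 / E * (1 / E) * \<bar>q powi (j * j) * z powi j\<bar>) summable_on UNIV"
      by (rule summable_on_cmult_right[OF summable])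
  qed
  then show ?thesis unfolding infsum_cmult_right' using E by (simp add: E_def[symmetric])
qed

section \<open>Eta quotients for theta constants\<close>

definition odd_prod :: "real \<Rightarrow> nat \<Rightarrow> real" where
  "odd_prod x N = (\<Prod>k<N. 1 - x ^ (2 * k + 1))"

lemma qpoch_double: "qpoch x (2 * N) = odd_prod x N * qpoch (x\<^sup>2) N"
proof (induction N)
  case (Suc N)
  have "2 * Suc N = Suc (Suc (2 * N))" by simp
  then have "qpoch x (2 * Suc N) = qpoch x (2 * N) * (1 - x ^ (2 * N + 1)) * (1 - x ^ (2 * Suc N))"
    by (simp add: qpoch_def del: mult_Suc_right power_Suc)
  also have "x ^ (2 * Suc N) = (x\<^sup>2) ^ Suc N" by (simp only: power_mult)
  finally show ?case unfolding Suc.IH by (simp add: odd_prod_def qpoch_def del: power_Suc)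
qed (simp add: qpoch_def odd_prod_def)

text \<open>The factors of \<open>odd_prod (-x)\<close> are the \<open>1 + x^(2k+1)\<close>, so the factors pair off as differences of squares.\<close>
lemma odd_prod_uminus: "odd_prod (- x) N * odd_prod x N = odd_prod (x\<^sup>2) N"
proof -
  have "(1 - (- x) ^ (2 * k + 1)) * (1 - x ^ (2 * k + 1)) = 1 - (x\<^sup>2) ^ (2 * k + 1)" for k
  proof -
    have "(1 - (- x) ^ (2 * k + 1)) * (1 - x ^ (2 * k + 1)) = 1 - x ^ (2 * k + 1) * x ^ (2 * k + 1)"
      by (simp add: algebra_simps)
    also have "x ^ (2 * k + 1) * x ^ (2 * k + 1) = (x\<^sup>2) ^ (2 * k + 1)"
      by (simp only: power_mult_distrib[symmetric] power2_eq_square)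
    finally show ?thesis .
  qed
  then show ?thesis unfolding odd_prod_def by (simp only: prod.distrib[symmetric])
qed

lemma tendsto_odd_prod:
  assumes x: "0 < x" "x < 1"
  shows "odd_prod x \<longlonglongrightarrow> euler_prod x / euler_prod (x\<^sup>2)"
proof -
  have p: "0 < x\<^sup>2" "x\<^sup>2 < 1" using x by (auto simp: power_less_one_iff)
  have "filterlim (\<lambda>N::nat. 2 * N) at_top sequentially"
    by (rule filterlim_subseq) (auto simp: strict_mono_def)
  from filterlim_compose[OF tendsto_qpoch[OF x] this]
  have "(\<lambda>N. qpoch x (2 * N) / qpoch (x\<^sup>2) N) \<longlonglongrightarrow> euler_prod x / euler_prod (x\<^sup>2)"
    using euler_prod_pos[of "x\<^sup>2"] by (intro tendsto_divide tendsto_qpoch p) auto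
  moreover have "qpoch x (2 * N) / qpoch (x\<^sup>2) N = odd_prod x N" for N
    using qpoch_bounds(1)[OF p, of N] by (simp add: qpoch_double)
  ultimately show ?thesis by simp
qed

lemma tendsto_odd_prod_uminus:
  assumes x: "0 < x" "x < 1"
  shows "odd_prod (- x) \<longlonglongrightarrow> euler_prod (x\<^sup>2) ^ 2 / (euler_prod x * euler_prod (x ^ 4))"
proof -
  have p: "0 < x\<^sup>2" "x\<^sup>2 < 1" using x by (auto simp: power_less_one_iff)
  have pos: "odd_prod x N > 0" for N
    unfolding odd_prod_def using x by (intro prod_pos) (auto simp: power_less_one_iff simp del: power_Suc)
  have "(\<lambda>N. odd_prod (x\<^sup>2) N / odd_prod x N) \<longlonglongrightarrow>
          (euler_prod (x\<^sup>2) / euler_prod ((x\<^sup>2)\<^sup>2)) / (euler_prod x / euler_prod (x\<^sup>2))"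
    using euler_prod_pos[of x] euler_prod_pos[of "x\<^sup>2"] by (intro tendsto_divide tendsto_odd_prod x p) auto
  moreover have "odd_prod (x\<^sup>2) N / odd_prod x N = odd_prod (- x) N" for N
    using pos[of N] by (simp flip: odd_prod_uminus)
  moreover have "(x\<^sup>2)\<^sup>2 = x ^ 4" by simp
  ultimately show ?thesis by (simp add: power2_eq_square[of "euler_prod (x\<^sup>2)"] mult_ac)
qed

lemma summable_on_power_abs:
  fixes x :: real
  assumes "0 < x" "x < 1"
  shows "(\<lambda>j::int. x ^ nat \<bar>j\<bar>) summable_on UNIV"
proof -
  have "(\<lambda>n. x ^ n) summable_on {1..}"
    using assms by (intro summable_on_power_atLeast_1) auto
  from has_sum_int_abs[OF has_sum_infsum[OF this]] show ?thesis
    by (rule has_sum_imp_summable)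
qed

lemma powi_nonneg: "k \<ge> 0 \<Longrightarrow> x powi k = x ^ nat k"
  by (simp add: power_int_def)

text \<open>The value \<open>\<vartheta>\<^sub>3(0)\<close> at real nome \<open>x\<close>.\<close>
definition theta_null :: "real \<Rightarrow> real" where
  "theta_null x = (\<Sum>\<^sub>\<infinity>j::int. x ^ nat (j * j))"

lemma abs_le_square_int: "\<bar>j\<bar> \<le> j * j" for j :: int
proof (cases "j = 0")
  case False
  then have "\<bar>j\<bar> * 1 \<le> \<bar>j\<bar> * \<bar>j\<bar>" by (intro mult_left_mono) auto
  then show ?thesis by simp
qed auto

lemma has_sum_theta_null:
  assumes x: "0 < x" "x < 1"
  shows "((\<lambda>j::int. x ^ nat (j * j)) has_sum theta_null x) UNIV"
proof -
  have "(\<lambda>j::int. x ^ nat (j * j)) summable_on UNIV"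
  proof (rule summable_on_comparison_test[OF summable_on_power_abs[OF x]])
    show "x ^ nat (j * j) \<le> x ^ nat \<bar>j\<bar>" for j
      using x abs_le_square_int[of j] by (intro power_decreasing nat_mono) auto
  qed (use x in auto)
  then show ?thesis unfolding theta_null_def by (rule has_sum_infsum)
qed

text \<open>The triple product at \<open>q = x\<close>, \<open>z = 1\<close> is the square of \<open>\<Prod>k. 1 + x^(2k+1)\<close>, whose limit is known from
  \<open>tendsto_odd_prod_uminus\<close>.\<close>
theorem theta_null_eta_quotient:
  assumes x: "0 < x" "x < 1"
  shows "theta_null x = euler_prod (x\<^sup>2) ^ 5 / (euler_prod x ^ 2 * euler_prod (x ^ 4) ^ 2)"
proof -
  have e: "x powi (j * j) = x ^ nat (j * j)" for j by (rule powi_nonneg) simp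
  have "(\<lambda>N. \<Prod>k<N. (1 + 1 * x ^ (2 * k + 1)) * (1 + x ^ (2 * k + 1) / 1))
          \<longlonglongrightarrow> (\<Sum>\<^sub>\<infinity>j. x powi (j * j) * 1 powi j) / euler_prod (x\<^sup>2)"
    using has_sum_imp_summable[OF has_sum_theta_null[OF x]] x
    by (intro jacobi_triple_product x) (auto simp: e)
  also have "(\<lambda>N. \<Prod>k<N. (1 + 1 * x ^ (2 * k + 1)) * (1 + x ^ (2 * k + 1) / 1)) = (\<lambda>N. odd_prod (- x) N * odd_prod (- x) N)"
    by (simp add: odd_prod_def prod.distrib)
  also have "(\<Sum>\<^sub>\<infinity>j. x powi (j * j) * 1 powi j) = theta_null x"
    by (simp add: theta_null_def e)
  finally have "(\<lambda>N. odd_prod (- x) N * odd_prod (- x) N) \<longlonglongrightarrow> theta_null x / euler_prod (x\<^sup>2)" .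
  moreover have "(\<lambda>N. odd_prod (- x) N * odd_prod (- x) N) \<longlonglongrightarrow>
      euler_prod (x\<^sup>2) ^ 2 / (euler_prod x * euler_prod (x ^ 4)) * (euler_prod (x\<^sup>2) ^ 2 / (euler_prod x * euler_prod (x ^ 4)))"
    by (intro tendsto_mult tendsto_odd_prod_uminus x)
  ultimately have "theta_null x / euler_prod (x\<^sup>2) =
      euler_prod (x\<^sup>2) ^ 2 / (euler_prod x * euler_prod (x ^ 4)) * (euler_prod (x\<^sup>2) ^ 2 / (euler_prod x * euler_prod (x ^ 4)))"
    by (rule LIMSEQ_unique)
  then have "theta_null x = euler_prod (x\<^sup>2) *
      (euler_prod (x\<^sup>2) ^ 2 / (euler_prod x * euler_prod (x ^ 4)) * (euler_prod (x\<^sup>2) ^ 2 / (euler_prod x * euler_prod (x ^ 4))))"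
    using euler_prod_pos[of "x\<^sup>2"] by (simp add: divide_eq_eq mult.commute)
  also have "E2 * (E2\<^sup>2 / (E1 * E4) * (E2\<^sup>2 / (E1 * E4))) = E2 ^ 5 / (E1\<^sup>2 * E4\<^sup>2)" for E1 E2 E4 :: real
    by (simp add: power_mult_distrib power2_eq_square eval_nat_numeral mult_ac)
  finally show ?thesis .
qed

text \<open>At \<open>q = x\<^sup>2\<close>, \<open>z = -x\<close> the factors of the triple product are \<open>1 - x^(4k+3)\<close> and \<open>1 - x^(4k+1)\<close>, that is, all
  odd exponents. The exponents of the series are \<open>2j\<^sup>2 + j\<close>.\<close>
lemma has_sum_gauss_triangular_int:
  assumes x: "0 < x" "x < 1"
  shows "((\<lambda>j::int. (- x) ^ nat (j * (2 * j + 1))) has_sum euler_prod x * euler_prod (x ^ 4) / euler_prod (x\<^sup>2)) UNIV"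
proof -
  have p: "0 < x\<^sup>2" "x\<^sup>2 < 1" using x by (auto simp: power_less_one_iff)
  have nn: "0 \<le> j * (2 * j + 1)" "\<bar>j\<bar> \<le> j * (2 * j + 1)" for j :: int
    using abs_le_square_int[of j] by (auto simp: algebra_simps abs_le_iff)
  have e: "(x\<^sup>2) powi (j * j) * (- x) powi j = (- x) ^ nat (j * (2 * j + 1))" for j
  proof -
    have "x\<^sup>2 = (- x) powi 2" by (simp add: power_int_def)
    then have "(x\<^sup>2) powi (j * j) * (- x) powi j = (- x) powi (2 * (j * j) + j)"
      using x by (simp only: power_int_mult[symmetric]) (subst power_int_add, auto)
    also have "2 * (j * j) + j = j * (2 * j + 1)" by (simp add: algebra_simps)
    finally show ?thesis using powi_nonneg[OF nn(1)] by simp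
  qed
  have s: "(\<lambda>j::int. \<bar>(- x) ^ nat (j * (2 * j + 1))\<bar>) summable_on UNIV"
  proof (rule summable_on_comparison_test[OF summable_on_power_abs[OF x]])
    fix j :: int
    have "x ^ nat (j * (2 * j + 1)) \<le> x ^ nat \<bar>j\<bar>"
      using x by (intro power_decreasing nat_mono nn) auto
    then show "\<bar>(- x) ^ nat (j * (2 * j + 1))\<bar> \<le> x ^ nat \<bar>j\<bar>"
      using x by (simp add: power_abs)
  qed auto
  have "(\<lambda>N. \<Prod>k<N. (1 + (- x) * (x\<^sup>2) ^ (2 * k + 1)) * (1 + (x\<^sup>2) ^ (2 * k + 1) / (- x)))
          \<longlonglongrightarrow> (\<Sum>\<^sub>\<infinity>j. (x\<^sup>2) powi (j * j) * (- x) powi j) / euler_prod ((x\<^sup>2)\<^sup>2)"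
    using s x by (intro jacobi_triple_product p) (auto simp: e)
  also have "(\<lambda>N. \<Prod>k<N. (1 + (- x) * (x\<^sup>2) ^ (2 * k + 1)) * (1 + (x\<^sup>2) ^ (2 * k + 1) / (- x))) = (\<lambda>N. odd_prod x (2 * N))"
  proof
    fix N
    have f: "(1 + (- x) * (x\<^sup>2) ^ (2 * k + 1)) * (1 + (x\<^sup>2) ^ (2 * k + 1) / (- x)) =
             (1 - x ^ (2 * (2 * k) + 1)) * (1 - x ^ (2 * (2 * k + 1) + 1))" for k
    proof -
      have "(x\<^sup>2) ^ (2 * k + 1) = x * x ^ (2 * (2 * k) + 1)"
        by (simp add: power_mult[symmetric] power_add[symmetric] flip: power_Suc)
      moreover have "x * (x * x ^ (2 * (2 * k) + 1)) = x ^ (2 * (2 * k + 1) + 1)"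
        by (simp flip: power_Suc)
      ultimately show ?thesis using x by simp
    qed
    show "(\<Prod>k<N. (1 + (- x) * (x\<^sup>2) ^ (2 * k + 1)) * (1 + (x\<^sup>2) ^ (2 * k + 1) / (- x))) = odd_prod x (2 * N)"
      unfolding f by (induction N) (simp_all add: odd_prod_def mult.assoc del: power_Suc)
  qed
  finally have "(\<lambda>N. odd_prod x (2 * N)) \<longlonglongrightarrow> (\<Sum>\<^sub>\<infinity>j. (- x) ^ nat (j * (2 * j + 1))) / euler_prod (x ^ 4)"
    by (simp add: e)
  moreover have "filterlim (\<lambda>N::nat. 2 * N) at_top sequentially"
    by (rule filterlim_subseq) (auto simp: strict_mono_def)
  from filterlim_compose[OF tendsto_odd_prod[OF x] this]
  have "(\<lambda>N. odd_prod x (2 * N)) \<longlonglongrightarrow> euler_prod x / euler_prod (x\<^sup>2)" .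
  ultimately have "(\<Sum>\<^sub>\<infinity>j. (- x) ^ nat (j * (2 * j + 1))) / euler_prod (x ^ 4) = euler_prod x / euler_prod (x\<^sup>2)"
    by (rule LIMSEQ_unique)
  then have "(\<Sum>\<^sub>\<infinity>j. (- x) ^ nat (j * (2 * j + 1))) = euler_prod x * euler_prod (x ^ 4) / euler_prod (x\<^sup>2)"
    using euler_prod_pos[of "x ^ 4"] by (simp add: field_simps)
  moreover have "(\<lambda>j::int. (- x) ^ nat (j * (2 * j + 1))) summable_on UNIV"
    by (rule abs_summable_summable) (use s in \<open>simp only: real_norm_def\<close>)
  ultimately show ?thesis by (metis has_sum_infsum)
qed

text \<open>The numbers \<open>j(2j + 1)\<close> for \<open>j \<in> \<int>\<close> are the triangular numbers, each once: even indices come from \<open>j \<ge> 0\<close>, odd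
  ones from \<open>j < 0\<close>.\<close>
theorem gauss_triangular_sums:
  assumes x: "0 < x" "x < 1"
  shows "(\<lambda>n::nat. (- x) ^ (n * (n + 1) div 2)) sums (euler_prod x * euler_prod (x ^ 4) / euler_prod (x\<^sup>2))"
proof -
  define j where "j = (\<lambda>n::nat. if even n then int n div 2 else - ((int n + 1) div 2))"
  define i where "i = (\<lambda>k::int. if k \<ge> 0 then nat (2 * k) else nat (- 2 * k - 1))"
  have "j (i k) = k" for k by (auto simp: i_def j_def even_nat_iff)
  moreover have "i (j n) = n" for n by (auto simp: i_def j_def elim!: evenE oddE)
  moreover have "nat (j n * (2 * j n + 1)) = n * (n + 1) div 2" for n
  proof (cases "even n")
    case True
    then obtain m where n: "n = 2 * m" by (elim evenE)
    have "j n = int m" by (simp add: j_def n)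
    then have "nat (j n * (2 * j n + 1)) = nat (int (m * (2 * m + 1)))"
      by (simp only: of_nat_mult of_nat_add of_nat_1 of_nat_numeral)
    also have "\<dots> = m * (2 * m + 1)" by (rule nat_int)
    also have "\<dots> = n * (n + 1) div 2" by (simp add: n)
    finally show ?thesis .
  next
    case False
    then obtain m where n: "n = 2 * m + 1" by (elim oddE)
    have "j n = - int (m + 1)" by (simp add: j_def n)
    then have "j n * (2 * j n + 1) = int ((m + 1) * (2 * m + 1))"
      by (simp add: \<open>j n = - int (m + 1)\<close>) (simp add: algebra_simps)
    then have "nat (j n * (2 * j n + 1)) = nat (int ((m + 1) * (2 * m + 1)))" by (simp only:)
    also have "\<dots> = (m + 1) * (2 * m + 1)" by (rule nat_int)
    also have "\<dots> = n * (n + 1) div 2"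
    proof -
      have "n * (n + 1) = 2 * ((m + 1) * (2 * m + 1))" by (simp add: n algebra_simps)
      then show ?thesis by simp
    qed
    finally show ?thesis .
  qed
  ultimately have "((\<lambda>n::nat. (- x) ^ (n * (n + 1) div 2)) has_sum euler_prod x * euler_prod (x ^ 4) / euler_prod (x\<^sup>2)) UNIV"
    using has_sum_gauss_triangular_int[OF x]
    by (subst has_sum_reindex_bij_witness[of UNIV i j UNIV "\<lambda>j::int. (- x) ^ nat (j * (2 * j + 1))" _ _
          "euler_prod x * euler_prod (x ^ 4) / euler_prod (x\<^sup>2)"]) auto
  then show ?thesis by (rule has_sum_imp_sums)
qed

section \<open>Moduli of theta constants on the line Re \<open>\<tau>\<close> = 1/2\<close>

lemma sin_odd_half_pi: "sin (of_nat (2 * n + 1) * of_real pi * (1 / 2)) = ((-1) ^ n :: complex)"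
proof (induction n)
  case (Suc n)
  have "of_nat (2 * Suc n + 1) * of_real pi * (1 / 2) = of_nat (2 * n + 1) * of_real pi * (1 / 2) + (of_real pi :: complex)"
    by (simp add: field_simps)
  then show ?case using Suc.IH by (simp only: sin_add cos_of_real sin_of_real cos_pi sin_pi) simp
qed simp

text \<open>Since \<open>(n + 1/2)\<^sup>2 = 1/4 + n(n + 1)\<close> and \<open>n(n + 1)\<close> is even, the factor \<open>q^(1/4)\<close> splits off and the rest is a series in
  \<open>Q = q\<^sup>2\<close>.\<close>
lemma theta2_0_eq_triangular_sum:
  assumes s: "(\<lambda>n. exp (2 * of_real pi * \<i> * \<tau>) ^ (n * (n + 1) div 2)) sums S"
  shows "theta2 0 \<tau> = 2 * exp (of_real pi * \<i> * \<tau> / 4) * S"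
proof -
  have t: "(-1) ^ n * exp (of_real pi * \<i> * \<tau> * (of_nat n + 1 / 2)\<^sup>2) * sin (of_nat (2 * n + 1) * of_real pi * (1 / 2))
        = exp (of_real pi * \<i> * \<tau> / 4) * exp (2 * of_real pi * \<i> * \<tau>) ^ (n * (n + 1) div 2)" for n
  proof -
    define T where "T = n * (n + 1) div 2"
    have "2 * T = n * (n + 1)" by (simp add: T_def)
    then have "2 * of_nat T = (of_nat n * (of_nat n + 1) :: complex)"
      by (metis of_nat_mult of_nat_add of_nat_1 of_nat_numeral)
    then have "of_real pi * \<i> * \<tau> * (of_nat n + 1 / 2)\<^sup>2 = of_real pi * \<i> * \<tau> * (1 / 4 + 2 * of_nat T)"
      by (simp add: power2_eq_square field_simps)
    also have "\<dots> = of_real pi * \<i> * \<tau> / 4 + of_nat T * (2 * of_real pi * \<i> * \<tau>)"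
      by (simp add: algebra_simps)
    finally have "exp (of_real pi * \<i> * \<tau> * (of_nat n + 1 / 2)\<^sup>2)
        = exp (of_real pi * \<i> * \<tau> / 4) * exp (2 * of_real pi * \<i> * \<tau>) ^ T"
      by (simp only: exp_add exp_of_nat_mult)
    moreover have "(-1) ^ n * (-1) ^ n = (1 :: complex)" by (simp flip: power_mult_distrib)
    ultimately show ?thesis unfolding sin_odd_half_pi T_def[symmetric] by simp
  qed
  have "theta2 0 \<tau> = 2 * (\<Sum>n. exp (of_real pi * \<i> * \<tau> / 4) * exp (2 * of_real pi * \<i> * \<tau>) ^ (n * (n + 1) div 2))"
    unfolding theta2_def theta1_def add_0_left t ..
  also have "(\<Sum>n. exp (of_real pi * \<i> * \<tau> / 4) * exp (2 * of_real pi * \<i> * \<tau>) ^ (n * (n + 1) div 2)) = exp (of_real pi * \<i> * \<tau> / 4) * S"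
    by (rule sums_unique[symmetric, OF sums_mult[OF s]])
  finally show ?thesis by simp
qed

text \<open>On this line \<open>exp (2\<pi>i\<tau>) = -exp (-2\<pi>b)\<close> is real and negative.\<close>
definition half_tau :: "real \<Rightarrow> complex" where
  "half_tau b = 1 / 2 + \<i> * of_real b"

lemma nome_half_tau: "exp (2 * of_real pi * \<i> * half_tau b) = - of_real (exp (- 2 * pi * b))"
proof -
  have "2 * of_real pi * \<i> * half_tau b = of_real (- 2 * pi * b) + of_real pi * \<i>"
    by (simp add: half_tau_def algebra_simps)
  then have "exp (2 * of_real pi * \<i> * half_tau b) = exp (of_real (- 2 * pi * b)) * exp (of_real pi * \<i>)"
    by (simp only: exp_add)
  then show ?thesis by (simp only: exp_pi_i exp_of_real[symmetric]) simp
qed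

lemma exp_neg_bounds: "b > 0 \<Longrightarrow> 0 < exp (- 2 * pi * b)" "b > 0 \<Longrightarrow> exp (- 2 * pi * b) < 1"
  by simp_all

theorem norm_theta2_half_tau:
  assumes b: "b > 0"
  defines "x \<equiv> exp (- 2 * pi * b)"
  shows "norm (theta2 0 (half_tau b)) = 2 * exp (- pi * b / 4) * (euler_prod x * euler_prod (x ^ 4) / euler_prod (x\<^sup>2))"
proof -
  define S where "S = euler_prod x * euler_prod (x ^ 4) / euler_prod (x\<^sup>2)"
  have x: "0 < x" "x < 1" using exp_neg_bounds[OF b] by (simp_all only: x_def)
  have S: "S > 0" by (simp add: S_def euler_prod_pos)
  have "(\<lambda>n::nat. complex_of_real ((- x) ^ (n * (n + 1) div 2))) sums of_real S"
    using gauss_triangular_sums[OF x] unfolding S_def by (rule sums_of_real)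
  then have "(\<lambda>n::nat. exp (2 * of_real pi * \<i> * half_tau b) ^ (n * (n + 1) div 2)) sums of_real S"
    unfolding nome_half_tau x_def[symmetric] by simp
  from theta2_0_eq_triangular_sum[OF this] have "norm (theta2 0 (half_tau b)) = 2 * norm (exp (of_real pi * \<i> * half_tau b / 4)) * S"
    using S by (simp only: norm_mult norm_of_real) simp
  also have "norm (exp (of_real pi * \<i> * half_tau b / 4)) = exp (- pi * b / 4)"
    by (simp add: norm_exp_eq_Re half_tau_def algebra_simps)
  finally show ?thesis by (simp only: S_def)
qed

definition theta_term :: "real \<Rightarrow> int \<Rightarrow> complex" where
  "theta_term b n = exp (of_real pi * \<i> * half_tau b * of_int (n\<^sup>2))"

lemma theta_term_eq: "theta_term b n = of_real (exp (- pi * b) ^ nat (n * n)) * cis (pi / 2 * of_int (n * n))"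
proof -
  have "of_real pi * \<i> * half_tau b * of_int (n\<^sup>2) = of_real (of_nat (nat (n * n)) * (- pi * b)) + \<i> * of_real (pi / 2 * of_int (n * n))"
    by (simp add: half_tau_def algebra_simps power2_eq_square)
  then have "theta_term b n = exp (of_real (of_nat (nat (n * n)) * (- pi * b))) * cis (pi / 2 * of_int (n * n))"
    unfolding theta_term_def cis_conv_exp by (simp only: exp_add)
  then show ?thesis by (simp only: exp_of_real exp_of_nat_mult)
qed

lemma exp_neg_pi_bounds: "b > 0 \<Longrightarrow> 0 < exp (- pi * b)" "b > 0 \<Longrightarrow> exp (- pi * b) < 1"
  by simp_all

lemma norm_theta_term: "norm (theta_term b n) = exp (- pi * b) ^ nat (n * n)"
  by (simp add: theta_term_eq norm_mult norm_power)

lemma has_sum_theta3_half_tau: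
  assumes b: "b > 0"
  shows "(theta_term b has_sum theta3 0 (half_tau b)) UNIV"
proof -
  have "(\<lambda>n. norm (theta_term b n)) summable_on UNIV"
    unfolding norm_theta_term by (rule has_sum_imp_summable[OF has_sum_theta_null[OF exp_neg_pi_bounds[OF b]]])
  from has_sum_infsum[OF abs_summable_summable[OF this]] show ?thesis
    by (simp add: theta3_series theta_term_def[abs_def])
qed

lemma Re_theta_term_mult_cnj:
  "Re (theta_term b m * cnj (theta_term b n)) =
     exp (- pi * b) ^ nat (m * m) * exp (- pi * b) ^ nat (n * n) * cos (pi / 2 * of_int ((m + n) * (m - n)))"
proof -
  have "theta_term b m * cnj (theta_term b n) =
     of_real (exp (- pi * b) ^ nat (m * m) * exp (- pi * b) ^ nat (n * n)) * (cis (pi / 2 * of_int (m * m)) * cis (- (pi / 2 * of_int (n * n))))"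
    by (simp add: theta_term_eq cis_cnj)
  also have "cis (pi / 2 * of_int (m * m)) * cis (- (pi / 2 * of_int (n * n))) = cis (pi / 2 * of_int ((m + n) * (m - n)))"
    unfolding cis_mult by (rule arg_cong[of _ _ cis]) (simp add: algebra_simps)
  finally show ?thesis by simp
qed

text \<open>If \<open>m\<close> and \<open>n\<close> have equal parity then 4 divides \<open>m\<^sup>2 - n\<^sup>2\<close>.\<close>
lemma cos_half_pi_diff_squares_even:
  assumes "even (m + n)"
  shows "cos (pi / 2 * of_int ((m + n) * (m - n))) = 1"
proof -
  obtain k where k: "m + n = 2 * k" using assms by (elim evenE)
  then have "m - n = 2 * (k - n)" by simp
  then have "(m + n) * (m - n) = 2 * k * (2 * (k - n))" using k by metis
  then have "pi / 2 * of_int ((m + n) * (m - n)) = of_int (2 * (k * (k - n))) * pi" by simp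
  also have "cos \<dots> = 1" using cos_int_2pin[of "k * (k - n)"] by (simp add: mult_ac)
  finally show ?thesis .
qed

lemma cos_half_pi_diff_squares_odd:
  assumes "odd (m + n)"
  shows "cos (pi / 2 * of_int ((m + n) * (m - n))) = 0"
proof -
  have "odd ((m + n) * (m - n))" using assms by simp
  then show ?thesis unfolding cos_zero_iff_int by (metis mult.commute)
qed

text \<open>Here \<open>q = ir\<close> with \<open>r = exp (-\<pi>b)\<close>, so that
  \<open>|\<vartheta>\<^sub>3|\<^sup>2 = \<Sum>m n. i^(m\<^sup>2 - n\<^sup>2) r^(m\<^sup>2 + n\<^sup>2)\<close>. Pairs of different parity contribute purely imaginary
  terms and disappear from the real part; pairs of equal parity have coefficient 1 and are
  \<open>(k + l, k - l)\<close>, with \<open>r^(m\<^sup>2 + n\<^sup>2) = x^(k\<^sup>2 + l\<^sup>2)\<close> for \<open>x = r\<^sup>2\<close>. What remains is the square of the theta constant at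
  the real nome \<open>x\<close>.\<close>
theorem norm_theta3_half_tau:
  assumes b: "b > 0"
  shows "norm (theta3 0 (half_tau b)) = theta_null (exp (- 2 * pi * b))"
proof -
  define S where "S = theta3 0 (half_tau b)"
  define r where "r = exp (- pi * b)"
  define x where "x = exp (- 2 * pi * b)"
  have r: "0 < r" "r < 1" using exp_neg_pi_bounds[OF b] by (simp_all only: r_def)
  have x: "0 < x" "x < 1" using exp_neg_bounds[OF b] by (simp_all only: x_def)
  have rx: "r\<^sup>2 = x" by (simp add: r_def x_def power2_eq_square flip: exp_add)
  let ?g = "\<lambda>(m, n). theta_term b m * cnj (theta_term b n)"
  have S: "(theta_term b has_sum S) UNIV" unfolding S_def by (rule has_sum_theta3_half_tau[OF b])
  have abs: "(\<lambda>p. norm (?g p)) summable_on (UNIV \<times> UNIV)"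
  proof (rule summable_on_SigmaI)
    show "((\<lambda>n. norm (?g (m, n))) has_sum r ^ nat (m * m) * theta_null r) UNIV" for m
      using has_sum_cmult_right[OF has_sum_theta_null[OF r], of "r ^ nat (m * m)"]
      by (simp add: norm_mult norm_theta_term r_def)
    show "(\<lambda>m::int. r ^ nat (m * m) * theta_null r) summable_on UNIV"
      by (rule has_sum_imp_summable[OF has_sum_cmult_left[OF has_sum_theta_null[OF r]]])
  qed auto
  have "(?g has_sum S * cnj S) (UNIV \<times> UNIV)"
  proof (rule has_sum_SigmaI[OF _ _ abs_summable_summable[OF abs]])
    show "((\<lambda>n. ?g (m, n)) has_sum theta_term b m * cnj S) UNIV" for m
      using has_sum_cmult_right[OF iffD2[OF has_sum_cnj_iff S], of "theta_term b m"] by simp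
    show "((\<lambda>m. theta_term b m * cnj S) has_sum S * cnj S) UNIV"
      by (rule has_sum_cmult_left[OF S])
  qed
  from has_sum_Re[OF this]
  have "((\<lambda>p. Re (?g p)) has_sum (norm S)\<^sup>2) (UNIV \<times> UNIV)"
    by (simp add: complex_mult_cnj cmod_power2)
  moreover define D where "D = {(m::int, n). even (m + n)}"
  have zero: "Re (?g p) = 0" if "p \<notin> D" for p
  proof -
    obtain m n where "p = (m, n)" by (cases p)
    then have "odd (m + n)" "?g p = theta_term b m * cnj (theta_term b n)"
      using that by (auto simp: D_def)
    with cos_half_pi_diff_squares_odd[OF this(1)] show ?thesis
      by (simp only: Re_theta_term_mult_cnj mult_zero_right)
  qed
  have "((\<lambda>p. Re (?g p)) has_sum (norm S)\<^sup>2) (UNIV \<times> UNIV) \<longleftrightarrow> ((\<lambda>p. Re (?g p)) has_sum (norm S)\<^sup>2) D"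
  proof (rule has_sum_cong_neutral)
    show "Re (?g p) = 0" if "p \<in> D - UNIV \<times> UNIV" for p using that by simp
    show "Re (?g p) = 0" if "p \<in> UNIV \<times> UNIV - D" for p using that by (intro zero) simp
  qed (rule refl)
  ultimately have "((\<lambda>p. Re (?g p)) has_sum (norm S)\<^sup>2) D" by blast
  moreover have "((\<lambda>p. Re (?g p)) has_sum (norm S)\<^sup>2) D \<longleftrightarrow>
      ((\<lambda>(m, n). x ^ nat (m * m) * x ^ nat (n * n)) has_sum (norm S)\<^sup>2) (UNIV \<times> UNIV)"
  proof (rule has_sum_reindex_bij_witness[where i = "\<lambda>(m, n). (m + n, m - n)" and j = "\<lambda>(m, n). ((m + n) div 2, (m - n) div 2)"], goal_cases)
    case (1 p)
    then obtain m n where p: "p = (m, n)" "even (m + n)" by (auto simp: D_def)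
    then obtain k where k: "m + n = 2 * k" by (elim evenE)
    then have m: "m = 2 * k - n" by simp
    have "m - n = 2 * (k - n)" by (simp add: m)
    then show ?case by (simp add: p(1) k) (simp add: m)
  next
    case (5 p)
    then obtain m n where p: "p = (m, n)" "even (m + n)" by (auto simp: D_def)
    then obtain k where k: "m + n = 2 * k" by (elim evenE)
    define l where "l = k - n"
    have mn: "m = k + l" "n = k - l" using k by (simp_all add: l_def)
    have e: "nat (m * m) + nat (n * n) = 2 * (nat (k * k) + nat (l * l))"
    proof -
      have "m * m + n * n = 2 * (k * k + l * l)" by (simp add: mn algebra_simps)
      then have "int (nat (m * m) + nat (n * n)) = int (2 * (nat (k * k) + nat (l * l)))"
        by simp
      then show ?thesis by (simp only: of_nat_eq_iff)
    qed
    have "Re (?g p) = r ^ (nat (m * m) + nat (n * n))"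
      unfolding p(1) case_prod_conv Re_theta_term_mult_cnj cos_half_pi_diff_squares_even[OF p(2)]
      by (simp only: r_def power_add mult_1_right)
    also have "\<dots> = x ^ nat (k * k) * x ^ nat (l * l)"
      unfolding e power_mult rx by (simp add: power_add)
    finally show ?case by (simp add: p mn)
  qed (auto simp: D_def algebra_simps)
  ultimately have "((\<lambda>(m, n). x ^ nat (m * m) * x ^ nat (n * n)) has_sum (norm S)\<^sup>2) (UNIV \<times> UNIV)"
    by simp
  then have "((\<lambda>m::int. x ^ nat (m * m) * theta_null x) has_sum (norm S)\<^sup>2) UNIV"
    by (rule has_sum_SigmaD) (use has_sum_cmult_right[OF has_sum_theta_null[OF x]] in simp)
  then have "(norm S)\<^sup>2 = theta_null x * theta_null x"
    using has_sum_cmult_left[OF has_sum_theta_null[OF x]] by (rule has_sum_unique)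
  then have "(norm S)\<^sup>2 = (theta_null x)\<^sup>2" by (simp add: power2_eq_square)
  moreover have "theta_null x \<ge> 0"
    using has_sum_theta_null[OF x] by (rule has_sum_nonneg) (use x in auto)
  ultimately have "norm S = theta_null x" by (simp add: power2_eq_iff_nonneg)
  then show ?thesis by (simp only: S_def x_def)
qed

text \<open>Conjugating \<open>i^(n\<^sup>2)\<close> multiplies it by \<open>(-1)^n\<close>.\<close>
theorem theta4_half_tau:
  assumes b: "b > 0"
  shows "theta4 0 (half_tau b) = cnj (theta3 0 (half_tau b))"
proof -
  have t: "(-1) powi n * exp (of_real pi * \<i> * half_tau b * of_int (n\<^sup>2)) = cnj (theta_term b n)" for n
  proof -
    have "cis (pi / 2 * of_int (n * n)) * (-1) powi n = cis (- (pi / 2 * of_int (n * n)))"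
    proof -
      have "cis (- (pi / 2 * of_int (n * n))) = cis (pi / 2 * of_int (n * n)) * cis (- (of_int (n * n) * pi))"
        unfolding cis_mult by (rule arg_cong[of _ _ cis]) (simp add: field_simps)
      also have "cis (- (of_int (n * n) * pi)) = (-1) powi n"
      proof (cases "even n")
        case True
        then obtain k where "n = 2 * k" by (elim evenE)
        then have "- (of_int (n * n) * pi) = 2 * pi * of_int (- 2 * k * k)" by simp
        then have "cis (- (of_int (n * n) * pi)) = 1" by (simp only: cis_multiple_2pi Ints_of_int)
        with True show ?thesis by simp
      next
        case False
        then obtain k where "n = 2 * k + 1" by (elim oddE)
        then have "- (of_int (n * n) * pi) = 2 * pi * of_int (- 2 * k * k - 2 * k - 1) + pi" by (simp add: algebra_simps)
        then have "cis (- (of_int (n * n) * pi)) = cis (2 * pi * of_int (- 2 * k * k - 2 * k - 1)) * cis pi"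
          by (simp only: cis_mult)
        also have "\<dots> = -1" using cis_multiple_2pi[of "of_int (- 2 * k * k - 2 * k - 1)"] by simp
        finally show ?thesis using False by simp
      qed
      finally show ?thesis by simp
    qed
    then show ?thesis
      unfolding theta_term_def[symmetric] theta_term_eq by (simp add: cis_cnj mult_ac)
  qed
  have "theta4 0 (half_tau b) = (\<Sum>\<^sub>\<infinity>n. cnj (theta_term b n))"
    unfolding theta4_def t[symmetric] by simp
  also have "\<dots> = cnj (\<Sum>\<^sub>\<infinity>n. theta_term b n)" by (rule infsum_cnj)
  also have "(\<Sum>\<^sub>\<infinity>n. theta_term b n) = theta3 0 (half_tau b)"
    using has_sum_theta3_half_tau[OF b] by (rule infsumI)
  finally show ?thesis .
qed

section \<open>Exponential sums\<close>

text \<open>General Dirichlet series over an arbitrary index set. With nonnegative coefficients and frequencies, as in \<open>exp_summable\<close>, the class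
  is closed under termwise differentiation up to sign, and signs of derivatives can be read off the coefficients.\<close>
definition exp_sum :: "'i set \<Rightarrow> ('i \<Rightarrow> real) \<Rightarrow> ('i \<Rightarrow> real) \<Rightarrow> real \<Rightarrow> real" where
  "exp_sum I a l b = (\<Sum>\<^sub>\<infinity>i\<in>I. a i * exp (- (l i * b)))"

definition exp_summable :: "'i set \<Rightarrow> ('i \<Rightarrow> real) \<Rightarrow> ('i \<Rightarrow> real) \<Rightarrow> bool" where
  "exp_summable I a l \<longleftrightarrow> (\<forall>i\<in>I. 0 \<le> a i \<and> 0 \<le> l i) \<and> (\<forall>b>0. (\<lambda>i. a i * exp (- (l i * b))) summable_on I)"

lemma has_sum_exp_sum:
  assumes "exp_summable I a l" "b > 0"
  shows "((\<lambda>i. a i * exp (- (l i * b))) has_sum exp_sum I a l b) I"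
  using assms unfolding exp_summable_def exp_sum_def by simp

text \<open>A factor \<open>l\<close> costs half of the exponential decay: \<open>t exp (-t) \<le> 1\<close> with \<open>t = l b / 2\<close>.\<close>
lemma exp_summable_mult:
  assumes a: "exp_summable I a l"
  shows "exp_summable I (\<lambda>i. l i * a i) l"
  unfolding exp_summable_def
proof (intro conjI ballI allI impI)
  fix b :: real assume b: "b > 0"
  show "(\<lambda>i. l i * a i * exp (- (l i * b))) summable_on I"
  proof (rule summable_on_comparison_test)
    have "(\<lambda>i. a i * exp (- (l i * (b / 2)))) summable_on I"
      using a half_gt_zero[OF b] unfolding exp_summable_def by blast
    then show "(\<lambda>i. 2 / b * (a i * exp (- (l i * (b / 2))))) summable_on I"
      by (rule summable_on_cmult_right)
    fix i assume i: "i \<in> I"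
    then have nn: "0 \<le> a i" "0 \<le> l i" using a by (auto simp: exp_summable_def)
    show "0 \<le> l i * a i * exp (- (l i * b))" using nn by simp
    define t where "t = l i * (b / 2)"
    have "t \<le> exp t" using exp_ge_add_one_self[of t] by linarith
    then have "t * exp (- t) \<le> 1"
      by (simp add: exp_minus field_simps)
    then have "t * exp (- t) * exp (- t) \<le> exp (- t)"
      using mult_right_mono[of "t * exp (- t)" 1 "exp (- t)"] by simp
    then have "2 / b * (t * exp (- t) * exp (- t)) \<le> 2 / b * exp (- t)"
      using b by (intro mult_left_mono) auto
    moreover have "exp (- (l i * b)) = exp (- t) * exp (- t)"
      by (simp add: t_def flip: exp_add)
    moreover have "l i = 2 / b * t" using b by (simp add: t_def)
    ultimately have "l i * exp (- (l i * b)) \<le> 2 / b * exp (- t)"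
      by (simp only: mult.assoc)
    from mult_left_mono[OF this nn(1)]
    show "l i * a i * exp (- (l i * b)) \<le> 2 / b * (a i * exp (- (l i * (b / 2))))"
      by (simp add: t_def mult_ac)
  qed
qed (use a in \<open>auto simp: exp_summable_def\<close>)

text \<open>Both bounds follow from \<open>1 + t \<le> exp t\<close> alone, and the constant depends on \<open>l\<close> only through a term that stays
  summable; this is what makes the remainder of the whole series quadratic in \<open>h\<close>.\<close>
lemma exp_second_order_remainder:
  fixes l b h :: real
  assumes l: "0 \<le> l" and h: "\<bar>h\<bar> \<le> b / 2"
  defines "R \<equiv> exp (- (l * (b + h))) - exp (- (l * b)) + l * h * exp (- (l * b))"
  shows "0 \<le> R" "R \<le> h\<^sup>2 * (l * (l * exp (- (l * (b / 2)))))"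
proof -
  define u v where "u = exp (- (l * (b + h)))" and "v = exp (- (l * b))"
  have uv: "u \<ge> v * (1 - l * h)" "v \<ge> u * (1 + l * h)"
  proof -
    have "u = v * exp (- (l * h))" by (simp add: u_def v_def algebra_simps flip: exp_add)
    moreover have "1 - l * h \<le> exp (- (l * h))" using exp_ge_add_one_self[of "- (l * h)"] by simp
    ultimately show "u \<ge> v * (1 - l * h)" by (simp add: v_def)
    have "v = u * exp (l * h)" by (simp add: u_def v_def algebra_simps flip: exp_add)
    moreover have "1 + l * h \<le> exp (l * h)" using exp_ge_add_one_self[of "l * h"] by simp
    ultimately show "v \<ge> u * (1 + l * h)" by (simp add: u_def)
  qed
  have R: "R = u - v + l * h * v" by (simp add: R_def u_def v_def)
  show "0 \<le> R" using uv(1) by (simp add: R algebra_simps)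
  define m where "m = exp (- (l * (b / 2)))"
  have "b / 2 \<le> b + h" "b / 2 \<le> b" using h by linarith+
  from this[THEN mult_left_mono, OF l] have "l * (b / 2) \<le> l * (b + h)" "l * (b / 2) \<le> l * b" .
  then have m: "u \<le> m" "v \<le> m" by (simp_all add: u_def v_def m_def)
  have "R \<le> l * h * (v - u)" using uv(2) by (simp add: R algebra_simps)
  also have "\<dots> \<le> (l * h) * (l * h) * m"
  proof (cases "h \<ge> 0")
    case True
    have "v - u \<le> l * h * v" using uv(1) by (simp add: algebra_simps)
    also have "\<dots> \<le> l * h * m" using True l m by (intro mult_left_mono) auto
    finally have "l * h * (v - u) \<le> l * h * (l * h * m)" using True l by (intro mult_left_mono) auto
    then show ?thesis by (simp add: mult_ac)
  next
    case False
    have "u - v \<le> (- (l * h)) * u" using uv(2) by (simp add: algebra_simps)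
    also have "\<dots> \<le> (- (l * h)) * m" using False l m by (intro mult_left_mono) (auto simp: mult_nonneg_nonpos)
    finally have "(- (l * h)) * (u - v) \<le> (- (l * h)) * ((- (l * h)) * m)"
      using False l by (intro mult_left_mono) (auto simp: mult_nonneg_nonpos)
    then show ?thesis by (simp add: algebra_simps)
  qed
  finally show "R \<le> h\<^sup>2 * (l * (l * exp (- (l * (b / 2)))))"
    by (simp add: m_def power2_eq_square mult_ac)
qed

theorem has_real_derivative_exp_sum:
  assumes a: "exp_summable I a l" and b: "b > 0"
  shows "(exp_sum I a l has_real_derivative - exp_sum I (\<lambda>i. l i * a i) l b) (at b)"
proof -
  let ?F = "exp_sum I a l" and ?D = "exp_sum I (\<lambda>i. l i * a i) l b"
  define K where "K = exp_sum I (\<lambda>i. l i * (l i * a i)) l (b / 2)"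
  have rem: "\<bar>?F (b + h) - ?F b + h * ?D\<bar> \<le> h\<^sup>2 * K" if h: "\<bar>h\<bar> \<le> b / 2" for h
  proof -
    have bh: "b + h > 0" using h b by (simp add: abs_le_iff)
    define R where "R = (\<lambda>i. exp (- (l i * (b + h))) - exp (- (l i * b)) + l i * h * exp (- (l i * b)))"
    have "((\<lambda>i. a i * exp (- (l i * (b + h))) + - (a i * exp (- (l i * b))) + h * (l i * a i * exp (- (l i * b))))
            has_sum ?F (b + h) + - ?F b + h * ?D) I"
      by (intro has_sum_add has_sum_uminusI has_sum_cmult_right has_sum_exp_sum exp_summable_mult a b bh)
    then have sR: "((\<lambda>i. a i * R i) has_sum ?F (b + h) - ?F b + h * ?D) I"
      by (simp add: R_def algebra_simps)
    have sK: "((\<lambda>i. h\<^sup>2 * (l i * (l i * a i) * exp (- (l i * (b / 2))))) has_sum h\<^sup>2 * K) I"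
      unfolding K_def using b by (intro has_sum_cmult_right has_sum_exp_sum exp_summable_mult a) auto
    have R: "0 \<le> a i * R i" "a i * R i \<le> h\<^sup>2 * (l i * (l i * a i) * exp (- (l i * (b / 2))))" if "i \<in> I" for i
    proof -
      have nn: "0 \<le> a i" "0 \<le> l i" using a that by (auto simp: exp_summable_def)
      note rem = exp_second_order_remainder[OF nn(2) h, folded R_def]
      show "0 \<le> a i * R i" using nn rem(1) by (simp add: R_def)
      have "a i * R i \<le> a i * (h\<^sup>2 * (l i * (l i * exp (- (l i * (b / 2))))))"
        using mult_left_mono[OF rem(2) nn(1)] by (simp add: R_def)
      then show "a i * R i \<le> h\<^sup>2 * (l i * (l i * a i) * exp (- (l i * (b / 2))))"
        by (simp add: mult_ac)
    qed
    have "0 \<le> ?F (b + h) - ?F b + h * ?D" using sR R(1) by (rule has_sum_nonneg)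
    moreover have "?F (b + h) - ?F b + h * ?D \<le> h\<^sup>2 * K" using sR sK R(2) by (rule has_sum_mono)
    ultimately show ?thesis by simp
  qed
  have "((\<lambda>h. (?F (b + h) - ?F b) / h - (- ?D)) \<longlongrightarrow> 0) (at 0)"
  proof (rule Lim_null_comparison)
    have "eventually (\<lambda>h. h \<in> ball 0 (b / 2) - {0}) (at (0::real))"
      using b by (intro eventually_at_in_open) auto
    then show "\<forall>\<^sub>F h in at 0. norm ((?F (b + h) - ?F b) / h - (- ?D)) \<le> \<bar>h\<bar> * K"
    proof eventually_elim
      case (elim h)
      then have h: "h \<noteq> 0" "\<bar>h\<bar> \<le> b / 2" by auto
      have "(?F (b + h) - ?F b) / h - (- ?D) = (?F (b + h) - ?F b + h * ?D) / h"
        using h(1) by (simp add: field_simps)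
      then have "norm ((?F (b + h) - ?F b) / h - (- ?D)) = \<bar>?F (b + h) - ?F b + h * ?D\<bar> / \<bar>h\<bar>"
        by (simp only: real_norm_def abs_divide)
      also have "\<dots> \<le> h\<^sup>2 * K / \<bar>h\<bar>"
        using rem[OF h(2)] by (rule divide_right_mono) simp
      also have "h\<^sup>2 = \<bar>h\<bar> * \<bar>h\<bar>" by (simp add: power2_eq_square)
      also have "\<bar>h\<bar> * \<bar>h\<bar> * K / \<bar>h\<bar> = \<bar>h\<bar> * K"
        using h(1) by (simp only: mult.assoc nonzero_mult_div_cancel_left abs_eq_0 simp_thms)
      finally show ?case .
    qed
    have "((\<lambda>h. \<bar>h\<bar> * K) \<longlongrightarrow> \<bar>0\<bar> * K) (at (0::real))"
      by (intro tendsto_intros)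
    then show "((\<lambda>h. \<bar>h\<bar> * K) \<longlongrightarrow> 0) (at (0::real))" by simp
  qed
  from LIM_zero_cancel[OF this] show ?thesis
    unfolding DERIV_def .
qed

lemma exp_sum_ge_term:
  assumes a: "exp_summable I a l" and "b > 0" "i \<in> I"
  shows "a i * exp (- (l i * b)) \<le> exp_sum I a l b"
  using finite_sum_le_has_sum[OF has_sum_exp_sum[OF a \<open>b > 0\<close>], of "{i}"] assms
  by (auto simp: exp_summable_def)

lemma exp_sum_pos:
  assumes "exp_summable I a l" "b > 0" "i \<in> I" "a i > 0"
  shows "exp_sum I a l b > 0"
  by (rule less_le_trans[OF _ exp_sum_ge_term[OF assms(1-3)]]) (use assms(4) in simp)

text \<open>Strict Cauchy-Schwarz: with \<open>\<mu> = S1 / S0\<close> the difference \<open>S2 - S1\<^sup>2 / S0\<close> is the sum of the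
  \<open>(l - \<mu>)\<^sup>2\<close> with weights \<open>a exp (-l b)\<close>, and the frequency 0 already contributes a positive term, because
  \<open>\<mu> > 0\<close>.\<close>
lemma exp_sum_log_convex:
  assumes a: "exp_summable I a l" and b: "b > 0"
    and i: "i \<in> I" "a i > 0" "l i = 0" and k: "k \<in> I" "a k > 0" "l k > 0"
  defines "S0 \<equiv> exp_sum I a l b" and "S1 \<equiv> exp_sum I (\<lambda>i. l i * a i) l b"
    and "S2 \<equiv> exp_sum I (\<lambda>i. l i * (l i * a i)) l b"
  shows "S1\<^sup>2 < S2 * S0"
proof -
  have S0: "S0 > 0" unfolding S0_def by (rule exp_sum_pos[OF a b i(1,2)])
  have S1: "S1 > 0" unfolding S1_def
    using k by (intro exp_sum_pos[OF exp_summable_mult[OF a] b k(1)]) auto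
  define \<mu> where "\<mu> = S1 / S0"
  have "((\<lambda>j. l j * (l j * a j) * exp (- (l j * b)) + (- (2 * \<mu>)) * (l j * a j * exp (- (l j * b))) + \<mu>\<^sup>2 * (a j * exp (- (l j * b))))
         has_sum S2 + (- (2 * \<mu>)) * S1 + \<mu>\<^sup>2 * S0) I"
    unfolding S0_def S1_def S2_def
    by (intro has_sum_add has_sum_cmult_right has_sum_exp_sum exp_summable_mult a b)
  then have s: "((\<lambda>j. (l j - \<mu>)\<^sup>2 * (a j * exp (- (l j * b)))) has_sum S2 + (- (2 * \<mu>)) * S1 + \<mu>\<^sup>2 * S0) I"
    by (simp add: power2_eq_square algebra_simps)
  have "(\<Sum>j\<in>{i}. (l j - \<mu>)\<^sup>2 * (a j * exp (- (l j * b)))) \<le> S2 + (- (2 * \<mu>)) * S1 + \<mu>\<^sup>2 * S0"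
    using a by (intro finite_sum_le_has_sum[OF s]) (auto simp: exp_summable_def i)
  moreover have "0 < (\<Sum>j\<in>{i}. (l j - \<mu>)\<^sup>2 * (a j * exp (- (l j * b))))"
    using i S0 S1 by (simp add: \<mu>_def)
  moreover have "S2 + (- (2 * \<mu>)) * S1 + \<mu>\<^sup>2 * S0 = (S2 * S0 - S1\<^sup>2) / S0"
    using S0 by (simp add: \<mu>_def field_simps power2_eq_square)
  ultimately have "0 < (S2 * S0 - S1\<^sup>2) / S0" by linarith
  then show ?thesis using S0 by (simp add: zero_less_divide_iff)
qed

lemma exp_power_nat: "exp (- 2 * pi * b) ^ k = exp (- (2 * pi * real k * b))"
  by (simp add: mult_ac flip: exp_of_nat_mult)

text \<open>With \<open>x = exp (-2\<pi>b)\<close>, both \<open>-log (\<Prod>n. 1 - x^n)\<close> and the Lambert series become exponential sums over pairs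
  \<open>(m, n)\<close> with the same frequencies; only the coefficients \<open>1 / n\<close> and \<open>m\<close> differ.\<close>
abbreviation pos_pairs :: "(nat \<times> nat) set" where
  "pos_pairs \<equiv> {1..} \<times> {1..}"

definition pair_freq :: "nat \<times> nat \<Rightarrow> real" where
  "pair_freq = (\<lambda>(m, n). 2 * pi * real (m * n))"

lemma euler_log_exp_sum:
  shows "exp_summable pos_pairs (\<lambda>(m, n). 1 / real n) pair_freq"
    and "euler_log (exp (- 2 * pi * b)) = exp_sum pos_pairs (\<lambda>(m, n). 1 / real n) pair_freq b"
proof -
  have t: "(case p of (m, n) \<Rightarrow> exp (- 2 * pi * b) ^ (m * n) / real n) =
           (case p of (m, n) \<Rightarrow> 1 / real n) * exp (- (pair_freq p * b))" for b and p :: "nat \<times> nat"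
    unfolding pair_freq_def exp_power_nat by (cases p) simp
  show "euler_log (exp (- 2 * pi * b)) = exp_sum pos_pairs (\<lambda>(m, n). 1 / real n) pair_freq b"
    unfolding euler_log_def exp_sum_def t ..
  have "(\<lambda>p. (case p of (m, n) \<Rightarrow> 1 / real n) * exp (- (pair_freq p * b))) summable_on pos_pairs" if "b > 0" for b
    using has_sum_imp_summable[OF has_sum_euler_log(1)[OF exp_neg_bounds[OF that]]] unfolding t .
  then show "exp_summable pos_pairs (\<lambda>(m, n). 1 / real n) pair_freq"
    by (auto simp: exp_summable_def pair_freq_def)
qed

lemma has_sum_koebe:
  fixes u :: real
  assumes "0 \<le> u" "u < 1"
  shows "((\<lambda>m. real m * u ^ m) has_sum koebe u) {1..}"
proof -
  have "(\<lambda>m. of_nat (Suc m) * u ^ m) sums (1 / (1 - u)\<^sup>2)"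
    using assms by (intro geometric_deriv_sums) auto
  from sums_mult[OF this, of u] have "(\<lambda>m. real (Suc m) * u ^ Suc m) sums koebe u"
    by (simp add: koebe_def mult_ac)
  then have "((\<lambda>m. real (Suc m) * u ^ Suc m) has_sum koebe u) UNIV"
    by (rule sums_nonneg_imp_has_sum) (use assms in auto)
  then show ?thesis
    by (subst has_sum_reindex_bij_witness[of "{1..}" Suc "\<lambda>n. n - 1" UNIV "\<lambda>m. real (Suc m) * u ^ Suc m" _ "koebe u" "koebe u"]) auto
qed

lemma has_sum_lambert_pairs:
  assumes x: "0 < x" "x < 1"
  shows "((\<lambda>(m, n). real m * x ^ (m * n)) has_sum lambert_sigma x) pos_pairs"
proof -
  have rows: "((\<lambda>m. case (n, m) of (n, m) \<Rightarrow> real m * x ^ (m * n)) has_sum koebe (x ^ n)) {1..}" if "n \<in> {1..}" for n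
  proof -
    have "0 \<le> x ^ n" "x ^ n < 1" using x that by (auto simp: power_less_one_iff)
    from has_sum_koebe[OF this] show ?thesis by (simp add: mult.commute flip: power_mult)
  qed
  have l: "((\<lambda>n. koebe (x ^ n)) has_sum lambert_sigma x) {1..}"
    using x by (intro has_sum_lambert_sigma) auto
  have "(\<lambda>(n, m). real m * x ^ (m * n)) summable_on pos_pairs"
    by (rule summable_on_SigmaI[OF rows has_sum_imp_summable[OF l]]) (use x in auto)
  from has_sum_SigmaI[OF rows l this]
  have "((\<lambda>(n, m). real m * x ^ (m * n)) has_sum lambert_sigma x) pos_pairs" .
  then show ?thesis by (subst has_sum_swap) (simp add: case_prod_unfold)
qed

lemma lambert_exp_sum:
  shows "exp_summable pos_pairs (\<lambda>(m, n). real m) pair_freq"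
    and "b > 0 \<Longrightarrow> lambert_sigma (exp (- 2 * pi * b)) = exp_sum pos_pairs (\<lambda>(m, n). real m) pair_freq b"
proof -
  have t: "(case p of (m, n) \<Rightarrow> real m * exp (- 2 * pi * b) ^ (m * n)) =
           (case p of (m, n) \<Rightarrow> real m) * exp (- (pair_freq p * b))" for b and p :: "nat \<times> nat"
    unfolding pair_freq_def exp_power_nat by (cases p) simp
  have s: "((\<lambda>p. (case p of (m, n) \<Rightarrow> real m) * exp (- (pair_freq p * b))) has_sum lambert_sigma (exp (- 2 * pi * b))) pos_pairs"
    if "b > 0" for b
    using has_sum_lambert_pairs[OF exp_neg_bounds[OF that]] unfolding t .
  show "lambert_sigma (exp (- 2 * pi * b)) = exp_sum pos_pairs (\<lambda>(m, n). real m) pair_freq b" if "b > 0"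
    unfolding exp_sum_def by (rule infsumI[symmetric, OF s[OF that]])
  show "exp_summable pos_pairs (\<lambda>(m, n). real m) pair_freq"
    using has_sum_imp_summable[OF s] by (auto simp: exp_summable_def pair_freq_def)
qed

text \<open>Differentiation multiplies \<open>1 / n\<close> by \<open>-2\<pi>mn\<close>, which leaves the coefficients \<open>-2\<pi>m\<close> of the Lambert series. This is the
  link between the theta and the lattice side.\<close>
theorem has_real_derivative_euler_log:
  assumes b: "b > 0"
  shows "((\<lambda>b. euler_log (exp (- 2 * pi * b))) has_real_derivative - 2 * pi * lambert_sigma (exp (- 2 * pi * b))) (at b)"
proof -
  have "((\<lambda>b. exp_sum pos_pairs (\<lambda>(m, n). 1 / real n) pair_freq b) has_real_derivative
          - exp_sum pos_pairs (\<lambda>p. pair_freq p * (case p of (m, n) \<Rightarrow> 1 / real n)) pair_freq b) (at b)"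
    by (rule has_real_derivative_exp_sum[OF euler_log_exp_sum(1) b])
  moreover have "exp_sum pos_pairs (\<lambda>p. pair_freq p * (case p of (m, n) \<Rightarrow> 1 / real n)) pair_freq b
       = 2 * pi * exp_sum pos_pairs (\<lambda>(m, n). real m) pair_freq b"
    unfolding exp_sum_def infsum_cmult_right'[symmetric]
    by (rule infsum_cong) (auto simp: pair_freq_def)
  ultimately show ?thesis
    unfolding euler_log_exp_sum(2) lambert_exp_sum(2)[OF b] by simp
qed

lemma theta_null_exp_sum:
  shows "exp_summable UNIV (\<lambda>j::int. 1) (\<lambda>j. 2 * pi * of_int (j * j))"
    and "theta_null (exp (- 2 * pi * b)) = exp_sum UNIV (\<lambda>j::int. 1) (\<lambda>j. 2 * pi * of_int (j * j)) b"
proof -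
  have t: "exp (- 2 * pi * b) ^ nat (j * j) = 1 * exp (- (2 * pi * of_int (j * j) * b))" for b and j :: int
    unfolding exp_power_nat by simp
  show "theta_null (exp (- 2 * pi * b)) = exp_sum UNIV (\<lambda>j::int. 1) (\<lambda>j. 2 * pi * of_int (j * j)) b"
    unfolding theta_null_def exp_sum_def t ..
  have "(\<lambda>j::int. 1 * exp (- (2 * pi * of_int (j * j) * b))) summable_on UNIV" if "b > 0" for b
    using has_sum_imp_summable[OF has_sum_theta_null[OF exp_neg_bounds[OF that]]] unfolding t .
  then show "exp_summable UNIV (\<lambda>j::int. 1) (\<lambda>j. 2 * pi * of_int (j * j))"
    by (simp add: exp_summable_def)
qed

lemma has_sum_lambert_pairs_dvd:
  assumes x: "0 < x" "x < 1" and d: "d > 0"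
  shows "((\<lambda>(m, n). real m * x ^ (m * n)) has_sum real d * lambert_sigma (x ^ d)) ({m \<in> {1..}. d dvd m} \<times> {1..})"
proof -
  have "0 < x ^ d" "x ^ d < 1" using x d by (auto simp: power_less_one_iff)
  from has_sum_cmult_right[OF has_sum_lambert_pairs[OF this], of "real d"]
  show ?thesis
    by (rule iffD1[OF has_sum_reindex_bij_witness[where i = "\<lambda>(m, n). (m div d, n)" and j = "\<lambda>(m, n). (d * m, n)"], rotated -1])
       (use d in \<open>auto elim!: dvdE simp: mult_ac simp flip: power_mult\<close>)
qed

text \<open>The pairs with \<open>d\<close> dividing \<open>m\<close> sum to \<open>d \<Lambda>(x^d)\<close>, where \<open>\<Lambda>\<close> is the Lambert series. Removing the even \<open>m\<close> and restoring the
  multiples of 4 shows that this combination, despite its minus sign, is an exponential sum with positive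
  coefficients.\<close>
lemma lambert_combination_exp_sum:
  assumes b: "b > 0"
  defines "x \<equiv> exp (- 2 * pi * b)"
  shows "lambert_sigma x - 2 * lambert_sigma (x\<^sup>2) + 4 * lambert_sigma (x ^ 4) =
           exp_sum ({m \<in> {1..}. odd m \<or> 4 dvd m} \<times> {1..}) (\<lambda>(m, n). real m) pair_freq b"
proof -
  have x: "0 < x" "x < 1" using exp_neg_bounds[OF b] by (simp_all only: x_def)
  let ?f = "\<lambda>(m, n). real m * x ^ (m * n)"
  have two: "(?f has_sum real 2 * lambert_sigma (x\<^sup>2)) ({m \<in> {1..}. even m} \<times> {1..})"
    and four: "(?f has_sum real 4 * lambert_sigma (x ^ 4)) ({m \<in> {1..}. 4 dvd m} \<times> {1..})"
    by (rule has_sum_lambert_pairs_dvd[OF x]; simp)+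
  have "(?f has_sum lambert_sigma x - real 2 * lambert_sigma (x\<^sup>2)) (pos_pairs - {m \<in> {1..}. even m} \<times> {1..})"
    by (rule has_sum_Diff[OF has_sum_lambert_pairs[OF x] two]) auto
  moreover have "even m" if "4 dvd m" for m :: nat using that by presburger
  then have "(pos_pairs - {m \<in> {1..}. even m} \<times> {1..}) \<inter> {m \<in> {1..}. 4 dvd m} \<times> {1..} = {}"
    by auto
  ultimately have "(?f has_sum lambert_sigma x - real 2 * lambert_sigma (x\<^sup>2) + real 4 * lambert_sigma (x ^ 4))
          ((pos_pairs - {m \<in> {1..}. even m} \<times> {1..}) \<union> {m \<in> {1..}. 4 dvd m} \<times> {1..})"
    by (intro has_sum_Un_disjoint four)
  moreover have "(pos_pairs - {m \<in> {1..}. even m} \<times> {1..}) \<union> {m \<in> {1..}. 4 dvd m} \<times> {1..} =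
       {m \<in> {1::nat..}. odd m \<or> 4 dvd m} \<times> {1::nat..}" by auto
  ultimately have hs: "(?f has_sum lambert_sigma x - 2 * lambert_sigma (x\<^sup>2) + 4 * lambert_sigma (x ^ 4))
          ({m \<in> {1..}. odd m \<or> 4 dvd m} \<times> {1..})" by simp
  have "?f p = (case p of (m, n) \<Rightarrow> real m) * exp (- (pair_freq p * b))" for p
    unfolding pair_freq_def x_def exp_power_nat by (cases p) simp
  from iffD1[OF has_sum_cong[OF this] hs]
  have "((\<lambda>p. (case p of (m, n) \<Rightarrow> real m) * exp (- (pair_freq p * b))) has_sum
      lambert_sigma x - 2 * lambert_sigma (x\<^sup>2) + 4 * lambert_sigma (x ^ 4)) ({m \<in> {1..}. odd m \<or> 4 dvd m} \<times> {1..})" .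
  from infsumI[OF this] show ?thesis unfolding exp_sum_def by (rule sym)
qed

lemma exp_summable_subset:
  assumes "exp_summable I a l" "J \<subseteq> I"
  shows "exp_summable J a l"
  using assms by (auto simp: exp_summable_def intro: summable_on_subset_banach)

section \<open>The derivatives along the line\<close>

lemma second_derivative_on_positive_reals:
  assumes L: "\<And>b. b > 0 \<Longrightarrow> (L has_real_derivative D b) (at b)"
    and D: "\<And>b. b > 0 \<Longrightarrow> (D has_real_derivative D' b) (at b)"
    and b: "b > 0"
  shows "L differentiable (at b)" "deriv L b = D b"
    "deriv L differentiable (at b)" "deriv (deriv L) b = D' b"
proof -
  show "L differentiable (at b)"
    using L[OF b] unfolding real_differentiable_def by blast
  have dL: "deriv L c = D c" if "c > 0" for c
    using L[OF that] by (rule DERIV_imp_deriv)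
  then show "deriv L b = D b" using b .
  have "(deriv L has_real_derivative D' b) (at b)"
    by (rule has_field_derivative_transform_within_open[OF D[OF b], of "{0<..}"]) (use b dL in auto)
  then show "deriv L differentiable (at b)" "deriv (deriv L) b = D' b"
    unfolding real_differentiable_def by (blast, rule DERIV_imp_deriv)
qed

lemma nome_powers:
  "exp (- 2 * pi * b) ^ 2 = exp (- 2 * pi * (2 * b))" "exp (- 2 * pi * b) ^ 4 = exp (- 2 * pi * (4 * b))"
  unfolding exp_power_nat by simp_all

lemma ln_euler_prod: "ln (euler_prod x) = - euler_log x"
  by (simp add: euler_prod_def)

text \<open>The Lambert series as a function of \<open>b\<close>, where replacing \<open>b\<close> by \<open>2b\<close> or \<open>4b\<close> squares the nome once or twice.\<close>
definition lambert_nome :: "real \<Rightarrow> real" where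
  "lambert_nome b = lambert_sigma (exp (- 2 * pi * b))"

lemma has_real_derivative_euler_log_scaled:
  assumes "c > 0" "b > 0"
  shows "((\<lambda>b. euler_log (exp (- 2 * pi * (c * b)))) has_real_derivative - 2 * pi * c * lambert_nome (c * b)) (at b)"
proof -
  have "((\<lambda>b. c * b) has_real_derivative c) (at b)" by (auto intro!: derivative_eq_intros)
  from DERIV_chain2[OF has_real_derivative_euler_log this] assms
  show ?thesis by (simp add: lambert_nome_def mult_ac)
qed

text \<open>The derivatives of \<open>log |\<vartheta>\<^sub>2(0)|\<close> and \<open>log |\<vartheta>\<^sub>3(0)|\<close> along \<open>\<tau> = 1/2 + ib\<close>, as obtained from the eta quotients.\<close>
definition dlog_theta2 :: "real \<Rightarrow> real" where
  "dlog_theta2 b = - pi / 4 + 2 * pi * (lambert_nome b - 2 * lambert_nome (2 * b) + 4 * lambert_nome (4 * b))"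

definition dlog_theta3 :: "real \<Rightarrow> real" where
  "dlog_theta3 b = 2 * pi * (- 2 * lambert_nome b + 10 * lambert_nome (2 * b) - 8 * lambert_nome (4 * b))"

lemma has_real_derivative_log_theta2:
  assumes b: "b > 0"
  shows "((\<lambda>b. ln (norm (theta2 0 (half_tau b)))) has_real_derivative dlog_theta2 b) (at b)"
proof (rule has_field_derivative_transform_within_open[where S = "{0<..}"])
  let ?el = "\<lambda>c b. euler_log (exp (- 2 * pi * (c * b)))"
  show "((\<lambda>b. ln 2 - pi * b / 4 - ?el 1 b - ?el 4 b + ?el 2 b) has_real_derivative dlog_theta2 b) (at b)"
  proof (rule DERIV_cong)
    have combine: "((\<lambda>b. ln 2 - pi * b / 4 - f1 b - f4 b + f2 b) has_real_derivative - pi / 4 - d1 - d4 + d2) (at b)"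
      if "(f1 has_real_derivative d1) (at b)" "(f4 has_real_derivative d4) (at b)" "(f2 has_real_derivative d2) (at b)"
      for f1 f2 f4 d1 d2 d4
      using that by (auto intro!: derivative_eq_intros)
    show "((\<lambda>b. ln 2 - pi * b / 4 - ?el 1 b - ?el 4 b + ?el 2 b) has_real_derivative
        - pi / 4 - (- 2 * pi * 1 * lambert_nome (1 * b)) - (- 2 * pi * 4 * lambert_nome (4 * b)) + (- 2 * pi * 2 * lambert_nome (2 * b))) (at b)"
      by (intro combine has_real_derivative_euler_log_scaled b) simp_all
  qed (simp add: dlog_theta2_def algebra_simps)
  fix c :: real assume "c \<in> {0<..}"
  then have c: "c > 0" by simp
  show "ln 2 - pi * c / 4 - ?el 1 c - ?el 4 c + ?el 2 c = ln (norm (theta2 0 (half_tau c)))"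
    unfolding norm_theta2_half_tau[OF c] nome_powers
    using euler_prod_pos by (simp add: ln_mult ln_div ln_euler_prod less_imp_neq[symmetric])
qed (use b in auto)

lemma has_real_derivative_log_theta3:
  assumes b: "b > 0"
  shows "((\<lambda>b. ln (norm (theta3 0 (half_tau b)))) has_real_derivative dlog_theta3 b) (at b)"
proof (rule has_field_derivative_transform_within_open[where S = "{0<..}"])
  let ?el = "\<lambda>c b. euler_log (exp (- 2 * pi * (c * b)))"
  show "((\<lambda>b. 2 * ?el 1 b + 2 * ?el 4 b - 5 * ?el 2 b) has_real_derivative dlog_theta3 b) (at b)"
  proof (rule DERIV_cong)
    have combine: "((\<lambda>b. 2 * f1 b + 2 * f4 b - 5 * f2 b) has_real_derivative 2 * d1 + 2 * d4 - 5 * d2) (at b)"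
      if "(f1 has_real_derivative d1) (at b)" "(f4 has_real_derivative d4) (at b)" "(f2 has_real_derivative d2) (at b)"
      for f1 f2 f4 d1 d2 d4
      using that by (auto intro!: derivative_eq_intros)
    show "((\<lambda>b. 2 * ?el 1 b + 2 * ?el 4 b - 5 * ?el 2 b) has_real_derivative
        2 * (- 2 * pi * 1 * lambert_nome (1 * b)) + 2 * (- 2 * pi * 4 * lambert_nome (4 * b)) - 5 * (- 2 * pi * 2 * lambert_nome (2 * b))) (at b)"
      by (intro combine has_real_derivative_euler_log_scaled b) simp_all
  qed (simp add: dlog_theta3_def algebra_simps)
  fix c :: real assume "c \<in> {0<..}"
  then have c: "c > 0" by simp
  show "2 * ?el 1 c + 2 * ?el 4 c - 5 * ?el 2 c = ln (norm (theta3 0 (half_tau c)))"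
    unfolding norm_theta3_half_tau[OF c] theta_null_eta_quotient[OF exp_neg_bounds[OF c]] nome_powers
    using euler_prod_pos by (simp add: ln_mult ln_div ln_realpow ln_euler_prod less_imp_neq[symmetric])
qed (use b in auto)

lemma dlog_theta2_decreasing:
  obtains D' where "\<And>b. b > 0 \<Longrightarrow> (dlog_theta2 has_real_derivative D' b) (at b)" "\<And>b. b > 0 \<Longrightarrow> D' b < 0"
proof
  let ?J = "{m \<in> {1::nat..}. odd m \<or> 4 dvd m} \<times> {1::nat..}"
  let ?a = "\<lambda>(m::nat, n::nat). real m"
  have J: "exp_summable ?J ?a pair_freq"
    by (rule exp_summable_subset[OF lambert_exp_sum(1)]) auto
  define D' where "D' = (\<lambda>b. - 2 * pi * exp_sum ?J (\<lambda>p. pair_freq p * ?a p) pair_freq b)"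
  fix b :: real assume b: "b > 0"
  have "(dlog_theta2 has_real_derivative 2 * pi * (- exp_sum ?J (\<lambda>p. pair_freq p * ?a p) pair_freq b)) (at b)"
  proof (rule has_field_derivative_transform_within_open[where S = "{0<..}"])
    show "((\<lambda>b. - pi / 4 + 2 * pi * exp_sum ?J ?a pair_freq b) has_real_derivative
            2 * pi * (- exp_sum ?J (\<lambda>p. pair_freq p * ?a p) pair_freq b)) (at b)"
      by (rule DERIV_cong[OF DERIV_add[OF DERIV_const DERIV_cmult[OF has_real_derivative_exp_sum[OF J b]]]]) simp
    fix c :: real assume "c \<in> {0<..}"
    then have c: "c > 0" by simp
    show "- pi / 4 + 2 * pi * exp_sum ?J ?a pair_freq c = dlog_theta2 c"
      unfolding lambert_combination_exp_sum[OF c, symmetric] nome_powers dlog_theta2_def lambert_nome_def ..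
  qed (use b in auto)
  then show "(dlog_theta2 has_real_derivative D' b) (at b)" by (simp add: D'_def)
  have "0 < exp_sum ?J (\<lambda>p. pair_freq p * ?a p) pair_freq b"
    by (rule exp_sum_pos[OF exp_summable_mult[OF J] b, of "(1, 1)"]) (auto simp: pair_freq_def)
  then show "D' b < 0" by (simp add: D'_def)
qed

text \<open>The Lambert series representation does not show these signs. They come from the other description
  \<open>|\<vartheta>\<^sub>3| = \<Sum>j\<in>\<int>. exp (-2\<pi>b j\<^sup>2)\<close>: it is decreasing in \<open>b\<close> and strictly log-convex.\<close>
lemma dlog_theta3_negative_increasing:
  obtains D' where "\<And>b. b > 0 \<Longrightarrow> (dlog_theta3 has_real_derivative D' b) (at b)" "\<And>b. b > 0 \<Longrightarrow> D' b > 0"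
    "\<And>b. b > 0 \<Longrightarrow> dlog_theta3 b < 0"
proof
  let ?l = "\<lambda>j::int. 2 * pi * of_int (j * j)"
  define S0 where "S0 = exp_sum UNIV (\<lambda>j::int. 1) ?l"
  define S1 where "S1 = exp_sum UNIV (\<lambda>j. ?l j * 1) ?l"
  define S2 where "S2 = exp_sum UNIV (\<lambda>j. ?l j * (?l j * 1)) ?l"
  note s = theta_null_exp_sum(1)
  have pos: "S0 b > 0" "S1 b > 0" if "b > 0" for b
    unfolding S0_def S1_def
    by (rule exp_sum_pos[OF s that, of 0]; simp) (rule exp_sum_pos[OF exp_summable_mult[OF s] that, of 1]; simp)
  have d0: "(S0 has_real_derivative - S1 b) (at b)" and d1: "(S1 has_real_derivative - S2 b) (at b)" if "b > 0" for b
    unfolding S0_def S1_def S2_def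
    by (rule has_real_derivative_exp_sum[OF s that] has_real_derivative_exp_sum[OF exp_summable_mult[OF s] that])+
  have D: "dlog_theta3 b = - S1 b / S0 b" if b: "b > 0" for b
  proof (rule DERIV_unique[OF has_real_derivative_log_theta3[OF b]])
    have "((\<lambda>b. ln (S0 b)) has_real_derivative - S1 b / S0 b) (at b)"
      using d0[OF b] pos[OF b] by (auto intro!: derivative_eq_intros)
    then show "((\<lambda>b. ln (norm (theta3 0 (half_tau b)))) has_real_derivative - S1 b / S0 b) (at b)"
    proof (rule has_field_derivative_transform_within_open[where S = "{0<..}"])
      fix c :: real assume "c \<in> {0<..}"
      then have c: "c > 0" by simp
      show "ln (S0 c) = ln (norm (theta3 0 (half_tau c)))"
        by (simp only: S0_def norm_theta3_half_tau[OF c] theta_null_exp_sum(2))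
    qed (use b in auto)
  qed
  fix b :: real assume b: "b > 0"
  show "dlog_theta3 b < 0" using pos[OF b] by (simp add: D[OF b])
  have "((\<lambda>b. - S1 b / S0 b) has_real_derivative (S2 b * S0 b - (S1 b)\<^sup>2) / (S0 b)\<^sup>2) (at b)"
    using d0[OF b] d1[OF b] pos[OF b]
    by (auto intro!: derivative_eq_intros simp: power2_eq_square diff_divide_distrib)
  then show "(dlog_theta3 has_real_derivative (S2 b * S0 b - (S1 b)\<^sup>2) / (S0 b)\<^sup>2) (at b)"
    by (rule has_field_derivative_transform_within_open[where S = "{0<..}"]) (use b D in auto)
  have "(S1 b)\<^sup>2 < S2 b * S0 b"
    unfolding S0_def S1_def S2_def by (rule exp_sum_log_convex[OF s b, of 0 1]) auto
  then show "(S2 b * S0 b - (S1 b)\<^sup>2) / (S0 b)\<^sup>2 > 0" using pos[OF b] by simp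
qed

lemma lambert_sigma_half_tau:
  assumes b: "b > 0"
  defines "Q \<equiv> exp (2 * of_real pi * \<i> * half_tau b)"
  shows "lambert_sigma Q = of_real (- lambert_nome b + 6 * lambert_nome (2 * b) - 4 * lambert_nome (4 * b))"
    "lambert_sigma (Q\<^sup>2) = of_real (lambert_nome (2 * b))"
proof -
  define x where "x = exp (- 2 * pi * b)"
  have x: "0 < x" "x < 1" using exp_neg_bounds[OF b] by (simp_all only: x_def)
  have Q: "Q = of_real (- x)" by (simp only: Q_def nome_half_tau x_def of_real_minus)
  have "lambert_sigma Q = of_real (lambert_sigma (- x))"
    unfolding Q using x by (intro lambert_sigma_of_real) auto
  also have "lambert_sigma (- x) = - lambert_sigma x + 6 * lambert_sigma (x\<^sup>2) - 4 * lambert_sigma (x ^ 4)"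
    using x by (intro lambert_sigma_minus) auto
  finally show "lambert_sigma Q = of_real (- lambert_nome b + 6 * lambert_nome (2 * b) - 4 * lambert_nome (4 * b))"
    by (simp only: lambert_nome_def x_def nome_powers)
  have "Q\<^sup>2 = of_real (x\<^sup>2)" by (simp add: Q)
  moreover have "\<bar>x\<^sup>2\<bar> < 1" using x by (simp add: power_less_one_iff)
  ultimately have "lambert_sigma (Q\<^sup>2) = of_real (lambert_sigma (x\<^sup>2))"
    using lambert_sigma_of_real by metis
  then show "lambert_sigma (Q\<^sup>2) = of_real (lambert_nome (2 * b))"
    by (simp only: lambert_nome_def x_def nome_powers)
qed

theorem e1_plus_eta1_half_tau:
  assumes b: "b > 0"
  shows "weierstrass_e1 (half_tau b) + weierstrass_eta1 (half_tau b) = of_real (- 4 * pi * dlog_theta2 b)"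
proof -
  have "Im (half_tau b) > 0" using b by (simp add: half_tau_def)
  from weierstrass_e1_plus_eta1_eq_lambert_sigma[OF this] show ?thesis
    unfolding lambert_sigma_half_tau[OF b] dlog_theta2_def
    by (simp add: algebra_simps power2_eq_square)
qed

text \<open>In \<open>(e\<^sub>1 + \<eta>\<^sub>1) / 2 - 3 \<eta>\<^sub>1 / 2\<close> the constants \<open>\<pi>\<^sup>2 / 2\<close> cancel, leaving
  \<open>16 \<pi>\<^sup>2 (\<Lambda>(Q) - \<Lambda>(Q\<^sup>2))\<close>; rewriting \<open>\<Lambda>\<close> at \<open>Q = -x\<close> gives the combination for \<open>\<vartheta>\<^sub>3\<close>.\<close>
theorem half_e1_minus_eta1_half_tau:
  assumes b: "b > 0"
  shows "1 / 2 * weierstrass_e1 (half_tau b) - weierstrass_eta1 (half_tau b) = of_real (4 * pi * dlog_theta3 b)"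
proof -
  have Im: "Im (half_tau b) > 0" using b by (simp add: half_tau_def)
  have "1 / 2 * weierstrass_e1 (half_tau b) - weierstrass_eta1 (half_tau b) =
        1 / 2 * (weierstrass_e1 (half_tau b) + weierstrass_eta1 (half_tau b)) - 3 / 2 * weierstrass_eta1 (half_tau b)"
    by (simp add: algebra_simps)
  also have "\<dots> = 1 / 2 * of_real (- 4 * pi * dlog_theta2 b) - 3 / 2 * weierstrass_eta1 (half_tau b)"
    by (simp only: e1_plus_eta1_half_tau[OF b])
  also have "\<dots> = of_real (4 * pi * dlog_theta3 b)"
    unfolding weierstrass_eta1_eq_lambert_sigma[OF Im] lambert_sigma_half_tau[OF b] dlog_theta2_def dlog_theta3_def
    by (simp add: field_simps power2_eq_square)
  finally show ?thesis .
qed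

text \<open>From \<open>3 e\<^sub>1 / 2 = (e\<^sub>1 + \<eta>\<^sub>1) + (e\<^sub>1 / 2 - \<eta>\<^sub>1)\<close>. Both summands increase in \<open>b\<close>, hence so does \<open>e\<^sub>1\<close>.\<close>
theorem e1_half_tau:
  assumes b: "b > 0"
  shows "weierstrass_e1 (half_tau b) = of_real (2 / 3 * (4 * pi * dlog_theta3 b - 4 * pi * dlog_theta2 b))"
proof -
  have "weierstrass_e1 (half_tau b) = 2 / 3 * ((1 / 2 * weierstrass_e1 (half_tau b) - weierstrass_eta1 (half_tau b)) +
            (weierstrass_e1 (half_tau b) + weierstrass_eta1 (half_tau b)))"
    by (simp add: field_simps)
  then show ?thesis
    unfolding e1_plus_eta1_half_tau[OF b] half_e1_minus_eta1_half_tau[OF b] by simp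
qed

theorem theorem1p7:
  fixes \<tau> e1 \<eta>1 :: "real \<Rightarrow> complex" and L2 L3 L4 :: "real \<Rightarrow> real"
  assumes "\<tau> = (\<lambda>b. 1 / 2 + \<i> * of_real b)"
    and "e1 = (\<lambda>b. weierstrass_e1 (\<tau> b))"
    and "\<eta>1 = (\<lambda>b. weierstrass_eta1 (\<tau> b))"
    and "L2 = (\<lambda>b. ln (norm (theta2 0 (\<tau> b))))"
    and "L3 = (\<lambda>b. ln (norm (theta3 0 (\<tau> b))))"
    and "L4 = (\<lambda>b. ln (norm (theta4 0 (\<tau> b))))"
  shows
    "(\<forall>b>0. e1 b \<in> \<real> \<and> \<eta>1 b \<in> \<real> \<and>
        theta2 0 (\<tau> b) \<noteq> 0 \<and> theta3 0 (\<tau> b) \<noteq> 0 \<and> theta4 0 (\<tau> b) \<noteq> 0) \<and>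
     (\<forall>b>0. L2 differentiable (at b) \<and> deriv L2 differentiable (at b) \<and>
        ((\<lambda>b. e1 b + \<eta>1 b) has_vector_derivative of_real (- 4 * pi * deriv (deriv L2) b)) (at b) \<and>
        - 4 * pi * deriv (deriv L2) b > 0) \<and>
     (\<forall>b>0. L3 differentiable (at b) \<and> deriv L3 differentiable (at b) \<and>
        1 / 2 * e1 b - \<eta>1 b = of_real (4 * pi * deriv L3 b) \<and>
        4 * pi * deriv L3 b < 0 \<and>
        deriv (deriv L3) b > 0) \<and>
     (\<forall>b>0. theta4 0 (\<tau> b) = cnj (theta3 0 (\<tau> b)) \<and>
        L4 differentiable (at b) \<and> deriv L4 differentiable (at b) \<and>
        1 / 2 * e1 b - \<eta>1 b = of_real (4 * pi * deriv L4 b) \<and>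
        4 * pi * deriv L4 b < 0 \<and>
        deriv (deriv L4) b > 0) \<and>
     strict_mono_on {0<..} (\<lambda>b. Re (e1 b))"
proof -
  have \<tau>: "\<tau> = half_tau" by (simp add: assms(1) half_tau_def fun_eq_iff)
  have e1: "e1 = (\<lambda>b. weierstrass_e1 (half_tau b))" and \<eta>1: "\<eta>1 = (\<lambda>b. weierstrass_eta1 (half_tau b))"
    and L2: "L2 = (\<lambda>b. ln (norm (theta2 0 (half_tau b))))"
    and L3: "L3 = (\<lambda>b. ln (norm (theta3 0 (half_tau b))))"
    and L4: "L4 = (\<lambda>b. ln (norm (theta4 0 (half_tau b))))"
    using assms(2-6) unfolding \<tau> by simp_all
  obtain D2' where D2': "\<And>b. b > 0 \<Longrightarrow> (dlog_theta2 has_real_derivative D2' b) (at b)" "\<And>b. b > 0 \<Longrightarrow> D2' b < 0"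
    by (rule dlog_theta2_decreasing) blast
  obtain D3' where D3': "\<And>b. b > 0 \<Longrightarrow> (dlog_theta3 has_real_derivative D3' b) (at b)" "\<And>b. b > 0 \<Longrightarrow> D3' b > 0"
     "\<And>b. b > 0 \<Longrightarrow> dlog_theta3 b < 0"
    by (rule dlog_theta3_negative_increasing) blast
  have dL2: "(L2 has_real_derivative dlog_theta2 b) (at b)" if "b > 0" for b
    unfolding L2 by (rule has_real_derivative_log_theta2[OF that])
  have dL3: "(L3 has_real_derivative dlog_theta3 b) (at b)" if "b > 0" for b
    unfolding L3 by (rule has_real_derivative_log_theta3[OF that])
  have dL4: "(L4 has_real_derivative dlog_theta3 b) (at b)" if b: "b > 0" for b
    by (rule has_field_derivative_transform_within_open[OF dL3[OF b], of "{0<..}"])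
       (use b in \<open>auto simp: L3 L4 theta4_half_tau\<close>)
  have twice2: "L2 differentiable (at b)" "deriv L2 b = dlog_theta2 b"
    "deriv L2 differentiable (at b)" "deriv (deriv L2) b = D2' b" if "b > 0" for b
    using second_derivative_on_positive_reals[OF dL2 D2'(1) that] by blast+
  have twice3: "L3 differentiable (at b)" "deriv L3 b = dlog_theta3 b"
    "deriv L3 differentiable (at b)" "deriv (deriv L3) b = D3' b" if "b > 0" for b
    using second_derivative_on_positive_reals[OF dL3 D3'(1) that] by blast+
  have twice4: "L4 differentiable (at b)" "deriv L4 b = dlog_theta3 b"
    "deriv L4 differentiable (at b)" "deriv (deriv L4) b = D3' b" if "b > 0" for b
    using second_derivative_on_positive_reals[OF dL4 D3'(1) that] by blast+

  have basic: "e1 b \<in> \<real> \<and> \<eta>1 b \<in> \<real> \<and> theta2 0 (half_tau b) \<noteq> 0 \<and> theta3 0 (half_tau b) \<noteq> 0 \<and> theta4 0 (half_tau b) \<noteq> 0"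
    if b: "b > 0" for b
  proof -
    have e: "e1 b \<in> \<real>" unfolding e1 e1_half_tau[OF b] by (rule Reals_of_real)
    have "\<eta>1 b = of_real (- 4 * pi * dlog_theta2 b) - e1 b"
      using e1_plus_eta1_half_tau[OF b] by (simp add: e1 \<eta>1 algebra_simps)
    then have \<eta>: "\<eta>1 b \<in> \<real>" using e by (metis Reals_diff Reals_of_real)
    have "norm (theta2 0 (half_tau b)) > 0"
      unfolding norm_theta2_half_tau[OF b]
      by (intro divide_pos_pos mult_pos_pos euler_prod_pos) simp_all
    moreover have "norm (theta3 0 (half_tau b)) > 0"
      unfolding norm_theta3_half_tau[OF b] theta_null_eta_quotient[OF exp_neg_bounds[OF b]]
      by (intro divide_pos_pos mult_pos_pos zero_less_power euler_prod_pos)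
    ultimately show ?thesis using e \<eta> by (simp add: theta4_half_tau[OF b])
  qed
  have vec: "((\<lambda>b. e1 b + \<eta>1 b) has_vector_derivative of_real (- 4 * pi * D2' b)) (at b)" if b: "b > 0" for b
  proof (rule has_vector_derivative_transform_within_open[of _ _ _ "{0<..}"])
    have "((\<lambda>b. - 4 * pi * dlog_theta2 b) has_real_derivative - 4 * pi * D2' b) (at b)"
      by (rule DERIV_cmult[OF D2'(1)[OF b]])
    then show "((\<lambda>b. complex_of_real (- 4 * pi * dlog_theta2 b)) has_vector_derivative of_real (- 4 * pi * D2' b)) (at b)"
      by (rule has_vector_derivative_of_real)
    show "complex_of_real (- 4 * pi * dlog_theta2 c) = e1 c + \<eta>1 c" if "c \<in> {0<..}" for c
      using that e1_plus_eta1_half_tau[of c] by (simp add: e1 \<eta>1)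
  qed (use b in auto)
  have pos2: "- 4 * pi * D2' b > 0" if "b > 0" for b
    using D2'(2)[OF that] by (simp add: mult_less_0_iff)
  have half: "1 / 2 * e1 b - \<eta>1 b = of_real (4 * pi * dlog_theta3 b)" if "b > 0" for b
    unfolding e1 \<eta>1 by (rule half_e1_minus_eta1_half_tau[OF that])
  have neg3: "4 * pi * dlog_theta3 b < 0" if "b > 0" for b
    using D3'(3)[OF that] by (simp add: mult_less_0_iff)
  have mono: "strict_mono_on {0<..} (\<lambda>b. Re (e1 b))"
  proof (rule strict_mono_onI)
    fix r s :: real assume rs: "r \<in> {0<..}" "s \<in> {0<..}" "r < s"
    define f where "f = (\<lambda>b. 2 / 3 * (4 * pi * dlog_theta3 b - 4 * pi * dlog_theta2 b))"
    have "f r < f s"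
    proof (rule DERIV_pos_imp_increasing[OF \<open>r < s\<close>])
      fix c assume "r \<le> c" "c \<le> s"
      then have c: "c > 0" using rs by simp
      have "(f has_real_derivative 2 / 3 * (4 * pi * D3' c - 4 * pi * D2' c)) (at c)"
        unfolding f_def by (intro DERIV_cmult DERIV_diff D2'(1) D3'(1) c)
      moreover have "2 / 3 * (4 * pi * D3' c - 4 * pi * D2' c) > 0"
        using D2'(2)[OF c] D3'(2)[OF c] by simp
      ultimately show "\<exists>y. (f has_real_derivative y) (at c) \<and> 0 < y" by blast
    qed
    then show "Re (e1 r) < Re (e1 s)"
      using rs by (simp add: e1 e1_half_tau f_def)
  qed
  show ?thesis
    unfolding \<tau>
  proof (rule conjI[OF _ conjI[OF _ conjI[OF _ conjI]]]; (intro allI impI)?)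
    fix b :: real assume b: "b > 0"
    show "e1 b \<in> \<real> \<and> \<eta>1 b \<in> \<real> \<and> theta2 0 (half_tau b) \<noteq> 0 \<and> theta3 0 (half_tau b) \<noteq> 0 \<and> theta4 0 (half_tau b) \<noteq> 0"
      by (rule basic[OF b])
    show "L2 differentiable (at b) \<and> deriv L2 differentiable (at b) \<and>
        ((\<lambda>b. e1 b + \<eta>1 b) has_vector_derivative of_real (- 4 * pi * deriv (deriv L2) b)) (at b) \<and>
        - 4 * pi * deriv (deriv L2) b > 0"
      unfolding twice2(4)[OF b] by (intro conjI twice2[OF b] vec[OF b] pos2[OF b])
    show "L3 differentiable (at b) \<and> deriv L3 differentiable (at b) \<and>
        1 / 2 * e1 b - \<eta>1 b = of_real (4 * pi * deriv L3 b) \<and> 4 * pi * deriv L3 b < 0 \<and> deriv (deriv L3) b > 0"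
      unfolding twice3(2,4)[OF b] by (intro conjI twice3[OF b] half[OF b] neg3[OF b] D3'(2)[OF b])
    show "theta4 0 (half_tau b) = cnj (theta3 0 (half_tau b)) \<and>
        L4 differentiable (at b) \<and> deriv L4 differentiable (at b) \<and>
        1 / 2 * e1 b - \<eta>1 b = of_real (4 * pi * deriv L4 b) \<and> 4 * pi * deriv L4 b < 0 \<and> deriv (deriv L4) b > 0"
      unfolding twice4(2,4)[OF b]
      by (intro conjI theta4_half_tau[OF b] twice4[OF b] half[OF b] neg3[OF b] D3'(2)[OF b])
  qed (rule mono)
qed

end
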